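(* Let $k$ be an infinite field, let $H$ be a Hopf algebra over $k$, and let $A$ be an $H$-comodule algebra with coinvariant subalgebra $B=A^H$ such that (i) $B$ is central in $A$, and (ii) there is a $B$-linear $H$-comodule isomorphism $u: B\otimes H\to A$, where $B\otimes H$ carries the coaction $\mathrm{id}_B\otimes\Delta$. Let $I_H(A)\subset T(X_H)$ be the ideal of $H$-identities for $A$ and let $\mathcal U_H(A)=T(X_H)/I_H(A)$. Then: (a) The algebra morphism $\mu_A: T(X_H)\to S(t_H)\otimes A$ determined by $\mu_A(X_h)=\sum_{(h)} t_{h_{(1)}}\otimes u(1_B\otimes h_{(2)})$ for all $h\in H$ induces an injective $H$-comodule algebra morphism $\mathcal U_H(A)\hookrightarrow S(t_H)\otimes A$. (b) $\mathcal U_H^0(A)\cong k$ and $\mathcal U_H^1(A)\cong X_H$, where $\mathcal U_H^r(A)$ denotes the image of $T^r(X_H)$ in $\mathcal U_H(A)$.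
   Context: All algebras are associative unital $k$-algebras, and unadorned tensor products are over $k$. $\Delta$ and $\varepsilon$ are the comultiplication and counit of $H$, with Sweedler notation $\Delta(h)=\sum_{(h)}h_{(1)}\otimes h_{(2)}$. An $H$-comodule algebra is an algebra $A$ with a right $H$-comodule structure whose coaction $\delta:A\to A\otimes H$ is an algebra morphism; $A^H=\{a\in A\mid \delta(a)=a\otimes 1\}$. An $H$-comodule algebra morphism is an algebra morphism that is also a comodule map. $X_H$ is a copy of the vector space $H$, with identity map $h\mapsto X_h$; the tensor algebra $T(X_H)=\bigoplus_{r\ge0}T^r(X_H)$ is an $H$-comodule algebra whose coaction is the algebra morphism determined by $\delta(X_h)=\sum_{(h)}X_{h_{(1)}}\otimes h_{(2)}$. $t_H$ is another copy of $H$, with identity map $h\mapsto t_h$, and $S(t_H)$ is its symmetric algebra over $k$. $S(t_H)\otimes A$ is an $H$-comodule algebra with coaction $\mathrm{id}_{S(t_H)}\otimes\delta$. An element $P\in T(X_H)$ is an $H$-identity for $A$ if $\mu(P)=0$ for all $H$-comodule algebra morphisms $\mu:T(X_H)\to A$. The set $I_H(A)$ of $H$-identities is a two-sided ideal and satisfies $\delta(I_H(A))\subset I_H(A)\otimes H$, so $\mathcal U_H(A)$ is an $H$-comodule algebra with the quotient coaction. *)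

theory Defs
  imports "HOL-Algebra.Module" "HOL-Algebra.QuotRing"
begin

section \<open>Algebras over a field\<close>

text \<open>
  The record type of \<^locale>\<open>module\<close> extends that of rings, so it also carries the data of an
  algebra.  The library locale \<^locale>\<open>algebra\<close> only covers commutative algebras.
\<close>

locale assoc_algebra = K?: field K + module K A + A?: ring A for K (structure) and A (structure) +
  assumes smult_mult_left:
      "\<lbrakk> c \<in> carrier K; x \<in> carrier A; y \<in> carrier A \<rbrakk>
        \<Longrightarrow> (c \<odot>\<^bsub>A\<^esub> x) \<otimes>\<^bsub>A\<^esub> y = c \<odot>\<^bsub>A\<^esub> (x \<otimes>\<^bsub>A\<^esub> y)"
    and smult_mult_right:
      "\<lbrakk> c \<in> carrier K; x \<in> carrier A; y \<in> carrier A \<rbrakk>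
        \<Longrightarrow> x \<otimes>\<^bsub>A\<^esub> (c \<odot>\<^bsub>A\<^esub> y) = c \<odot>\<^bsub>A\<^esub> (x \<otimes>\<^bsub>A\<^esub> y)"

definition base_algebra :: "'k ring \<Rightarrow> ('k, 'k) module" where
  "base_algebra K = \<lparr>carrier = carrier K, mult = mult K, one = one K, zero = zero K, add = add K,
     smult = mult K\<rparr>"

definition linear_maps :: "'k ring \<Rightarrow> ('k, 'v) module \<Rightarrow> ('k, 'w) module \<Rightarrow> ('v \<Rightarrow> 'w) set" where
  "linear_maps K V W = {f. f \<in> carrier V \<rightarrow> carrier W \<and>
     (\<forall>x\<in>carrier V. \<forall>y\<in>carrier V. f (x \<oplus>\<^bsub>V\<^esub> y) = f x \<oplus>\<^bsub>W\<^esub> f y) \<and>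
     (\<forall>c\<in>carrier K. \<forall>x\<in>carrier V. f (c \<odot>\<^bsub>V\<^esub> x) = c \<odot>\<^bsub>W\<^esub> f x)}"

definition alg_hom :: "'k ring \<Rightarrow> ('k, 'v) module \<Rightarrow> ('k, 'w) module \<Rightarrow> ('v \<Rightarrow> 'w) set" where
  "alg_hom K A B = ring_hom A B \<inter> linear_maps K A B"

definition module_span :: "'k ring \<Rightarrow> ('k, 'v) module \<Rightarrow> 'v set \<Rightarrow> 'v set" where
  "module_span K V R = \<Inter>{N. submodule N K V \<and> R \<subseteq> N}"

text \<open>
  \<open>V Quot N\<close> of the library together with the induced scalar multiplication.  The additive and
  scalar structure only require \<open>N\<close> to be a submodule; the multiplication is meaningful if \<open>N\<close> is
  moreover a two-sided ideal.
\<close>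

definition quot_algebra :: "('k, 'v) module \<Rightarrow> 'v set \<Rightarrow> ('k, 'v set) module" where
  "quot_algebra V N = \<lparr>carrier = a_rcosets\<^bsub>V\<^esub> N, mult = rcoset_mult V N,
     one = N +>\<^bsub>V\<^esub> \<one>\<^bsub>V\<^esub>, zero = N, add = set_add V,
     smult = (\<lambda>c X. \<Union>x\<in>X. N +>\<^bsub>V\<^esub> (c \<odot>\<^bsub>V\<^esub> x))\<rparr>"

section \<open>Monoid algebras and linear extension\<close>

text \<open>
  The monoid algebra \<open>K[M]\<close>; as a vector space it is the free vector space on the carrier of \<open>M\<close>,
  realised as finitely supported functions.
\<close>

definition monoid_algebra :: "'k ring \<Rightarrow> 'x monoid \<Rightarrow> ('k, 'x \<Rightarrow> 'k) module" where
  "monoid_algebra K M = \<lparr>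
     carrier = {p. range p \<subseteq> carrier K \<and> finite {x. p x \<noteq> \<zero>\<^bsub>K\<^esub>} \<and> {x. p x \<noteq> \<zero>\<^bsub>K\<^esub>} \<subseteq> carrier M},
     mult = (\<lambda>p q z. finsum K (\<lambda>(x, y). p x \<otimes>\<^bsub>K\<^esub> q y)
               {(x, y). p x \<noteq> \<zero>\<^bsub>K\<^esub> \<and> q y \<noteq> \<zero>\<^bsub>K\<^esub> \<and> x \<otimes>\<^bsub>M\<^esub> y = z}),
     one = (\<lambda>x. if x = \<one>\<^bsub>M\<^esub> then \<one>\<^bsub>K\<^esub> else \<zero>\<^bsub>K\<^esub>),
     zero = (\<lambda>x. \<zero>\<^bsub>K\<^esub>),
     add = (\<lambda>p q x. p x \<oplus>\<^bsub>K\<^esub> q x),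
     smult = (\<lambda>c p x. c \<otimes>\<^bsub>K\<^esub> p x)\<rparr>"

definition basis_elem :: "'k ring \<Rightarrow> 'x \<Rightarrow> 'x \<Rightarrow> 'k" where
  "basis_elem K x = (\<lambda>y. if y = x then \<one>\<^bsub>K\<^esub> else \<zero>\<^bsub>K\<^esub>)"

definition lin_ext :: "'k ring \<Rightarrow> ('k, 'z) module \<Rightarrow> ('x \<Rightarrow> 'z) \<Rightarrow> ('x \<Rightarrow> 'k) \<Rightarrow> 'z" where
  "lin_ext K Z f p = finsum Z (\<lambda>x. p x \<odot>\<^bsub>Z\<^esub> f x) {x. p x \<noteq> \<zero>\<^bsub>K\<^esub>}"

section \<open>Tensor products\<close>

text \<open>
  \<open>V \<otimes> W\<close> is the free vector space on \<open>V \<times> W\<close> modulo the subspace spanned by the bilinearity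
  relations.  Starting from the monoid algebra of the product of the multiplicative monoids makes
  it carry the product \<open>(v \<otimes> w) (v' \<otimes> w') = v v' \<otimes> w w'\<close> when \<open>V\<close> and \<open>W\<close> are algebras.
\<close>

definition tensor_free ::
  "'k ring \<Rightarrow> ('k, 'v) module \<Rightarrow> ('k, 'w) module \<Rightarrow> ('k, 'v \<times> 'w \<Rightarrow> 'k) module" where
  "tensor_free K V W = monoid_algebra K (V \<times>\<times> W)"

definition tensor_rels ::
  "'k ring \<Rightarrow> ('k, 'v) module \<Rightarrow> ('k, 'w) module \<Rightarrow> ('v \<times> 'w \<Rightarrow> 'k) set" where
  "tensor_rels K V W = (let F = tensor_free K V W; e = basis_elem K in
     {e (v \<oplus>\<^bsub>V\<^esub> v', w) \<ominus>\<^bsub>F\<^esub> (e (v, w) \<oplus>\<^bsub>F\<^esub> e (v', w)) | v v' w.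
        v \<in> carrier V \<and> v' \<in> carrier V \<and> w \<in> carrier W} \<union>
     {e (v, w \<oplus>\<^bsub>W\<^esub> w') \<ominus>\<^bsub>F\<^esub> (e (v, w) \<oplus>\<^bsub>F\<^esub> e (v, w')) | v w w'.
        v \<in> carrier V \<and> w \<in> carrier W \<and> w' \<in> carrier W} \<union>
     {e (c \<odot>\<^bsub>V\<^esub> v, w) \<ominus>\<^bsub>F\<^esub> c \<odot>\<^bsub>F\<^esub> e (v, w) | c v w.
        c \<in> carrier K \<and> v \<in> carrier V \<and> w \<in> carrier W} \<union>
     {e (v, c \<odot>\<^bsub>W\<^esub> w) \<ominus>\<^bsub>F\<^esub> c \<odot>\<^bsub>F\<^esub> e (v, w) | c v w.
        c \<in> carrier K \<and> v \<in> carrier V \<and> w \<in> carrier W})"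

definition tensor_null ::
  "'k ring \<Rightarrow> ('k, 'v) module \<Rightarrow> ('k, 'w) module \<Rightarrow> ('v \<times> 'w \<Rightarrow> 'k) set" where
  "tensor_null K V W = module_span K (tensor_free K V W) (tensor_rels K V W)"

definition tensor ::
  "'k ring \<Rightarrow> ('k, 'v) module \<Rightarrow> ('k, 'w) module \<Rightarrow> ('k, ('v \<times> 'w \<Rightarrow> 'k) set) module" where
  "tensor K V W = quot_algebra (tensor_free K V W) (tensor_null K V W)"

definition pure_tensor ::
  "'k ring \<Rightarrow> ('k, 'v) module \<Rightarrow> ('k, 'w) module \<Rightarrow> 'v \<Rightarrow> 'w \<Rightarrow> ('v \<times> 'w \<Rightarrow> 'k) set" where
  "pure_tensor K V W v w = tensor_null K V W +>\<^bsub>tensor_free K V W\<^esub> basis_elem K (v, w)"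

text \<open>
  The linear map \<open>V \<otimes> W \<rightarrow> Z\<close> induced by a bilinear map \<open>f\<close>.  Bilinearity makes \<open>lin_ext K Z f\<close>
  constant on each coset \<open>X\<close>, so the image is a singleton.  In Sweedler notation,
  \<open>tensor_lift K Z f (\<Delta> h)\<close> is \<open>\<Sum>\<^sub>(\<^sub>h\<^sub>) f h\<^sub>(\<^sub>1\<^sub>) h\<^sub>(\<^sub>2\<^sub>)\<close>.
\<close>

definition tensor_lift ::
  "'k ring \<Rightarrow> ('k, 'z) module \<Rightarrow> ('v \<Rightarrow> 'w \<Rightarrow> 'z) \<Rightarrow> ('v \<times> 'w \<Rightarrow> 'k) set \<Rightarrow> 'z" where
  "tensor_lift K Z f X = the_elem (lin_ext K Z (\<lambda>(v, w). f v w) ` X)"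

text \<open>\<open>f \<otimes> g\<close>, with codomain \<open>V \<otimes> W\<close>.\<close>

definition tensor_map ::
  "'k ring \<Rightarrow> ('k, 'v) module \<Rightarrow> ('k, 'w) module \<Rightarrow> ('x \<Rightarrow> 'v) \<Rightarrow> ('y \<Rightarrow> 'w)
    \<Rightarrow> ('x \<times> 'y \<Rightarrow> 'k) set \<Rightarrow> ('v \<times> 'w \<Rightarrow> 'k) set" where
  "tensor_map K V W f g = tensor_lift K (tensor K V W) (\<lambda>x y. pure_tensor K V W (f x) (g y))"

text \<open>The associativity isomorphism \<open>V \<otimes> (W \<otimes> Z) \<rightarrow> (V \<otimes> W) \<otimes> Z\<close>.\<close>

definition tensor_assoc ::
  "'k ring \<Rightarrow> ('k, 'v) module \<Rightarrow> ('k, 'w) module \<Rightarrow> ('k, 'z) module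
    \<Rightarrow> ('v \<times> ('w \<times> 'z \<Rightarrow> 'k) set \<Rightarrow> 'k) set \<Rightarrow> (('v \<times> 'w \<Rightarrow> 'k) set \<times> 'z \<Rightarrow> 'k) set" where
  "tensor_assoc K V W Z =
     tensor_lift K (tensor K (tensor K V W) Z) (\<lambda>v.
       tensor_lift K (tensor K (tensor K V W) Z) (\<lambda>w z.
         pure_tensor K (tensor K V W) Z (pure_tensor K V W v w) z))"

section \<open>Tensor algebras and symmetric algebras\<close>

definition word_monoid :: "'v set \<Rightarrow> 'v list monoid" where
  "word_monoid S = \<lparr>carrier = lists S, mult = (@), one = []\<rparr>"

text \<open>
  The tensor algebra is the free algebra on the set \<open>V\<close> modulo the relations of linearity in the
  letters.  The relations are homogeneous in the word length, and the words of length \<open>r\<close> give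
  the free vector space on \<open>V\<^sup>r\<close> modulo multilinearity, that is \<open>T\<^sup>r(V)\<close>.
\<close>

definition word_algebra :: "'k ring \<Rightarrow> ('k, 'v) module \<Rightarrow> ('k, 'v list \<Rightarrow> 'k) module" where
  "word_algebra K V = monoid_algebra K (word_monoid (carrier V))"

definition tensor_algebra_null :: "'k ring \<Rightarrow> ('k, 'v) module \<Rightarrow> ('v list \<Rightarrow> 'k) set" where
  "tensor_algebra_null K V = (let F = word_algebra K V; e = basis_elem K in
     Idl\<^bsub>F\<^esub> ({e [v \<oplus>\<^bsub>V\<^esub> v'] \<ominus>\<^bsub>F\<^esub> (e [v] \<oplus>\<^bsub>F\<^esub> e [v']) | v v'. v \<in> carrier V \<and> v' \<in> carrier V} \<union>
             {e [c \<odot>\<^bsub>V\<^esub> v] \<ominus>\<^bsub>F\<^esub> c \<odot>\<^bsub>F\<^esub> e [v] | c v. c \<in> carrier K \<and> v \<in> carrier V}))"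

definition tensor_algebra :: "'k ring \<Rightarrow> ('k, 'v) module \<Rightarrow> ('k, ('v list \<Rightarrow> 'k) set) module" where
  "tensor_algebra K V = quot_algebra (word_algebra K V) (tensor_algebra_null K V)"

definition tensor_algebra_gen :: "'k ring \<Rightarrow> ('k, 'v) module \<Rightarrow> 'v \<Rightarrow> ('v list \<Rightarrow> 'k) set" where
  "tensor_algebra_gen K V v = tensor_algebra_null K V +>\<^bsub>word_algebra K V\<^esub> basis_elem K [v]"

definition tensor_power :: "'k ring \<Rightarrow> ('k, 'v) module \<Rightarrow> nat \<Rightarrow> ('v list \<Rightarrow> 'k) set set" where
  "tensor_power K V r = {tensor_algebra_null K V +>\<^bsub>word_algebra K V\<^esub> p | p.
     p \<in> carrier (word_algebra K V) \<and> (\<forall>w. p w \<noteq> \<zero>\<^bsub>K\<^esub> \<longrightarrow> length w = r)}"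

text \<open>The algebra morphism \<open>T(V) \<rightarrow> Z\<close> determined by a linear map \<open>f\<close> on \<open>V\<close>.\<close>

definition tensor_algebra_lift ::
  "'k ring \<Rightarrow> ('k, 'z) module \<Rightarrow> ('v \<Rightarrow> 'z) \<Rightarrow> ('v list \<Rightarrow> 'k) set \<Rightarrow> 'z" where
  "tensor_algebra_lift K Z f X =
     the_elem (lin_ext K Z (\<lambda>w. foldr (\<lambda>v y. f v \<otimes>\<^bsub>Z\<^esub> y) w \<one>\<^bsub>Z\<^esub>) ` X)"

definition sym_algebra_null :: "'k ring \<Rightarrow> ('k, 'v) module \<Rightarrow> ('v list \<Rightarrow> 'k) set set" where
  "sym_algebra_null K V = (let T = tensor_algebra K V; x = tensor_algebra_gen K V in
     Idl\<^bsub>T\<^esub> {x v \<otimes>\<^bsub>T\<^esub> x w \<ominus>\<^bsub>T\<^esub> x w \<otimes>\<^bsub>T\<^esub> x v | v w. v \<in> carrier V \<and> w \<in> carrier V})"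

definition sym_algebra :: "'k ring \<Rightarrow> ('k, 'v) module \<Rightarrow> ('k, ('v list \<Rightarrow> 'k) set set) module" where
  "sym_algebra K V = quot_algebra (tensor_algebra K V) (sym_algebra_null K V)"

definition sym_algebra_gen :: "'k ring \<Rightarrow> ('k, 'v) module \<Rightarrow> 'v \<Rightarrow> ('v list \<Rightarrow> 'k) set set" where
  "sym_algebra_gen K V v =
     sym_algebra_null K V +>\<^bsub>tensor_algebra K V\<^esub> tensor_algebra_gen K V v"

section \<open>Hopf algebras and comodule algebras\<close>

locale bialgebra = assoc_algebra K H for K :: "'k ring" and H :: "('k, 'h) module" +
  fixes \<Delta> :: "'h \<Rightarrow> ('h \<times> 'h \<Rightarrow> 'k) set" and \<epsilon> :: "'h \<Rightarrow> 'k"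
  assumes comult_hom: "\<Delta> \<in> alg_hom K H (tensor K H H)"
    and counit_hom: "\<epsilon> \<in> alg_hom K H (base_algebra K)"
    and coassoc: "h \<in> carrier H \<Longrightarrow>
      tensor_map K (tensor K H H) H \<Delta> id (\<Delta> h) =
      tensor_assoc K H H H (tensor_map K H (tensor K H H) id \<Delta> (\<Delta> h))"
    and counit_left: "h \<in> carrier H \<Longrightarrow> tensor_lift K H (\<lambda>x y. \<epsilon> x \<odot>\<^bsub>H\<^esub> y) (\<Delta> h) = h"
    and counit_right: "h \<in> carrier H \<Longrightarrow> tensor_lift K H (\<lambda>x y. \<epsilon> y \<odot>\<^bsub>H\<^esub> x) (\<Delta> h) = h"

locale hopf_algebra = bialgebra K H \<Delta> \<epsilon>
  for K :: "'k ring" and H :: "('k, 'h) module" and \<Delta> \<epsilon> +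
  fixes S :: "'h \<Rightarrow> 'h"
  assumes antipode_linear: "S \<in> linear_maps K H H"
    and antipode_left: "h \<in> carrier H \<Longrightarrow>
      tensor_lift K H (\<lambda>x y. S x \<otimes>\<^bsub>H\<^esub> y) (\<Delta> h) = \<epsilon> h \<odot>\<^bsub>H\<^esub> \<one>\<^bsub>H\<^esub>"
    and antipode_right: "h \<in> carrier H \<Longrightarrow>
      tensor_lift K H (\<lambda>x y. x \<otimes>\<^bsub>H\<^esub> S y) (\<Delta> h) = \<epsilon> h \<odot>\<^bsub>H\<^esub> \<one>\<^bsub>H\<^esub>"

locale comodule_algebra = bialgebra K H \<Delta> \<epsilon> + A: assoc_algebra K A
  for K :: "'k ring" and H :: "('k, 'h) module" and \<Delta> \<epsilon> and A :: "('k, 'a) module" +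
  fixes \<delta> :: "'a \<Rightarrow> ('a \<times> 'h \<Rightarrow> 'k) set"
  assumes coact_hom: "\<delta> \<in> alg_hom K A (tensor K A H)"
    and coact_coassoc: "a \<in> carrier A \<Longrightarrow>
      tensor_map K (tensor K A H) H \<delta> id (\<delta> a) =
      tensor_assoc K A H H (tensor_map K A (tensor K H H) id \<Delta> (\<delta> a))"
    and coact_counit: "a \<in> carrier A \<Longrightarrow> tensor_lift K A (\<lambda>x h. \<epsilon> h \<odot>\<^bsub>A\<^esub> x) (\<delta> a) = a"

definition comodule_hom ::
  "'k ring \<Rightarrow> ('k, 'h) module \<Rightarrow> ('k, 'm) module \<Rightarrow> ('m \<Rightarrow> ('m \<times> 'h \<Rightarrow> 'k) set)
    \<Rightarrow> ('k, 'n) module \<Rightarrow> ('n \<Rightarrow> ('n \<times> 'h \<Rightarrow> 'k) set) \<Rightarrow> ('m \<Rightarrow> 'n) set" where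
  "comodule_hom K H M \<delta>M N \<delta>N = {f \<in> linear_maps K M N.
     \<forall>m\<in>carrier M. \<delta>N (f m) = tensor_map K N H f id (\<delta>M m)}"

definition comodule_alg_hom ::
  "'k ring \<Rightarrow> ('k, 'h) module \<Rightarrow> ('k, 'm) module \<Rightarrow> ('m \<Rightarrow> ('m \<times> 'h \<Rightarrow> 'k) set)
    \<Rightarrow> ('k, 'n) module \<Rightarrow> ('n \<Rightarrow> ('n \<times> 'h \<Rightarrow> 'k) set) \<Rightarrow> ('m \<Rightarrow> 'n) set" where
  "comodule_alg_hom K H M \<delta>M N \<delta>N = alg_hom K M N \<inter> comodule_hom K H M \<delta>M N \<delta>N"

text \<open>The coaction \<open>id\<^sub>V \<otimes> \<delta>M\<close> on \<open>V \<otimes> M\<close>.\<close>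

definition free_coact ::
  "'k ring \<Rightarrow> ('k, 'h) module \<Rightarrow> ('k, 'v) module \<Rightarrow> ('k, 'm) module \<Rightarrow> ('m \<Rightarrow> ('m \<times> 'h \<Rightarrow> 'k) set)
    \<Rightarrow> ('v \<times> 'm \<Rightarrow> 'k) set \<Rightarrow> (('v \<times> 'm \<Rightarrow> 'k) set \<times> 'h \<Rightarrow> 'k) set" where
  "free_coact K H V M \<delta>M x = tensor_assoc K V M H (tensor_map K V (tensor K M H) id \<delta>M x)"

definition coinvariants ::
  "'k ring \<Rightarrow> ('k, 'h) module \<Rightarrow> ('k, 'a) module \<Rightarrow> ('a \<Rightarrow> ('a \<times> 'h \<Rightarrow> 'k) set) \<Rightarrow> ('k, 'a) module" where
  "coinvariants K H A \<delta> = A\<lparr>carrier := {a \<in> carrier A. \<delta> a = pure_tensor K A H a \<one>\<^bsub>H\<^esub>}\<rparr>"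

section \<open>Identities and the universal comodule algebra\<close>

text \<open>
  \<open>X\<^sub>H\<close> and \<open>t\<^sub>H\<close> are copies of the vector space \<open>H\<close>, so \<open>T(X\<^sub>H)\<close> is \<open>tensor_algebra K H\<close> with
  \<open>X\<^sub>h = tensor_algebra_gen K H h\<close>, and \<open>S(t\<^sub>H)\<close> is \<open>sym_algebra K H\<close> with
  \<open>t\<^sub>h = sym_algebra_gen K H h\<close>.
\<close>

definition tensor_algebra_coact ::
  "'k ring \<Rightarrow> ('k, 'h) module \<Rightarrow> ('h \<Rightarrow> ('h \<times> 'h \<Rightarrow> 'k) set)
    \<Rightarrow> ('h list \<Rightarrow> 'k) set \<Rightarrow> (('h list \<Rightarrow> 'k) set \<times> 'h \<Rightarrow> 'k) set" where
  "tensor_algebra_coact K H \<Delta> = (let T = tensor_algebra K H; X = tensor_algebra_gen K H in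
     tensor_algebra_lift K (tensor K T H)
       (\<lambda>h. tensor_lift K (tensor K T H) (\<lambda>x y. pure_tensor K T H (X x) y) (\<Delta> h)))"

definition identities ::
  "'k ring \<Rightarrow> ('k, 'h) module \<Rightarrow> ('h \<Rightarrow> ('h \<times> 'h \<Rightarrow> 'k) set)
    \<Rightarrow> ('k, 'a) module \<Rightarrow> ('a \<Rightarrow> ('a \<times> 'h \<Rightarrow> 'k) set) \<Rightarrow> ('h list \<Rightarrow> 'k) set set" where
  "identities K H \<Delta> A \<delta> = {P \<in> carrier (tensor_algebra K H).
     \<forall>\<mu> \<in> comodule_alg_hom K H (tensor_algebra K H) (tensor_algebra_coact K H \<Delta>) A \<delta>. \<mu> P = \<zero>\<^bsub>A\<^esub>}"

definition univ_algebra ::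
  "'k ring \<Rightarrow> ('k, 'h) module \<Rightarrow> ('h \<Rightarrow> ('h \<times> 'h \<Rightarrow> 'k) set)
    \<Rightarrow> ('k, 'a) module \<Rightarrow> ('a \<Rightarrow> ('a \<times> 'h \<Rightarrow> 'k) set) \<Rightarrow> ('k, ('h list \<Rightarrow> 'k) set set) module" where
  "univ_algebra K H \<Delta> A \<delta> = quot_algebra (tensor_algebra K H) (identities K H \<Delta> A \<delta>)"

definition univ_proj ::
  "'k ring \<Rightarrow> ('k, 'h) module \<Rightarrow> ('h \<Rightarrow> ('h \<times> 'h \<Rightarrow> 'k) set)
    \<Rightarrow> ('k, 'a) module \<Rightarrow> ('a \<Rightarrow> ('a \<times> 'h \<Rightarrow> 'k) set) \<Rightarrow> ('h list \<Rightarrow> 'k) set \<Rightarrow> ('h list \<Rightarrow> 'k) set set" where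
  "univ_proj K H \<Delta> A \<delta> P = identities K H \<Delta> A \<delta> +>\<^bsub>tensor_algebra K H\<^esub> P"

text \<open>The quotient coaction; \<open>\<delta>(I\<^sub>H(A)) \<subseteq> I\<^sub>H(A) \<otimes> H\<close> makes the image below a singleton.\<close>

definition univ_coact ::
  "'k ring \<Rightarrow> ('k, 'h) module \<Rightarrow> ('h \<Rightarrow> ('h \<times> 'h \<Rightarrow> 'k) set)
    \<Rightarrow> ('k, 'a) module \<Rightarrow> ('a \<Rightarrow> ('a \<times> 'h \<Rightarrow> 'k) set)
    \<Rightarrow> ('h list \<Rightarrow> 'k) set set \<Rightarrow> (('h list \<Rightarrow> 'k) set set \<times> 'h \<Rightarrow> 'k) set" where
  "univ_coact K H \<Delta> A \<delta> Y =
     the_elem ((\<lambda>P. tensor_map K (univ_algebra K H \<Delta> A \<delta>) H (univ_proj K H \<Delta> A \<delta>) id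
                     (tensor_algebra_coact K H \<Delta> P)) ` Y)"

definition univ_deg ::
  "'k ring \<Rightarrow> ('k, 'h) module \<Rightarrow> ('h \<Rightarrow> ('h \<times> 'h \<Rightarrow> 'k) set)
    \<Rightarrow> ('k, 'a) module \<Rightarrow> ('a \<Rightarrow> ('a \<times> 'h \<Rightarrow> 'k) set) \<Rightarrow> nat \<Rightarrow> ('h list \<Rightarrow> 'k) set set set" where
  "univ_deg K H \<Delta> A \<delta> r = univ_proj K H \<Delta> A \<delta> ` tensor_power K H r"

definition generic_map ::
  "'k ring \<Rightarrow> ('k, 'h) module \<Rightarrow> ('h \<Rightarrow> ('h \<times> 'h \<Rightarrow> 'k) set)
    \<Rightarrow> ('k, 'a) module \<Rightarrow> ('a \<Rightarrow> ('a \<times> 'h \<Rightarrow> 'k) set) \<Rightarrow> (('a \<times> 'h \<Rightarrow> 'k) set \<Rightarrow> 'a)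
    \<Rightarrow> ('h list \<Rightarrow> 'k) set \<Rightarrow> (('h list \<Rightarrow> 'k) set set \<times> 'a \<Rightarrow> 'k) set" where
  "generic_map K H \<Delta> A \<delta> u =
     (let B = coinvariants K H A \<delta>; S = sym_algebra K H; t = sym_algebra_gen K H in
      tensor_algebra_lift K (tensor K S A)
        (\<lambda>h. tensor_lift K (tensor K S A)
               (\<lambda>x y. pure_tensor K S A (t x) (u (pure_tensor K B H \<one>\<^bsub>B\<^esub> y))) (\<Delta> h)))"

end

theory Submission
  imports Defs
begin

text \<open>
  Put \<open>j h = u (1 \<otimes> h)\<close>, a comodule map \<open>H \<rightarrow> A\<close>.  The injectivity claim says that \<open>I\<^sub>H(A)\<close> is the
  kernel of \<open>\<mu>\<^sub>A\<close>.  Every comodule map \<open>g : H \<rightarrow> A\<close> is \<open>g h = \<Sum> f h\<^sub>(\<^sub>1\<^sub>) j h\<^sub>(\<^sub>2\<^sub>)\<close> for the linear map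
  \<open>f = (id \<otimes> \<epsilon>) \<circ> u\<^sup>-\<^sup>1 \<circ> g : H \<rightarrow> B\<close>, so every comodule algebra morphism \<open>T(X\<^sub>H) \<rightarrow> A\<close> factors as
  \<open>\<Phi>\<^sub>f \<circ> \<mu>\<^sub>A\<close>, where \<open>\<Phi>\<^sub>f : S(t\<^sub>H) \<otimes> A \<rightarrow> A\<close> sends \<open>t\<^sub>h \<otimes> a\<close> to \<open>f h \<cdot> a\<close> and is multiplicative because
  \<open>B\<close> is central; hence the kernel consists of identities.  Conversely, \<open>\<Phi>\<^sub>f \<circ> \<mu>\<^sub>A\<close> is a comodule
  algebra morphism for every functional \<open>f : H \<rightarrow> K\<close>, and these \<open>\<Phi>\<^sub>f\<close> jointly separate the points of
  \<open>S(t\<^sub>H) \<otimes> A\<close>, because a polynomial vanishing at every point of an infinite field is zero.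
  The coaction descends to the quotient because an injective linear map has a linear left inverse
  and so remains injective after tensoring with \<open>H\<close>.  For part (b), the functional \<open>\<epsilon>\<close> gives
  \<open>\<Phi>\<^sub>\<epsilon> (\<mu>\<^sub>A X\<^sub>h) = j h\<close>, and \<open>j\<close> is injective if \<open>A\<close> is nonzero.
\<close>

section \<open>Linear maps\<close>

text \<open>No basis of \<open>H\<close> is chosen and its dimension is arbitrary, so
  \<open>S(t_H)\<close> is never identified with a polynomial ring. This shapes the separation
  argument: the finitely many vectors occurring in an element replace the variables. They may be
  linearly dependent, and each new one is either redundant or split off from the earlier ones by a
  functional. Complements of subspaces, from Zorn's lemma, supply these functionals as well as the
  left inverses of injective maps.

  Maps out of a quotient are defined by their value on a coset, so each must be shown well defined
  before it can be evaluated. A Sweedler sum is the lift of a bilinear map, and identities between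
  such sums are reduced to pure tensors by linearity.

  A tensor product always carries the product built from its factors. Hence its null space has to be
  an ideal, and factors that matter only as vector spaces are still required to be algebras.\<close>

lemma (in abelian_group) minus_eq_zero_iff:
  assumes "x \<in> carrier G" "y \<in> carrier G"
  shows "x \<ominus> y = \<zero> \<longleftrightarrow> x = y"
proof
  assume "x \<ominus> y = \<zero>"
  then have "(x \<ominus> y) \<oplus> y = y" using assms by simp
  then show "x = y" using assms by (simp add: a_minus_def a_assoc l_neg)
qed (use assms in \<open>simp add: a_minus_def r_neg\<close>)

lemma (in abelian_group) minus_zero_right:
  assumes "x \<in> carrier G" shows "x \<ominus> \<zero> = x"
proof -
  have "\<ominus> \<zero> = \<zero>" by (rule minus_equality) auto
  then show ?thesis using assms by (simp add: a_minus_def)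
qed

lemma linear_mapsI:
  assumes "\<And>x. x \<in> carrier V \<Longrightarrow> f x \<in> carrier W"
    and "\<And>x y. x \<in> carrier V \<Longrightarrow> y \<in> carrier V \<Longrightarrow> f (x \<oplus>\<^bsub>V\<^esub> y) = f x \<oplus>\<^bsub>W\<^esub> f y"
    and "\<And>c x. c \<in> carrier K \<Longrightarrow> x \<in> carrier V \<Longrightarrow> f (c \<odot>\<^bsub>V\<^esub> x) = c \<odot>\<^bsub>W\<^esub> f x"
  shows "f \<in> linear_maps K V W"
  using assms by (auto simp: linear_maps_def)

lemma linear_maps_closed: "f \<in> linear_maps K V W \<Longrightarrow> x \<in> carrier V \<Longrightarrow> f x \<in> carrier W"
  by (auto simp: linear_maps_def)

lemma linear_maps_add:
  "f \<in> linear_maps K V W \<Longrightarrow> x \<in> carrier V \<Longrightarrow> y \<in> carrier V \<Longrightarrow> f (x \<oplus>\<^bsub>V\<^esub> y) = f x \<oplus>\<^bsub>W\<^esub> f y"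
  by (auto simp: linear_maps_def)

lemma linear_maps_smult:
  "f \<in> linear_maps K V W \<Longrightarrow> c \<in> carrier K \<Longrightarrow> x \<in> carrier V \<Longrightarrow> f (c \<odot>\<^bsub>V\<^esub> x) = c \<odot>\<^bsub>W\<^esub> f x"
  by (auto simp: linear_maps_def)

lemma linear_maps_comp:
  "f \<in> linear_maps K V W \<Longrightarrow> g \<in> linear_maps K W Z \<Longrightarrow> (\<lambda>x. g (f x)) \<in> linear_maps K V Z"
  by (auto simp: linear_maps_def Pi_iff)

lemma linear_maps_id: "(\<lambda>x. x) \<in> linear_maps K V V"
  by (auto simp: linear_maps_def)

lemma linear_maps_cong:
  assumes "module K V" "f \<in> linear_maps K V W" "\<And>x. x \<in> carrier V \<Longrightarrow> g x = f x"
  shows "g \<in> linear_maps K V W"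
proof -
  interpret V: module K V by fact
  show ?thesis using assms(2,3) by (auto simp: linear_maps_def)
qed

lemma linear_maps_zero:
  assumes "module K V" "module K W" "f \<in> linear_maps K V W"
  shows "f \<zero>\<^bsub>V\<^esub> = \<zero>\<^bsub>W\<^esub>"
proof -
  interpret V: module K V by fact
  interpret W: module K W by fact
  have "f (\<zero>\<^bsub>K\<^esub> \<odot>\<^bsub>V\<^esub> \<zero>\<^bsub>V\<^esub>) = \<zero>\<^bsub>K\<^esub> \<odot>\<^bsub>W\<^esub> f \<zero>\<^bsub>V\<^esub>"
    using assms(3) by (intro linear_maps_smult) auto
  then show ?thesis using linear_maps_closed[OF assms(3), of "\<zero>\<^bsub>V\<^esub>"] by simp
qed

lemma linear_maps_inv:
  assumes "module K V" "module K W" "f \<in> linear_maps K V W" "x \<in> carrier V"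
  shows "f (\<ominus>\<^bsub>V\<^esub> x) = \<ominus>\<^bsub>W\<^esub> f x"
proof -
  interpret V: module K V by fact
  interpret W: module K W by fact
  have "f (\<ominus>\<^bsub>V\<^esub> x) \<oplus>\<^bsub>W\<^esub> f x = f (\<ominus>\<^bsub>V\<^esub> x \<oplus>\<^bsub>V\<^esub> x)"
    using assms(3,4) by (simp add: linear_maps_add)
  also have "\<dots> = \<zero>\<^bsub>W\<^esub>" using assms by (simp add: V.M.l_neg linear_maps_zero)
  finally show ?thesis using linear_maps_closed[OF assms(3)] assms(4)
    by (intro W.M.minus_equality[symmetric]) auto
qed

lemma linear_maps_minus:
  assumes "module K V" "module K W" "f \<in> linear_maps K V W" "x \<in> carrier V" "y \<in> carrier V"
  shows "f (x \<ominus>\<^bsub>V\<^esub> y) = f x \<ominus>\<^bsub>W\<^esub> f y"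
proof -
  interpret V: module K V by fact
  interpret W: module K W by fact
  show ?thesis using assms
    by (simp add: a_minus_def linear_maps_add linear_maps_inv)
qed

lemma submodule_zero: "submodule N K V \<Longrightarrow> \<zero>\<^bsub>V\<^esub> \<in> N"
  using subgroup.one_closed[OF submodule.axioms(1), of N K V] by simp

lemma submodule_vimage:
  assumes "module K V" "module K W" "f \<in> linear_maps K V W" "submodule N K W"
  shows "submodule {x \<in> carrier V. f x \<in> N} K V"
proof -
  interpret V: module K V by fact
  interpret W: module K W by fact
  note N = W.submoduleE[OF assms(4)]
  have z: "\<zero>\<^bsub>W\<^esub> \<in> N" by (rule submodule_zero[OF assms(4)])
  show ?thesis
    using z N assms(1-3)
    by (intro V.submoduleI)
      (auto simp: linear_maps_zero linear_maps_inv linear_maps_add linear_maps_smult)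
qed

lemma zero_submodule:
  assumes "module K V" shows "submodule {\<zero>\<^bsub>V\<^esub>} K V"
proof -
  interpret V: module K V by fact
  show ?thesis by (intro V.submoduleI) auto
qed

lemma submodule_kernel:
  assumes "module K V" "module K W" "f \<in> linear_maps K V W"
  shows "submodule {x \<in> carrier V. f x = \<zero>\<^bsub>W\<^esub>} K V"
  using submodule_vimage[OF assms zero_submodule[OF assms(2)]] by simp

lemma submodule_image:
  assumes "module K V" "module K W" "f \<in> linear_maps K V W"
  shows "submodule (f ` carrier V) K W"
proof -
  interpret V: module K V by fact
  interpret W: module K W by fact
  show ?thesis
  proof (intro W.submoduleI)
    show "\<zero>\<^bsub>W\<^esub> \<in> f ` carrier V"
      using linear_maps_zero[OF assms] by (metis V.M.zero_closed image_eqI)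
  next
    fix a assume "a \<in> f ` carrier V"
    then show "\<ominus>\<^bsub>W\<^esub> a \<in> f ` carrier V"
      using linear_maps_inv[OF assms] by (metis (no_types, lifting) V.M.a_inv_closed imageE image_eqI)
  next
    fix a b assume "a \<in> f ` carrier V" "b \<in> f ` carrier V"
    then show "a \<oplus>\<^bsub>W\<^esub> b \<in> f ` carrier V"
      using linear_maps_add[OF assms(3)] by (smt (verit) V.M.a_closed imageE image_eqI)
  next
    fix c b assume "c \<in> carrier K" "b \<in> f ` carrier V"
    then show "c \<odot>\<^bsub>W\<^esub> b \<in> f ` carrier V"
      using linear_maps_smult[OF assms(3)] by (smt (verit) V.smult_closed imageE image_eqI)
  qed (use assms(3) linear_maps_closed in fast)
qed

section \<open>Algebra morphisms and their kernels\<close>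

lemma alg_homD:
  assumes "f \<in> alg_hom K A B"
  shows "f \<in> linear_maps K A B" "f \<one>\<^bsub>A\<^esub> = \<one>\<^bsub>B\<^esub>"
    and "x \<in> carrier A \<Longrightarrow> y \<in> carrier A \<Longrightarrow> f (x \<otimes>\<^bsub>A\<^esub> y) = f x \<otimes>\<^bsub>B\<^esub> f y"
  using assms by (auto simp: alg_hom_def ring_hom_def)

lemma alg_homI:
  assumes "f \<in> linear_maps K A B" "f \<one>\<^bsub>A\<^esub> = \<one>\<^bsub>B\<^esub>"
    and "\<And>x y. x \<in> carrier A \<Longrightarrow> y \<in> carrier A \<Longrightarrow> f (x \<otimes>\<^bsub>A\<^esub> y) = f x \<otimes>\<^bsub>B\<^esub> f y"
  shows "f \<in> alg_hom K A B"
  using assms by (auto simp: alg_hom_def ring_hom_def linear_maps_def)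

lemma alg_hom_comp:
  assumes "f \<in> alg_hom K A B" "g \<in> alg_hom K B C"
  shows "(\<lambda>x. g (f x)) \<in> alg_hom K A C"
  using assms linear_maps_closed[OF alg_homD(1)[OF assms(1)]]
  by (intro alg_homI linear_maps_comp[of f K A B g])
    (auto simp: alg_homD)

lemma alg_hom_kernel_ideal:
  assumes "assoc_algebra K A" "assoc_algebra K B" "f \<in> alg_hom K A B"
  shows "ideal {x \<in> carrier A. f x = \<zero>\<^bsub>B\<^esub>} A"
proof -
  interpret A: assoc_algebra K A by fact
  interpret B: assoc_algebra K B by fact
  note f = alg_homD[OF assms(3)]
  have sub: "submodule {x \<in> carrier A. f x = \<zero>\<^bsub>B\<^esub>} K A"
    by (rule submodule_kernel[OF A.module_axioms B.module_axioms f(1)])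
  show ?thesis
    using linear_maps_closed[OF f(1)] f
    by (intro idealI submodule.axioms(1)[OF sub] A.ring_axioms) auto
qed

subsection \<open>Linear projections\<close>

text \<open>Zorn's lemma gives a submodule \<open>M\<close> maximal among those meeting
  \<open>N\<close> only in zero. Maximality forces \<open>M + N\<close> to be the whole space, and
  the projection onto \<open>N\<close> along \<open>M\<close> is the required map.\<close>

lemma exists_linear_projection:
  fixes V (structure)
  assumes K: "field K" and V: "module K V" and N: "submodule N K V"
  shows "\<exists>p \<in> linear_maps K V V. p ` carrier V \<subseteq> N \<and> (\<forall>x\<in>N. p x = x)"
proof -
  interpret K: field K by fact
  interpret V: module K V by fact
  note NE = V.submoduleE[OF N]
  note zero_in = submodule_zero
  define S where "S = {M. submodule M K V \<and> M \<inter> N = {\<zero>}}"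
  have "\<exists>M\<in>S. \<forall>X\<in>S. M \<subseteq> X \<longrightarrow> X = M"
  proof (rule subset_Zorn_nonempty)
    show "S \<noteq> {}"
      using zero_submodule[OF V] zero_in[OF N] by (auto simp: S_def intro!: exI[of _ "{\<zero>}"])
  next
    fix C assume C: "C \<noteq> {}" "subset.chain S C"
    have CE: "X \<subseteq> carrier V" "\<zero> \<in> X" "\<And>a. a \<in> X \<Longrightarrow> \<ominus> a \<in> X"
      "\<And>a b. a \<in> X \<Longrightarrow> b \<in> X \<Longrightarrow> a \<oplus> b \<in> X"
      "\<And>c b. c \<in> carrier K \<Longrightarrow> b \<in> X \<Longrightarrow> c \<odot> b \<in> X" "X \<inter> N = {\<zero>}" if "X \<in> C" for X
    proof -
      have sub: "submodule X K V" "X \<inter> N = {\<zero>}"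
        using that C(2) by (auto simp: S_def subset_chain_def)
      note E = V.submoduleE[OF sub(1)]
      show "X \<subseteq> carrier V" "\<zero> \<in> X" "X \<inter> N = {\<zero>}" using E(1) zero_in[OF sub(1)] sub(2) by auto
      show "\<ominus> a \<in> X" if "a \<in> X" for a using E(3) that .
      show "a \<oplus> b \<in> X" if "a \<in> X" "b \<in> X" for a b using E(5) that .
      show "c \<odot> b \<in> X" if "c \<in> carrier K" "b \<in> X" for c b using E(4) that .
    qed
    have "submodule (\<Union>C) K V"
    proof (intro V.submoduleI)
      show "a \<oplus> b \<in> \<Union>C" if ab: "a \<in> \<Union>C" "b \<in> \<Union>C" for a b
      proof -
        obtain X Y where XY: "X \<in> C" "Y \<in> C" "a \<in> X" "b \<in> Y" using ab by auto
        then have "X \<subseteq> Y \<or> Y \<subseteq> X" using C(2) by (auto simp: subset_chain_def)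
        then show ?thesis using XY CE(4) by (metis UnionI subset_iff)
      qed
      show "\<Union>C \<subseteq> carrier V" using CE(1) by (rule Union_least)
      show "\<zero> \<in> \<Union>C" using C(1) CE(2) by (meson UnionI ex_in_conv)
      show "\<ominus> a \<in> \<Union>C" if "a \<in> \<Union>C" for a using that CE(3) by (meson UnionE UnionI)
      show "c \<odot> a \<in> \<Union>C" if "c \<in> carrier K" "a \<in> \<Union>C" for c a
        using that CE(5) by (meson UnionE UnionI)
    qed
    moreover have "\<Union>C \<inter> N = {\<zero>}" using CE(6) C(1) unfolding Int_Union2 by auto
    ultimately show "\<Union>C \<in> S" by (simp add: S_def)
  qed
  then obtain M where M: "submodule M K V" "M \<inter> N = {\<zero>}"
    and max: "\<And>X. submodule X K V \<Longrightarrow> X \<inter> N = {\<zero>} \<Longrightarrow> M \<subseteq> X \<Longrightarrow> X = M"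
    by (auto simp: S_def)
  note ME = V.submoduleE[OF M(1)]
  \<comment> \<open>If \<open>x\<close> lies outside \<open>M\<close>, then \<open>M + K x\<close>
    is strictly larger and so contains a nonzero element \<open>m + c x\<close> of \<open>N\<close>.
    Here \<open>c\<close> is nonzero because \<open>M\<close> meets \<open>N\<close> trivially, and
    dividing by \<open>c\<close> gives the component of \<open>x\<close> in
    \<open>N\<close>.\<close>
  have ex: "\<exists>n\<in>N. x \<ominus> n \<in> M" if x: "x \<in> carrier V" for x
  proof (cases "x \<in> M")
    case True
    then show ?thesis using zero_in[OF N] x
      by (intro bexI[of _ "\<zero>"]) (auto simp: V.M.minus_zero_right)
  next
    case False
    define X where "X = {m \<oplus> c \<odot> x | m c. m \<in> M \<and> c \<in> carrier K}"
    have X: "submodule X K V"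
    proof (intro V.submoduleI)
      show "X \<subseteq> carrier V" using ME(1) x by (auto simp: X_def)
      show "\<zero> \<in> X" using zero_in[OF M(1)] x
        unfolding X_def by (intro CollectI exI[of _ "\<zero>"] exI[of _ "\<zero>\<^bsub>K\<^esub>"]) auto
    next
      fix a assume "a \<in> X"
      then obtain m c where "a = m \<oplus> c \<odot> x" "m \<in> M" "c \<in> carrier K" by (auto simp: X_def)
      then show "\<ominus> a \<in> X" using ME x unfolding X_def
        by (intro CollectI exI[of _ "\<ominus> m"] exI[of _ "\<ominus>\<^bsub>K\<^esub> c"])
          (auto simp: V.M.minus_add V.smult_l_minus subset_iff)
    next
      fix a b assume "a \<in> X" "b \<in> X"
      then obtain m c m' c' where "a = m \<oplus> c \<odot> x" "m \<in> M" "c \<in> carrier K"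
         "b = m' \<oplus> c' \<odot> x" "m' \<in> M" "c' \<in> carrier K" by (auto simp: X_def)
      then show "a \<oplus> b \<in> X" using ME x unfolding X_def
        by (intro CollectI exI[of _ "m \<oplus> m'"] exI[of _ "c \<oplus>\<^bsub>K\<^esub> c'"])
          (auto simp: V.M.a_ac V.smult_l_distr subset_iff)
    next
      fix d a assume d: "d \<in> carrier K" and "a \<in> X"
      then obtain m c where "a = m \<oplus> c \<odot> x" "m \<in> M" "c \<in> carrier K" by (auto simp: X_def)
      then show "d \<odot> a \<in> X" using ME x d unfolding X_def
        by (intro CollectI exI[of _ "d \<odot> m"] exI[of _ "d \<otimes>\<^bsub>K\<^esub> c"])
          (auto simp: V.smult_r_distr V.smult_assoc1 subset_iff)
    qed
    have "M \<subseteq> X"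
    proof
      fix m assume "m \<in> M"
      then show "m \<in> X" using ME(1) x unfolding X_def
        by (intro CollectI exI[of _ m] exI[of _ "\<zero>\<^bsub>K\<^esub>"]) auto
    qed
    moreover have "x \<in> X" using zero_in[OF M(1)] x unfolding X_def
      by (intro CollectI exI[of _ "\<zero>"] exI[of _ "\<one>\<^bsub>K\<^esub>"]) auto
    ultimately have "X \<inter> N \<noteq> {\<zero>}" using max[OF X] False by auto
    moreover have "\<zero> \<in> X \<inter> N" using zero_in[OF X] zero_in[OF N] by auto
    ultimately obtain n where n: "n \<in> X" "n \<in> N" "n \<noteq> \<zero>" by blast
    then obtain m c where mc: "n = m \<oplus> c \<odot> x" "m \<in> M" "c \<in> carrier K"
      by (auto simp: X_def)
    have c0: "c \<noteq> \<zero>\<^bsub>K\<^esub>"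
    proof
      assume "c = \<zero>\<^bsub>K\<^esub>"
      then have "n = m" using mc x ME(1) by auto
      then show False using n mc M(2) by auto
    qed
    then have ci: "inv\<^bsub>K\<^esub> c \<in> carrier K" "inv\<^bsub>K\<^esub> c \<otimes>\<^bsub>K\<^esub> c = \<one>\<^bsub>K\<^esub>"
      using mc(3) K.field_Units by auto
    have carr: "m \<in> carrier V" "n \<in> carrier V" using mc ME(1) n NE(1) by auto
    have "inv\<^bsub>K\<^esub> c \<odot> n = inv\<^bsub>K\<^esub> c \<odot> m \<oplus> x"
      using ci mc(1,3) x carr by (simp add: V.smult_r_distr flip: V.smult_assoc1)
    then have "x \<ominus> inv\<^bsub>K\<^esub> c \<odot> n = \<ominus> (inv\<^bsub>K\<^esub> c \<odot> m)"
      using ci x carr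
      by (simp add: a_minus_def V.M.minus_add V.M.a_ac V.M.r_neg1 V.M.r_neg2)
    then show ?thesis using ci n(2) NE ME mc(2)
      by (intro bexI[of _ "inv\<^bsub>K\<^esub> c \<odot> n"]) auto
  qed
  have uniq: "n = n'" if "x \<in> carrier V" "n \<in> N" "n' \<in> N" "x \<ominus> n \<in> M" "x \<ominus> n' \<in> M" for x n n'
  proof -
    have c: "n \<in> carrier V" "n' \<in> carrier V" using that NE by auto
    have "(x \<ominus> n) \<oplus> \<ominus> (x \<ominus> n') = (n' \<ominus> n) \<oplus> (x \<ominus> x)"
      using c that(1) by (simp add: a_minus_def V.M.minus_add V.M.a_ac)
    then have "n' \<ominus> n = (x \<ominus> n) \<oplus> \<ominus> (x \<ominus> n')"
      using c that(1) by (simp add: a_minus_def V.M.r_neg)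
    then have "n' \<ominus> n \<in> M" using ME that by auto
    moreover have "n' \<ominus> n \<in> N" using NE that by (auto simp: a_minus_def)
    ultimately have "n' \<ominus> n = \<zero>" using M(2) by blast
    then show ?thesis using c by (simp add: V.M.minus_eq_zero_iff)
  qed
  \<comment> \<open>The component in \<open>N\<close>. As it is unique, additivity and homogeneity
    follow by exhibiting the sum or the multiple as a valid component.\<close>
  define p where "p x = (THE n. n \<in> N \<and> x \<ominus> n \<in> M)" for x
  have pI: "p x = n" if "x \<in> carrier V" "n \<in> N" "x \<ominus> n \<in> M" for x n
    unfolding p_def using that uniq by (intro the_equality) blast+
  have p: "p x \<in> N" "x \<ominus> p x \<in> M" if "x \<in> carrier V" for x
    using ex[OF that] pI[OF that] by auto
  have pc: "p x \<in> carrier V" if "x \<in> carrier V" for x using p(1)[OF that] NE(1) by auto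
  show ?thesis
  proof (intro bexI[of _ p] conjI ballI linear_mapsI)
    show "p ` carrier V \<subseteq> N" using p by auto
    show "p x = x" if "x \<in> N" for x
      using that NE(1) zero_in[OF M(1)] by (intro pI) (auto simp: a_minus_def V.M.r_neg)
    show "p x \<in> carrier V" if "x \<in> carrier V" for x using pc[OF that] .
  next
    fix x y assume xy: "x \<in> carrier V" "y \<in> carrier V"
    have "x \<oplus> y \<ominus> (p x \<oplus> p y) = (x \<ominus> p x) \<oplus> (y \<ominus> p y)"
      using xy pc by (simp add: a_minus_def V.M.minus_add V.M.a_ac)
    then show "p (x \<oplus> y) = p x \<oplus> p y"
      using xy p ME NE by (intro pI) auto
  next
    fix c x assume xy: "c \<in> carrier K" "x \<in> carrier V"
    have "c \<odot> x \<ominus> (c \<odot> p x) = c \<odot> (x \<ominus> p x)"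
      using xy pc by (simp add: a_minus_def V.smult_r_minus V.smult_r_distr)
    then show "p (c \<odot> x) = c \<odot> p x"
      using xy p ME NE by (intro pI) auto
  qed
qed

text \<open>The image of \<open>f\<close> is the range of a linear projection, and undoing
  \<open>f\<close> after this projection gives \<open>g\<close>. The point is that an equation
  \<open>g (f x) = x\<close>, in contrast to bare injectivity, visibly survives tensoring with
  another space.\<close>

lemma linear_left_inverse:
  assumes K: "field K" and V: "module K V" and W: "module K W"
    and f: "f \<in> linear_maps K V W" and inj: "inj_on f (carrier V)"
  shows "\<exists>g \<in> linear_maps K W V. \<forall>x\<in>carrier V. g (f x) = x"
proof -
  interpret V: module K V by fact
  interpret W: module K W by fact
  obtain p where p: "p \<in> linear_maps K W W" "p ` carrier W \<subseteq> f ` carrier V"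
     "\<And>x. x \<in> f ` carrier V \<Longrightarrow> p x = x"
    using exists_linear_projection[OF K W submodule_image[OF V W f]] by auto
  let ?i = "inv_into (carrier V) f"
  have i: "?i (f x) = x" if "x \<in> carrier V" for x using inj that by simp
  have ex: "\<exists>x\<in>carrier V. p w = f x" if "w \<in> carrier W" for w using p(2) that by auto
  have "(\<lambda>w. ?i (p w)) \<in> linear_maps K W V"
  proof (rule linear_mapsI)
    fix w assume "w \<in> carrier W"
    then show "?i (p w) \<in> carrier V" using ex i by force
  next
    fix w w' assume w: "w \<in> carrier W" "w' \<in> carrier W"
    obtain x x' where x: "x \<in> carrier V" "x' \<in> carrier V" "p w = f x" "p w' = f x'"
      using ex w by meson
    then have "p (w \<oplus>\<^bsub>W\<^esub> w') = f (x \<oplus>\<^bsub>V\<^esub> x')"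
      using w p(1) f by (simp add: linear_maps_add)
    then show "?i (p (w \<oplus>\<^bsub>W\<^esub> w')) = ?i (p w) \<oplus>\<^bsub>V\<^esub> ?i (p w')" using x i by simp
  next
    fix c w assume w: "c \<in> carrier K" "w \<in> carrier W"
    obtain x where x: "x \<in> carrier V" "p w = f x"
      using ex w by meson
    then have "p (c \<odot>\<^bsub>W\<^esub> w) = f (c \<odot>\<^bsub>V\<^esub> x)"
      using w p(1) f by (simp add: linear_maps_smult)
    then show "?i (p (c \<odot>\<^bsub>W\<^esub> w)) = c \<odot>\<^bsub>V\<^esub> ?i (p w)" using x w i by simp
  qed
  then show ?thesis using p(3) i by (intro bexI[of _ "\<lambda>w. ?i (p w)"]) auto
qed

section \<open>The field as an algebra, and separating functionals\<close>

lemma base_algebra_algebra: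
  assumes "field K" shows "assoc_algebra K (base_algebra K)"
proof -
  interpret K: field K by fact
  have "abelian_group (base_algebra K)"
    unfolding base_algebra_def
    by (rule abelian_groupI) (auto simp: K.a_ac intro: K.add.l_inv_ex)
  moreover have "ring (base_algebra K)"
    using calculation
    by (intro ringI) (auto simp: base_algebra_def K.l_distr K.r_distr K.m_assoc intro!: monoidI)
  ultimately show ?thesis
    by (intro assoc_algebra.intro moduleI assms K.is_cring assoc_algebra_axioms.intro)
      (auto simp: base_algebra_def K.l_distr K.r_distr K.m_assoc K.m_lcomm)
qed

lemma smult_right_cancel:
  assumes "field K" "module K V" "c \<in> carrier K" "d \<in> carrier K" "x \<in> carrier V" "x \<noteq> \<zero>\<^bsub>V\<^esub>"
    "c \<odot>\<^bsub>V\<^esub> x = d \<odot>\<^bsub>V\<^esub> x"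
  shows "c = d"
proof (rule ccontr)
  interpret K: field K by fact
  interpret V: module K V by fact
  assume "c \<noteq> d"
  then have ci: "inv\<^bsub>K\<^esub> (c \<ominus>\<^bsub>K\<^esub> d) \<in> carrier K" "inv\<^bsub>K\<^esub> (c \<ominus>\<^bsub>K\<^esub> d) \<otimes>\<^bsub>K\<^esub> (c \<ominus>\<^bsub>K\<^esub> d) = \<one>\<^bsub>K\<^esub>"
    using assms K.field_Units by (auto simp: K.minus_eq_zero_iff)
  have "(c \<ominus>\<^bsub>K\<^esub> d) \<odot>\<^bsub>V\<^esub> x = \<zero>\<^bsub>V\<^esub>"
    using assms(3-7) by (simp add: a_minus_def V.smult_l_distr V.smult_l_minus V.M.r_neg)
  then have "(inv\<^bsub>K\<^esub> (c \<ominus>\<^bsub>K\<^esub> d) \<otimes>\<^bsub>K\<^esub> (c \<ominus>\<^bsub>K\<^esub> d)) \<odot>\<^bsub>V\<^esub> x = \<zero>\<^bsub>V\<^esub>"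
    using assms(3-5) ci(1) by (subst V.smult_assoc1) auto
  then show False using ci assms(5,6) by simp
qed

text \<open>For a projection \<open>p\<close> onto \<open>N\<close>, the map \<open>x - p x\<close>
  kills \<open>N\<close> and sends \<open>v\<close> to a nonzero vector \<open>w\<close>. Scaling
  \<open>w\<close> embeds the field into \<open>V\<close>, and a left inverse of this embedding
  reads off the coefficient of \<open>w\<close>.\<close>

lemma separating_functional:
  assumes K: "field K" and V: "module K V" and N: "submodule N K V"
    and v: "v \<in> carrier V" "v \<notin> N"
  shows "\<exists>f \<in> linear_maps K V (base_algebra K). (\<forall>x\<in>N. f x = \<zero>\<^bsub>K\<^esub>) \<and> f v = \<one>\<^bsub>K\<^esub>"
proof -
  interpret K: field K by fact
  interpret V: module K V by fact
  interpret B: assoc_algebra K "base_algebra K" by (rule base_algebra_algebra[OF K])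
  obtain p where p: "p \<in> linear_maps K V V" "p ` carrier V \<subseteq> N" "\<And>x. x \<in> N \<Longrightarrow> p x = x"
    using exists_linear_projection[OF K V N] by auto
  have NC: "N \<subseteq> carrier V" using V.submoduleE[OF N] by auto
  define w where "w = v \<ominus>\<^bsub>V\<^esub> p v"
  have w: "w \<in> carrier V" "w \<noteq> \<zero>\<^bsub>V\<^esub>"
  proof -
    show "w \<in> carrier V" using v p(1) by (auto simp: w_def linear_maps_closed)
    show "w \<noteq> \<zero>\<^bsub>V\<^esub>"
      using v p(1,2) linear_maps_closed[OF p(1)] unfolding w_def by (auto simp: V.M.minus_eq_zero_iff)
  qed
  have scale: "(\<lambda>c. c \<odot>\<^bsub>V\<^esub> w) \<in> linear_maps K (base_algebra K) V"
    using w(1) by (intro linear_mapsI) (auto simp: base_algebra_def V.smult_l_distr V.smult_assoc1)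
  have inj: "inj_on (\<lambda>c. c \<odot>\<^bsub>V\<^esub> w) (carrier (base_algebra K))"
    using w by (auto simp: base_algebra_def intro!: inj_onI smult_right_cancel[OF K V])
  obtain g where g: "g \<in> linear_maps K V (base_algebra K)" "\<And>c. c \<in> carrier K \<Longrightarrow> g (c \<odot>\<^bsub>V\<^esub> w) = c"
    using linear_left_inverse[OF K B.module_axioms V scale inj] by (auto simp: base_algebra_def)
  have q: "(\<lambda>x. x \<ominus>\<^bsub>V\<^esub> p x) \<in> linear_maps K V V"
    using p(1) linear_maps_closed[OF p(1)]
    by (intro linear_mapsI)
      (auto simp: linear_maps_add linear_maps_smult a_minus_def V.M.minus_add V.M.a_ac
         V.smult_r_minus V.smult_r_distr)
  show ?thesis
  proof (intro bexI[of _ "\<lambda>x. g (x \<ominus>\<^bsub>V\<^esub> p x)"] conjI ballI)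
    show "(\<lambda>x. g (x \<ominus>\<^bsub>V\<^esub> p x)) \<in> linear_maps K V (base_algebra K)"
      by (rule linear_maps_comp[OF q g(1)])
    show "g (x \<ominus>\<^bsub>V\<^esub> p x) = \<zero>\<^bsub>K\<^esub>" if "x \<in> N" for x
      using p(3)[OF that] that NC linear_maps_zero[OF V B.module_axioms g(1)]
      by (simp add: a_minus_def V.M.r_neg subset_iff base_algebra_def)
    show "g (v \<ominus>\<^bsub>V\<^esub> p v) = \<one>\<^bsub>K\<^esub>"
      using g(2)[of "\<one>\<^bsub>K\<^esub>"] w(1) by (simp add: w_def)
  qed
qed


section \<open>Quotients of algebras\<close>

text \<open>The axioms are equations together with the existence of negatives, so they pass to every
  surjective image with induced operations. This covers all coset algebras at once.\<close>

lemma assoc_algebra_image: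
  assumes A: "assoc_algebra K A"
    and carr: "carrier Q = f ` carrier A"
    and zero: "\<zero>\<^bsub>Q\<^esub> = f \<zero>\<^bsub>A\<^esub>" and one: "\<one>\<^bsub>Q\<^esub> = f \<one>\<^bsub>A\<^esub>"
    and add: "\<And>x y. x \<in> carrier A \<Longrightarrow> y \<in> carrier A \<Longrightarrow> f x \<oplus>\<^bsub>Q\<^esub> f y = f (x \<oplus>\<^bsub>A\<^esub> y)"
    and mult: "\<And>x y. x \<in> carrier A \<Longrightarrow> y \<in> carrier A \<Longrightarrow> f x \<otimes>\<^bsub>Q\<^esub> f y = f (x \<otimes>\<^bsub>A\<^esub> y)"
    and smult: "\<And>c x. c \<in> carrier K \<Longrightarrow> x \<in> carrier A \<Longrightarrow> c \<odot>\<^bsub>Q\<^esub> f x = f (c \<odot>\<^bsub>A\<^esub> x)"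
  shows "assoc_algebra K Q"
proof -
  interpret A: assoc_algebra K A by fact
  have inv: "\<exists>y\<in>carrier A. f (x \<oplus>\<^bsub>A\<^esub> y) = f \<zero>\<^bsub>A\<^esub>" if "x \<in> carrier A" for x
    using that by (intro bexI[of _ "\<ominus>\<^bsub>A\<^esub> x"]) (auto simp: A.r_neg)
  have ag: "abelian_group Q"
    by (rule abelian_groupI) (auto simp: carr zero add A.a_ac inv)
  moreover have "ring Q"
    by (intro ringI ag monoidI) (auto simp: carr one add mult A.l_distr A.r_distr A.m_assoc)
  ultimately show ?thesis
    by (intro assoc_algebra.intro moduleI A.K.field_axioms A.K.is_cring assoc_algebra_axioms.intro)
      (auto simp: carr add mult smult A.smult_l_distr A.smult_r_distr A.smult_assoc1
        A.smult_mult_left A.smult_mult_right)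
qed

text \<open>In an algebra with unit \<open>c x = (c 1) x\<close>, so absorbing products entails
  absorbing scalars.\<close>

lemma ideal_submodule:
  assumes "assoc_algebra K V" "ideal N V"
  shows "submodule N K V"
proof -
  interpret V: assoc_algebra K V by fact
  interpret N: ideal N V by fact
  have "c \<odot>\<^bsub>V\<^esub> x \<in> N" if "c \<in> carrier K" "x \<in> N" for c x
  proof -
    have "c \<odot>\<^bsub>V\<^esub> x = (c \<odot>\<^bsub>V\<^esub> \<one>\<^bsub>V\<^esub>) \<otimes>\<^bsub>V\<^esub> x"
      using that by (simp add: V.smult_mult_left)
    then show ?thesis using that by (simp add: N.I_l_closed)
  qed
  then show ?thesis
    by (intro V.submoduleI N.a_subset N.zero_closed N.a_inv_closed N.a_closed)
qed

context
  fixes K :: "'k ring" and V :: "('k, 'v) module" (structure) and N :: "'v set"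
  assumes V: "assoc_algebra K V" and N: "ideal N V"
begin

interpretation V: assoc_algebra K V by (rule V)
interpretation N: ideal N V by (rule N)

lemma quot_eq_iff:
  assumes "x \<in> carrier V" "y \<in> carrier V"
  shows "N +> x = N +> y \<longleftrightarrow> x \<ominus> y \<in> N"
  using V.quotient_eq_iff_same_a_r_cos[OF N assms] by auto

lemma quot_self: "x \<in> carrier V \<Longrightarrow> x \<in> N +> x"
  by (rule N.a_rcos_self)

lemma quot_memD:
  assumes "x \<in> carrier V" "y \<in> N +> x"
  shows "y \<in> carrier V" "N +> y = N +> x"
proof -
  show "y \<in> carrier V" using N.a_elemrcos_carrier assms by auto
  then show "N +> y = N +> x" using assms N.a_repr_independence' by metis
qed

lemma quot_carrier: "carrier (quot_algebra V N) = (\<lambda>x. N +> x) ` carrier V"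
  by (auto simp: quot_algebra_def A_RCOSETS_def')

lemma quot_zero: "\<zero>\<^bsub>quot_algebra V N\<^esub> = N +> \<zero>"
  by (simp add: quot_algebra_def N.a_subset)

lemma quot_one: "\<one>\<^bsub>quot_algebra V N\<^esub> = N +> \<one>"
  by (simp add: quot_algebra_def)

lemma quot_add:
  "x \<in> carrier V \<Longrightarrow> y \<in> carrier V \<Longrightarrow>
    (N +> x) \<oplus>\<^bsub>quot_algebra V N\<^esub> (N +> y) = N +> (x \<oplus> y)"
  by (simp add: quot_algebra_def N.a_rcos_sum)

lemma quot_mult:
  "x \<in> carrier V \<Longrightarrow> y \<in> carrier V \<Longrightarrow>
    (N +> x) \<otimes>\<^bsub>quot_algebra V N\<^esub> (N +> y) = N +> (x \<otimes> y)"
  by (simp add: quot_algebra_def N.rcoset_mult_add)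

text \<open>The defining union runs over all representatives of the coset. Its members coincide
  because \<open>N\<close> is closed under scalars, so it collapses to a single coset.\<close>

lemma quot_smult:
  assumes c: "c \<in> carrier K" and x: "x \<in> carrier V"
  shows "c \<odot>\<^bsub>quot_algebra V N\<^esub> (N +> x) = N +> (c \<odot> x)"
proof -
  have eq: "N +> (c \<odot> y) = N +> (c \<odot> x)" if "y \<in> N +> x" for y
  proof -
    note y = quot_memD[OF x that]
    have "y \<ominus> x \<in> N" using y x quot_eq_iff by blast
    then have "c \<odot> (y \<ominus> x) \<in> N"
      using c submodule.smult_closed[OF ideal_submodule[OF V N]] by blast
    then show ?thesis using c x y(1)
      by (subst quot_eq_iff) (auto simp: a_minus_def V.smult_r_distr V.smult_r_minus)
  qed
  have "(\<Union>y\<in>N +> x. N +> (c \<odot> y)) = N +> (c \<odot> x)"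
    by (rule SUP_eq_const) (use quot_self[OF x] in blast, rule eq)
  then show ?thesis by (simp add: quot_algebra_def)
qed

lemma quot_algebra_algebra: "assoc_algebra K (quot_algebra V N)"
  by (rule assoc_algebra_image[OF V quot_carrier quot_zero quot_one quot_add quot_mult quot_smult])

lemma quot_proj_alg_hom: "(\<lambda>x. N +> x) \<in> alg_hom K V (quot_algebra V N)"
  by (intro alg_homI linear_mapsI) (auto simp: quot_carrier quot_one quot_add quot_mult quot_smult)

text \<open>A linear map that kills \<open>N\<close> is constant on cosets. The definitions of
  \<open>tensor_lift\<close>, \<open>tensor_algebra_lift\<close> and \<open>univ_coact\<close> all
  have this \<open>the_elem\<close> form, and this is how each of them becomes computable.\<close>

lemma quot_lift_eq:
  assumes Z: "module K Z" and g: "g \<in> linear_maps K V Z"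
    and ker: "\<And>x. x \<in> N \<Longrightarrow> g x = \<zero>\<^bsub>Z\<^esub>" and x: "x \<in> carrier V"
  shows "the_elem (g ` (N +> x)) = g x"
proof -
  interpret Z: module K Z by fact
  have "g y = g x" if "y \<in> N +> x" for y
  proof -
    note y = quot_memD[OF x that]
    have "y \<ominus> x \<in> N" using y x quot_eq_iff by blast
    then have "g y \<ominus>\<^bsub>Z\<^esub> g x = \<zero>\<^bsub>Z\<^esub>"
      using ker linear_maps_minus[OF V.module_axioms Z g y(1) x] by simp
    then show ?thesis using linear_maps_closed[OF g] y(1) x by (simp add: Z.minus_eq_zero_iff)
  qed
  then have "g ` (N +> x) = {g x}" using quot_self[OF x] by blast
  then show ?thesis by simp
qed

lemma quot_lift_linear:
  assumes Z: "module K Z" and g: "g \<in> linear_maps K V Z"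
    and ker: "\<And>x. x \<in> N \<Longrightarrow> g x = \<zero>\<^bsub>Z\<^esub>"
  shows "(\<lambda>X. the_elem (g ` X)) \<in> linear_maps K (quot_algebra V N) Z"
  using linear_maps_closed[OF g] linear_maps_add[OF g] linear_maps_smult[OF g]
  by (intro linear_mapsI)
    (auto simp: quot_carrier quot_lift_eq[OF Z g ker] quot_add quot_smult)

lemma quot_lift_alg_hom:
  assumes Z: "module K Z" and g: "g \<in> alg_hom K V Z"
    and ker: "\<And>x. x \<in> N \<Longrightarrow> g x = \<zero>\<^bsub>Z\<^esub>"
  shows "(\<lambda>X. the_elem (g ` X)) \<in> alg_hom K (quot_algebra V N) Z"
  using alg_homD[OF g]
  by (intro alg_homI quot_lift_linear[OF Z _ ker])
    (auto simp: quot_carrier quot_lift_eq[OF Z _ ker] quot_mult quot_one)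

end

section \<open>Monoid algebras\<close>

context
  fixes K :: "'k ring" (structure) and M :: "'x monoid"
  assumes K: "field K" and M: "Group.monoid M"
begin

interpretation K: field K by (rule K)
interpretation M: Group.monoid M by (rule M)

private abbreviation (input) "MF \<equiv> monoid_algebra K M"
private abbreviation (input) "me \<equiv> basis_elem K"
private abbreviation (input) "supp p \<equiv> {x. p x \<noteq> \<zero>}"

lemma monoid_algebra_carrierD:
  assumes "p \<in> carrier (MF)"
  shows "p x \<in> carrier K" "finite (supp p)" "p x \<noteq> \<zero> \<Longrightarrow> x \<in> carrier M"
  using assms by (auto simp: monoid_algebra_def)

lemma monoid_algebra_basis_closed: "x \<in> carrier M \<Longrightarrow> me x \<in> carrier (MF)"
  by (auto simp: monoid_algebra_def basis_elem_def)

lemma monoid_algebra_abelian_group: "abelian_group (MF)"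
proof (rule abelian_groupI)
  fix p q assume pq: "p \<in> carrier MF" "q \<in> carrier MF"
  have "finite (supp p \<union> supp q)" using pq by (auto simp: monoid_algebra_def)
  then have "finite {x. p x \<oplus> q x \<noteq> \<zero>}"
    by (rule rev_finite_subset) auto
  moreover have "\<And>x. p x \<oplus> q x \<noteq> \<zero> \<Longrightarrow> x \<in> carrier M"
    using monoid_algebra_carrierD(3)[OF pq(1)] monoid_algebra_carrierD(3)[OF pq(2)] K.l_zero
    by (metis K.zero_closed)
  ultimately show "p \<oplus>\<^bsub>MF\<^esub> q \<in> carrier MF"
    using monoid_algebra_carrierD(1)[OF pq(1)] monoid_algebra_carrierD(1)[OF pq(2)]
    by (auto simp: monoid_algebra_def)
next
  fix p assume p: "p \<in> carrier MF"
  have "(\<lambda>x. \<ominus> p x) \<in> carrier MF"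
  proof -
    have "{x. \<ominus> p x \<noteq> \<zero>} = supp p"
      using monoid_algebra_carrierD(1)[OF p]
      by (metis K.minus_minus K.minus_zero)
    then show ?thesis using p by (auto simp: monoid_algebra_def)
  qed
  then show "\<exists>q\<in>carrier MF. q \<oplus>\<^bsub>MF\<^esub> p = \<zero>\<^bsub>MF\<^esub>"
    using monoid_algebra_carrierD(1)[OF p]
    by (intro bexI[of _ "\<lambda>x. \<ominus> p x"]) (auto simp: monoid_algebra_def K.l_neg)
qed (auto simp: monoid_algebra_def K.a_ac image_subset_iff)

lemma monoid_algebra_module: "module K (MF)"
proof (rule moduleI[OF K.is_cring monoid_algebra_abelian_group])
  fix c p assume c: "c \<in> carrier K" and p: "p \<in> carrier MF"
  have "{x. c \<otimes> p x \<noteq> \<zero>} \<subseteq> supp p" using c by auto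
  then show "c \<odot>\<^bsub>MF\<^esub> p \<in> carrier MF" using p c
    by (auto simp: monoid_algebra_def image_subset_iff dest: finite_subset)
qed (auto simp: monoid_algebra_def K.l_distr K.r_distr K.m_assoc image_subset_iff)

interpretation MF: module K MF by (rule monoid_algebra_module)

text \<open>Induction on the finite support: resetting one point to zero splits off a multiple of a
  basis element.\<close>

lemma monoid_algebra_induct [consumes 1, case_names zero basis smult add]:
  assumes p: "p \<in> carrier (MF)"
    and zero: "P \<zero>\<^bsub>MF\<^esub>"
    and basis: "\<And>x. x \<in> carrier M \<Longrightarrow> P (me x)"
    and smult: "\<And>c p. c \<in> carrier K \<Longrightarrow> p \<in> carrier (MF) \<Longrightarrow> P p \<Longrightarrow>
      P (c \<odot>\<^bsub>MF\<^esub> p)"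
    and add: "\<And>p q. p \<in> carrier (MF) \<Longrightarrow> q \<in> carrier (MF) \<Longrightarrow>
      P p \<Longrightarrow> P q \<Longrightarrow> P (p \<oplus>\<^bsub>MF\<^esub> q)"
  shows "P p"
proof -
  have "finite S \<Longrightarrow> p \<in> carrier MF \<Longrightarrow> supp p = S \<Longrightarrow> P p" for S p
  proof (induction S arbitrary: p rule: finite_induct)
    case empty
    then have "p = \<zero>\<^bsub>MF\<^esub>" by (auto simp: monoid_algebra_def)
    then show ?case using zero by simp
  next
    case (insert x S)
    note p = monoid_algebra_carrierD[OF insert.prems(1)]
    let ?q = "p(x := \<zero>)"
    have S: "supp ?q = S" using insert.prems(2) insert.hyps(2) by auto
    have q: "?q \<in> carrier MF" using insert.prems(1) S insert.hyps(1)
      by (auto simp: monoid_algebra_def split: if_splits)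
    have x: "x \<in> carrier M" using p(3) insert.prems(2) by blast
    have "p = (p x \<odot>\<^bsub>MF\<^esub> me x) \<oplus>\<^bsub>MF\<^esub> ?q"
      using p(1) by (auto simp: monoid_algebra_def basis_elem_def)
    moreover have "P \<dots>"
      using x p(1) q monoid_algebra_basis_closed
      by (intro add smult basis insert.IH[OF q S]) auto
    ultimately show ?case by simp
  qed
  then show ?thesis using p monoid_algebra_carrierD(2)[OF p] by blast
qed

lemma monoid_algebra_linear_eq:
  assumes "module K Z" "f \<in> linear_maps K (MF) Z"
    "g \<in> linear_maps K (MF) Z"
    and "\<And>x. x \<in> carrier M \<Longrightarrow> f (me x) = g (me x)"
    and "p \<in> carrier (MF)"
  shows "f p = g p"
  using assms(5)
proof (induction rule: monoid_algebra_induct)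
  case zero
  show ?case using linear_maps_zero[OF monoid_algebra_module assms(1)] assms(2,3) by metis
qed (use assms in \<open>simp_all add: linear_maps_add linear_maps_smult\<close>)

text \<open>Supports change under addition and scaling, so sums over exact supports do not combine
  termwise. Any finite superset will do, which provides a common index set.\<close>

lemma lin_ext_eq:
  assumes Z: "module K Z" and f: "f \<in> carrier M \<rightarrow> carrier Z" and p: "p \<in> carrier (MF)"
    and S: "finite S" "supp p \<subseteq> S" "S \<subseteq> carrier M"
  shows "lin_ext K Z f p = finsum Z (\<lambda>x. p x \<odot>\<^bsub>Z\<^esub> f x) S"
proof -
  interpret Z: module K Z by fact
  show ?thesis unfolding lin_ext_def
    using S f monoid_algebra_carrierD[OF p]
    by (intro Z.add.finprod_mono_neutral_cong_left) (auto simp: Pi_iff subset_iff)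
qed

lemma lin_ext_linear:
  assumes Z: "module K Z" and f: "f \<in> carrier M \<rightarrow> carrier Z"
  shows "lin_ext K Z f \<in> linear_maps K (MF) Z"
proof (rule linear_mapsI)
  interpret Z: module K Z by fact
  note D = monoid_algebra_carrierD
  show "lin_ext K Z f p \<in> carrier Z" if p: "p \<in> carrier MF" for p
    unfolding lin_ext_def using f D[OF p] by (intro Z.finsum_closed) auto
  show "lin_ext K Z f (p \<oplus>\<^bsub>MF\<^esub> q) = lin_ext K Z f p \<oplus>\<^bsub>Z\<^esub> lin_ext K Z f q"
    if p: "p \<in> carrier MF" and q: "q \<in> carrier MF" for p q
  proof -
    let ?S = "supp p \<union> supp q"
    have S: "finite ?S" "?S \<subseteq> carrier M" "supp p \<subseteq> ?S" "supp q \<subseteq> ?S"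
      using D[OF p] D[OF q] by auto
    have S': "supp (p \<oplus>\<^bsub>MF\<^esub> q) \<subseteq> ?S" by (auto simp: monoid_algebra_def)
    have "lin_ext K Z f (p \<oplus>\<^bsub>MF\<^esub> q) = finsum Z (\<lambda>x. p x \<odot>\<^bsub>Z\<^esub> f x \<oplus>\<^bsub>Z\<^esub> q x \<odot>\<^bsub>Z\<^esub> f x) ?S"
      using S(2) f D[OF p] D[OF q]
      by (subst lin_ext_eq[OF Z f _ S(1) S' S(2)], use p q in simp, intro Z.finsum_cong')
        (auto simp: monoid_algebra_def Z.smult_l_distr Pi_iff)
    also have "\<dots> = lin_ext K Z f p \<oplus>\<^bsub>Z\<^esub> lin_ext K Z f q"
      using S(2) f D[OF p] D[OF q]
      unfolding lin_ext_eq[OF Z f p S(1,3,2)] lin_ext_eq[OF Z f q S(1,4,2)]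
      by (intro Z.finsum_addf) (auto simp: Pi_iff)
    finally show ?thesis .
  qed
  show "lin_ext K Z f (c \<odot>\<^bsub>MF\<^esub> p) = c \<odot>\<^bsub>Z\<^esub> lin_ext K Z f p"
    if c: "c \<in> carrier K" and p: "p \<in> carrier MF" for c p
  proof -
    have S: "finite (supp p)" "supp p \<subseteq> carrier M" "supp p \<subseteq> supp p" using D[OF p] by auto
    have S': "supp (c \<odot>\<^bsub>MF\<^esub> p) \<subseteq> supp p" using c by (auto simp: monoid_algebra_def)
    have "lin_ext K Z f (c \<odot>\<^bsub>MF\<^esub> p) = finsum Z (\<lambda>x. c \<odot>\<^bsub>Z\<^esub> (p x \<odot>\<^bsub>Z\<^esub> f x)) (supp p)"
      using S(2) f D[OF p] c
      by (subst lin_ext_eq[OF Z f _ S(1) S' S(2)], use p c in simp, intro Z.finsum_cong')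
        (auto simp: monoid_algebra_def Z.smult_assoc1 Pi_iff)
    also have "\<dots> = c \<odot>\<^bsub>Z\<^esub> lin_ext K Z f p"
      using f D[OF p] c unfolding lin_ext_def
      by (intro Z.finsum_smult_ldistr[symmetric]) (auto simp: Pi_iff)
    finally show ?thesis .
  qed
qed

lemma lin_ext_basis:
  assumes Z: "module K Z" and f: "f \<in> carrier M \<rightarrow> carrier Z" and x: "x \<in> carrier M"
  shows "lin_ext K Z f (me x) = f x"
proof -
  interpret Z: module K Z by fact
  have "{y. me x y \<noteq> \<zero>} = {x}" by (auto simp: basis_elem_def)
  then show ?thesis unfolding lin_ext_def
    using f x by (auto simp: basis_elem_def Z.finsum_insert Pi_iff)
qed

text \<open>Moving the condition on the product into the summand frees the index set from
  \<open>z\<close> and from the exact supports. Linearity in either factor then becomes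
  termwise.\<close>

lemma monoid_algebra_mult_eq:
  assumes p: "p \<in> carrier (MF)" and q: "q \<in> carrier (MF)"
    and S: "finite S" "supp p \<subseteq> S" and T: "finite T" "supp q \<subseteq> T"
  shows "(p \<otimes>\<^bsub>MF\<^esub> q) z =
    finsum K (\<lambda>(x, y). if x \<otimes>\<^bsub>M\<^esub> y = z then p x \<otimes> q y else \<zero>) (S \<times> T)"
proof -
  note D = monoid_algebra_carrierD[OF p] monoid_algebra_carrierD[OF q]
  have "finsum K (\<lambda>(x, y). p x \<otimes> q y)
               {(x, y). p x \<noteq> \<zero> \<and> q y \<noteq> \<zero> \<and> x \<otimes>\<^bsub>M\<^esub> y = z}
     = finsum K (\<lambda>(x, y). if x \<otimes>\<^bsub>M\<^esub> y = z then p x \<otimes> q y else \<zero>) (S \<times> T)"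
    using S T D by (intro K.add.finprod_mono_neutral_cong_left) (auto simp: K.integral_iff split: if_splits)
  then show ?thesis by (simp add: monoid_algebra_def)
qed

lemma monoid_algebra_mult_closed:
  assumes p: "p \<in> carrier (MF)" and q: "q \<in> carrier (MF)"
  shows "p \<otimes>\<^bsub>MF\<^esub> q \<in> carrier (MF)"
proof -
  note D = monoid_algebra_carrierD[OF p] monoid_algebra_carrierD[OF q]
  let ?S = "(\<lambda>(x, y). x \<otimes>\<^bsub>M\<^esub> y) ` (supp p \<times> supp q)"
  have eq: "(p \<otimes>\<^bsub>MF\<^esub> q) z = finsum K (\<lambda>(x, y). if x \<otimes>\<^bsub>M\<^esub> y = z then p x \<otimes> q y else \<zero>)
       (supp p \<times> supp q)" for z
    using D by (intro monoid_algebra_mult_eq[OF p q]) auto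
  have "supp (p \<otimes>\<^bsub>MF\<^esub> q) \<subseteq> ?S"
  proof (rule ccontr)
    assume "\<not> ?thesis"
    then obtain z where z: "(p \<otimes>\<^bsub>MF\<^esub> q) z \<noteq> \<zero>" "z \<notin> ?S" by auto
    have "(p \<otimes>\<^bsub>MF\<^esub> q) z = \<zero>"
      unfolding eq using z(2) by (intro K.add.finprod_one_eqI) auto
    then show False using z by simp
  qed
  moreover have "finite ?S" "?S \<subseteq> carrier M" using D by auto
  moreover have "(p \<otimes>\<^bsub>MF\<^esub> q) z \<in> carrier K" for z
    unfolding eq using D by (intro K.finsum_closed) auto
  ultimately show ?thesis
    by (auto simp: monoid_algebra_def image_subset_iff dest: finite_subset)
qed

lemma monoid_algebra_mult_basis:
  assumes x: "x \<in> carrier M" and y: "y \<in> carrier M"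
  shows "me x \<otimes>\<^bsub>MF\<^esub> me y = me (x \<otimes>\<^bsub>M\<^esub> y)"
proof
  fix z
  have "(me x \<otimes>\<^bsub>MF\<^esub> me y) z =
     finsum K (\<lambda>(a, b). if a \<otimes>\<^bsub>M\<^esub> b = z then me x a \<otimes> me y b else \<zero>) ({x} \<times> {y})"
    using x y by (intro monoid_algebra_mult_eq monoid_algebra_basis_closed) (auto simp: basis_elem_def)
  then show "(me x \<otimes>\<^bsub>MF\<^esub> me y) z = me (x \<otimes>\<^bsub>M\<^esub> y) z"
    by (auto simp: basis_elem_def K.finsum_insert)
qed

lemma monoid_algebra_mult_linear_left:
  assumes q: "q \<in> carrier (MF)"
  shows "(\<lambda>p. p \<otimes>\<^bsub>MF\<^esub> q) \<in> linear_maps K (MF) (MF)"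
proof (rule linear_mapsI)
  fix p p' assume p: "p \<in> carrier MF" and p': "p' \<in> carrier MF"
  note D = monoid_algebra_carrierD[OF p] monoid_algebra_carrierD[OF p'] monoid_algebra_carrierD[OF q]
  let ?S = "supp p \<union> supp p'"
  have S: "finite ?S" "supp p \<subseteq> ?S" "supp p' \<subseteq> ?S" "supp (p \<oplus>\<^bsub>MF\<^esub> p') \<subseteq> ?S"
    using D by (auto simp: monoid_algebra_def)
  let ?t = "\<lambda>p z (x, y). if x \<otimes>\<^bsub>M\<^esub> y = z then p x \<otimes> q y else \<zero>"
  have eq: "(r \<otimes>\<^bsub>MF\<^esub> q) z = finsum K (?t r z) (?S \<times> supp q)"
    if "r \<in> carrier MF" "supp r \<subseteq> ?S" for r z
    using D S that by (intro monoid_algebra_mult_eq[OF _ q]) auto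
  show "(p \<oplus>\<^bsub>MF\<^esub> p') \<otimes>\<^bsub>MF\<^esub> q = (p \<otimes>\<^bsub>MF\<^esub> q) \<oplus>\<^bsub>MF\<^esub> (p' \<otimes>\<^bsub>MF\<^esub> q)"
  proof
    fix z
    have "((p \<oplus>\<^bsub>MF\<^esub> p') \<otimes>\<^bsub>MF\<^esub> q) z = finsum K (\<lambda>w. ?t p z w \<oplus> ?t p' z w) (?S \<times> supp q)"
      using D S p p' by (subst eq, simp, simp, intro K.finsum_cong') (auto simp: monoid_algebra_def K.l_distr)
    also have "\<dots> = finsum K (?t p z) (?S \<times> supp q) \<oplus> finsum K (?t p' z) (?S \<times> supp q)"
      using D by (intro K.finsum_addf) auto
    also have "\<dots> = ((p \<otimes>\<^bsub>MF\<^esub> q) \<oplus>\<^bsub>MF\<^esub> (p' \<otimes>\<^bsub>MF\<^esub> q)) z"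
      using eq[OF p S(2)] eq[OF p' S(3)] by (simp add: monoid_algebra_def)
    finally show "((p \<oplus>\<^bsub>MF\<^esub> p') \<otimes>\<^bsub>MF\<^esub> q) z = ((p \<otimes>\<^bsub>MF\<^esub> q) \<oplus>\<^bsub>MF\<^esub> (p' \<otimes>\<^bsub>MF\<^esub> q)) z" .
  qed
next
  fix c p assume c: "c \<in> carrier K" and p: "p \<in> carrier MF"
  note D = monoid_algebra_carrierD[OF p] monoid_algebra_carrierD[OF q]
  let ?t = "\<lambda>p z (x, y). if x \<otimes>\<^bsub>M\<^esub> y = z then p x \<otimes> q y else \<zero>"
  have S: "supp (c \<odot>\<^bsub>MF\<^esub> p) \<subseteq> supp p" using c by (auto simp: monoid_algebra_def)
  have eq: "(r \<otimes>\<^bsub>MF\<^esub> q) z = finsum K (?t r z) (supp p \<times> supp q)"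
    if "r \<in> carrier MF" "supp r \<subseteq> supp p" for r z
    using D that by (intro monoid_algebra_mult_eq[OF _ q]) auto
  show "(c \<odot>\<^bsub>MF\<^esub> p) \<otimes>\<^bsub>MF\<^esub> q = c \<odot>\<^bsub>MF\<^esub> (p \<otimes>\<^bsub>MF\<^esub> q)"
  proof
    fix z
    have "((c \<odot>\<^bsub>MF\<^esub> p) \<otimes>\<^bsub>MF\<^esub> q) z = finsum K (\<lambda>w. c \<otimes> ?t p z w) (supp p \<times> supp q)"
      using D S p c by (subst eq, simp, simp, intro K.finsum_cong') (auto simp: monoid_algebra_def K.m_assoc)
    also have "\<dots> = c \<otimes> finsum K (?t p z) (supp p \<times> supp q)"
      using D c by (intro K.finsum_rdistr[symmetric]) auto
    also have "\<dots> = (c \<odot>\<^bsub>MF\<^esub> (p \<otimes>\<^bsub>MF\<^esub> q)) z"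
      using eq[OF p] by (simp add: monoid_algebra_def)
    finally show "((c \<odot>\<^bsub>MF\<^esub> p) \<otimes>\<^bsub>MF\<^esub> q) z = (c \<odot>\<^bsub>MF\<^esub> (p \<otimes>\<^bsub>MF\<^esub> q)) z" .
  qed
qed (use monoid_algebra_mult_closed q in blast)

lemma monoid_algebra_mult_linear_right:
  assumes q: "q \<in> carrier (MF)"
  shows "(\<lambda>p. q \<otimes>\<^bsub>MF\<^esub> p) \<in> linear_maps K (MF) (MF)"
proof (rule linear_mapsI)
  fix p p' assume p: "p \<in> carrier MF" and p': "p' \<in> carrier MF"
  note D = monoid_algebra_carrierD[OF p] monoid_algebra_carrierD[OF p'] monoid_algebra_carrierD[OF q]
  let ?S = "supp p \<union> supp p'"
  have S: "finite ?S" "supp p \<subseteq> ?S" "supp p' \<subseteq> ?S" "supp (p \<oplus>\<^bsub>MF\<^esub> p') \<subseteq> ?S"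
    using D by (auto simp: monoid_algebra_def)
  let ?t = "\<lambda>p z (x, y). if x \<otimes>\<^bsub>M\<^esub> y = z then q x \<otimes> p y else \<zero>"
  have eq: "(q \<otimes>\<^bsub>MF\<^esub> r) z = finsum K (?t r z) (supp q \<times> ?S)"
    if "r \<in> carrier MF" "supp r \<subseteq> ?S" for r z
    using D S that by (intro monoid_algebra_mult_eq[OF q]) auto
  show "q \<otimes>\<^bsub>MF\<^esub> (p \<oplus>\<^bsub>MF\<^esub> p') = (q \<otimes>\<^bsub>MF\<^esub> p) \<oplus>\<^bsub>MF\<^esub> (q \<otimes>\<^bsub>MF\<^esub> p')"
  proof
    fix z
    have "(q \<otimes>\<^bsub>MF\<^esub> (p \<oplus>\<^bsub>MF\<^esub> p')) z = finsum K (\<lambda>w. ?t p z w \<oplus> ?t p' z w) (supp q \<times> ?S)"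
      using D S p p' by (subst eq, simp, simp, intro K.finsum_cong') (auto simp: monoid_algebra_def K.r_distr)
    also have "\<dots> = finsum K (?t p z) (supp q \<times> ?S) \<oplus> finsum K (?t p' z) (supp q \<times> ?S)"
      using D by (intro K.finsum_addf) auto
    also have "\<dots> = ((q \<otimes>\<^bsub>MF\<^esub> p) \<oplus>\<^bsub>MF\<^esub> (q \<otimes>\<^bsub>MF\<^esub> p')) z"
      using eq[OF p S(2)] eq[OF p' S(3)] by (simp add: monoid_algebra_def)
    finally show "(q \<otimes>\<^bsub>MF\<^esub> (p \<oplus>\<^bsub>MF\<^esub> p')) z = ((q \<otimes>\<^bsub>MF\<^esub> p) \<oplus>\<^bsub>MF\<^esub> (q \<otimes>\<^bsub>MF\<^esub> p')) z" .
  qed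
next
  fix c p assume c: "c \<in> carrier K" and p: "p \<in> carrier MF"
  note D = monoid_algebra_carrierD[OF p] monoid_algebra_carrierD[OF q]
  let ?t = "\<lambda>p z (x, y). if x \<otimes>\<^bsub>M\<^esub> y = z then q x \<otimes> p y else \<zero>"
  have S: "supp (c \<odot>\<^bsub>MF\<^esub> p) \<subseteq> supp p" using c by (auto simp: monoid_algebra_def)
  have eq: "(q \<otimes>\<^bsub>MF\<^esub> r) z = finsum K (?t r z) (supp q \<times> supp p)"
    if "r \<in> carrier MF" "supp r \<subseteq> supp p" for r z
    using D that by (intro monoid_algebra_mult_eq[OF q]) auto
  show "q \<otimes>\<^bsub>MF\<^esub> (c \<odot>\<^bsub>MF\<^esub> p) = c \<odot>\<^bsub>MF\<^esub> (q \<otimes>\<^bsub>MF\<^esub> p)"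
  proof
    fix z
    have "(q \<otimes>\<^bsub>MF\<^esub> (c \<odot>\<^bsub>MF\<^esub> p)) z = finsum K (\<lambda>w. c \<otimes> ?t p z w) (supp q \<times> supp p)"
      using D S p c by (subst eq, simp, simp, intro K.finsum_cong') (auto simp: monoid_algebra_def K.m_lcomm)
    also have "\<dots> = c \<otimes> finsum K (?t p z) (supp q \<times> supp p)"
      using D c by (intro K.finsum_rdistr[symmetric]) auto
    also have "\<dots> = (c \<odot>\<^bsub>MF\<^esub> (q \<otimes>\<^bsub>MF\<^esub> p)) z"
      using eq[OF p] by (simp add: monoid_algebra_def)
    finally show "(q \<otimes>\<^bsub>MF\<^esub> (c \<odot>\<^bsub>MF\<^esub> p)) z = (c \<odot>\<^bsub>MF\<^esub> (q \<otimes>\<^bsub>MF\<^esub> p)) z" .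
  qed
qed (use monoid_algebra_mult_closed q in blast)

lemma monoid_algebra_one: "\<one>\<^bsub>MF\<^esub> = me \<one>\<^bsub>M\<^esub>"
  by (auto simp: monoid_algebra_def basis_elem_def)

lemma monoid_algebra_algebra: "assoc_algebra K (MF)"
proof -
  note L = monoid_algebra_mult_linear_left and R = monoid_algebra_mult_linear_right
  note C = monoid_algebra_mult_closed monoid_algebra_basis_closed
  note eqI = monoid_algebra_linear_eq[OF monoid_algebra_module]
  \<comment> \<open>Both sides of associativity are linear in each argument. The law for
    \<open>M\<close> is therefore extended from basis elements to arbitrary elements one argument at
    a time: first \<open>r\<close>, then \<open>q\<close>, then \<open>p\<close>.\<close>
  have assoc3: "(me x \<otimes>\<^bsub>MF\<^esub> me y) \<otimes>\<^bsub>MF\<^esub> r = me x \<otimes>\<^bsub>MF\<^esub> (me y \<otimes>\<^bsub>MF\<^esub> r)"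
    if "x \<in> carrier M" "y \<in> carrier M" "r \<in> carrier MF" for x y r
    by (rule eqI[OF R linear_maps_comp[OF R R] _ that(3)])
      (use that C in \<open>auto simp: monoid_algebra_mult_basis M.m_assoc\<close>)
  have assoc2: "(me x \<otimes>\<^bsub>MF\<^esub> q) \<otimes>\<^bsub>MF\<^esub> r = me x \<otimes>\<^bsub>MF\<^esub> (q \<otimes>\<^bsub>MF\<^esub> r)"
    if "x \<in> carrier M" "q \<in> carrier MF" "r \<in> carrier MF" for x q r
    by (rule eqI[OF linear_maps_comp[OF R L] linear_maps_comp[OF L R] _ that(2)])
      (use that C assoc3 in auto)
  have assoc: "(p \<otimes>\<^bsub>MF\<^esub> q) \<otimes>\<^bsub>MF\<^esub> r = p \<otimes>\<^bsub>MF\<^esub> (q \<otimes>\<^bsub>MF\<^esub> r)"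
    if "p \<in> carrier MF" "q \<in> carrier MF" "r \<in> carrier MF" for p q r
    by (rule eqI[OF linear_maps_comp[OF L L] L _ that(1)])
      (use that C assoc2 in auto)
  have l_one: "\<one>\<^bsub>MF\<^esub> \<otimes>\<^bsub>MF\<^esub> p = p" if "p \<in> carrier MF" for p
    by (rule eqI[OF R linear_maps_id _ that])
      (use C in \<open>auto simp: monoid_algebra_one monoid_algebra_mult_basis\<close>)
  have r_one: "p \<otimes>\<^bsub>MF\<^esub> \<one>\<^bsub>MF\<^esub> = p" if "p \<in> carrier MF" for p
    by (rule eqI[OF L linear_maps_id _ that])
      (use C in \<open>auto simp: monoid_algebra_one monoid_algebra_mult_basis\<close>)
  have "ring MF"
    by (intro ringI monoidI monoid_algebra_abelian_group)
      (use C assoc l_one r_one linear_maps_add[OF L] linear_maps_add[OF R]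
        in \<open>auto simp: monoid_algebra_one\<close>)
  then show ?thesis
    using linear_maps_smult[OF L] linear_maps_smult[OF R]
    by (intro assoc_algebra.intro assoc_algebra_axioms.intro K monoid_algebra_module) auto
qed

lemma lin_ext_alg_hom:
  assumes Z: "assoc_algebra K Z" and f: "f \<in> carrier M \<rightarrow> carrier Z"
    and one: "f \<one>\<^bsub>M\<^esub> = \<one>\<^bsub>Z\<^esub>"
    and mult: "\<And>x y. x \<in> carrier M \<Longrightarrow> y \<in> carrier M \<Longrightarrow> f (x \<otimes>\<^bsub>M\<^esub> y) = f x \<otimes>\<^bsub>Z\<^esub> f y"
  shows "lin_ext K Z f \<in> alg_hom K (MF) Z"
proof -
  interpret Z: assoc_algebra K Z by fact
  note Zm = Z.module_axioms
  let ?l = "lin_ext K Z f"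
  have l: "?l \<in> linear_maps K MF Z" by (rule lin_ext_linear[OF Zm f])
  note lb = lin_ext_basis[OF Zm f]
  note L = monoid_algebra_mult_linear_left and R = monoid_algebra_mult_linear_right
  note C = monoid_algebra_mult_closed monoid_algebra_basis_closed
  have left: "(\<lambda>x. ?l x \<otimes>\<^bsub>Z\<^esub> z) \<in> linear_maps K MF Z" if "z \<in> carrier Z" for z
    using that l linear_maps_closed[OF l]
    by (intro linear_mapsI) (auto simp: linear_maps_add linear_maps_smult Z.l_distr Z.smult_mult_left)
  have right: "(\<lambda>x. z \<otimes>\<^bsub>Z\<^esub> ?l x) \<in> linear_maps K MF Z" if "z \<in> carrier Z" for z
    using that l linear_maps_closed[OF l]
    by (intro linear_mapsI) (auto simp: linear_maps_add linear_maps_smult Z.r_distr Z.smult_mult_right)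
  have m1: "?l (me x \<otimes>\<^bsub>MF\<^esub> q) = ?l (me x) \<otimes>\<^bsub>Z\<^esub> ?l q" if "x \<in> carrier M" "q \<in> carrier MF" for x q
    by (rule monoid_algebra_linear_eq[OF Zm linear_maps_comp[OF R l] right _ that(2)])
      (use that C linear_maps_closed[OF l] mult f in \<open>auto simp: monoid_algebra_mult_basis lb Pi_iff\<close>)
  have m2: "?l (p \<otimes>\<^bsub>MF\<^esub> q) = ?l p \<otimes>\<^bsub>Z\<^esub> ?l q" if "p \<in> carrier MF" "q \<in> carrier MF" for p q
    by (rule monoid_algebra_linear_eq[OF Zm linear_maps_comp[OF L l] left _ that(1)])
      (use that C linear_maps_closed[OF l] m1 in auto)
  show ?thesis
    by (rule alg_homI[OF l]) (use m2 one in \<open>auto simp: monoid_algebra_one lb\<close>)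
qed

end

section \<open>Bilinear maps and tensor products\<close>

definition bilinear_maps ::
  "'k ring \<Rightarrow> ('k, 'v) module \<Rightarrow> ('k, 'w) module \<Rightarrow> ('k, 'z) module \<Rightarrow> ('v \<Rightarrow> 'w \<Rightarrow> 'z) set" where
  "bilinear_maps K V W Z = {f. (\<forall>v\<in>carrier V. f v \<in> linear_maps K W Z) \<and>
     (\<forall>w\<in>carrier W. (\<lambda>v. f v w) \<in> linear_maps K V Z)}"

lemma bilinear_mapsI:
  assumes "\<And>v. v \<in> carrier V \<Longrightarrow> f v \<in> linear_maps K W Z"
    and "\<And>w. w \<in> carrier W \<Longrightarrow> (\<lambda>v. f v w) \<in> linear_maps K V Z"
  shows "f \<in> bilinear_maps K V W Z"
  using assms by (simp add: bilinear_maps_def)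

lemma bilinear_mapsD:
  assumes "f \<in> bilinear_maps K V W Z"
  shows "v \<in> carrier V \<Longrightarrow> f v \<in> linear_maps K W Z"
    and "w \<in> carrier W \<Longrightarrow> (\<lambda>v. f v w) \<in> linear_maps K V Z"
    and "v \<in> carrier V \<Longrightarrow> w \<in> carrier W \<Longrightarrow> f v w \<in> carrier Z"
  using assms by (auto simp: bilinear_maps_def intro: linear_maps_closed)

lemma bilinear_maps_comp:
  assumes "f \<in> bilinear_maps K V W Z" "L \<in> linear_maps K Z Y"
  shows "(\<lambda>v w. L (f v w)) \<in> bilinear_maps K V W Y"
  using assms by (intro bilinear_mapsI) (auto intro: linear_maps_comp bilinear_mapsD)

lemma bilinear_maps_precomp:
  assumes "f \<in> bilinear_maps K V' W' Z" "g \<in> linear_maps K V V'" "h \<in> linear_maps K W W'"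
  shows "(\<lambda>v w. f (g v) (h w)) \<in> bilinear_maps K V W Z"
proof (rule bilinear_mapsI)
  show "(\<lambda>w. f (g v) (h w)) \<in> linear_maps K W Z" if "v \<in> carrier V" for v
    by (rule linear_maps_comp[OF assms(3) bilinear_mapsD(1)[OF assms(1)
          linear_maps_closed[OF assms(2) that]]])
  show "(\<lambda>v. f (g v) (h w)) \<in> linear_maps K V Z" if "w \<in> carrier W" for w
    by (rule linear_maps_comp[OF assms(2) bilinear_mapsD(2)[OF assms(1)
          linear_maps_closed[OF assms(3) that]]])
qed

lemma bilinear_maps_swap:
  "f \<in> bilinear_maps K V W Z \<Longrightarrow> (\<lambda>w v. f v w) \<in> bilinear_maps K W V Z"
  by (intro bilinear_mapsI) (auto intro: bilinear_mapsD)

lemma mult_bilinear: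
  assumes "assoc_algebra K A" shows "mult A \<in> bilinear_maps K A A A"
proof -
  interpret A: assoc_algebra K A by fact
  show ?thesis
    by (intro bilinear_mapsI linear_mapsI)
      (auto simp: A.l_distr A.r_distr A.smult_mult_left A.smult_mult_right)
qed

text \<open>With the field regarded as the module \<open>base_algebra K\<close>, scalar
  multiplication is an ordinary bilinear map. Precomposing it with a functional such as the counit
  then yields bilinear maps like \<open>f x\<close> times \<open>a\<close>.\<close>

lemma smult_bilinear:
  assumes "assoc_algebra K A" shows "smult A \<in> bilinear_maps K (base_algebra K) A A"
proof -
  interpret A: assoc_algebra K A by fact
  show ?thesis
    by (intro bilinear_mapsI linear_mapsI)
      (auto simp: base_algebra_def A.smult_l_distr A.smult_r_distr A.K.m_comm
        simp flip: A.smult_assoc1)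
qed

section \<open>Submodules spanned by relations\<close>

lemma submodule_Inter:
  assumes "module K V" "\<And>N. N \<in> C \<Longrightarrow> submodule N K V" "C \<noteq> {}"
  shows "submodule (\<Inter>C) K V"
proof -
  interpret V: module K V by fact
  note E = V.submoduleE[OF assms(2)]
  have z: "\<zero>\<^bsub>V\<^esub> \<in> N" if "N \<in> C" for N
    by (rule submodule_zero[OF assms(2)[OF that]])
  show ?thesis
  proof (rule V.submoduleI)
    show "\<Inter>C \<subseteq> carrier V" using E(1) assms(3) by fastforce
    show "\<zero>\<^bsub>V\<^esub> \<in> \<Inter>C" using z by blast
    show "\<ominus>\<^bsub>V\<^esub> a \<in> \<Inter>C" if "a \<in> \<Inter>C" for a using that E(3) by (meson InterE InterI)
    show "a \<oplus>\<^bsub>V\<^esub> b \<in> \<Inter>C" if "a \<in> \<Inter>C" "b \<in> \<Inter>C" for a b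
      using that E(5) by (meson InterE InterI)
    show "c \<odot>\<^bsub>V\<^esub> a \<in> \<Inter>C" if "c \<in> carrier K" "a \<in> \<Inter>C" for c a
      using that E(4) by (meson InterE InterI)
  qed
qed

lemma module_span_submodule:
  assumes "module K V" "R \<subseteq> carrier V"
  shows "submodule (module_span K V R) K V"
  unfolding module_span_def
  using module.carrier_is_submodule[OF assms(1)] assms
  by (intro submodule_Inter) auto

lemma module_span_subset: "R \<subseteq> module_span K V R"
  by (auto simp: module_span_def)

lemma module_span_least: "submodule N K V \<Longrightarrow> R \<subseteq> N \<Longrightarrow> module_span K V R \<subseteq> N"
  by (auto simp: module_span_def)

section \<open>The tensor product as an algebra\<close>

context
  fixes K :: "'k ring" and V :: "('k, 'v) module" and W :: "('k, 'w) module"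
  assumes V: "assoc_algebra K V" and W: "assoc_algebra K W"
begin

interpretation V: assoc_algebra K V by (rule V)
interpretation W: assoc_algebra K W by (rule W)

private abbreviation (input) "F \<equiv> tensor_free K V W"
private abbreviation (input) "e \<equiv> basis_elem K"
private abbreviation (input) "N \<equiv> tensor_null K V W"

private lemma M: "Group.monoid (V \<times>\<times> W)"
  by (rule DirProd_monoid) (rule V.monoid_axioms W.monoid_axioms)+

private lemma F: "assoc_algebra K F"
  unfolding tensor_free_def by (rule monoid_algebra_algebra[OF V.K.field_axioms M])

interpretation F: assoc_algebra K F by (rule F)

private lemma e_closed: "v \<in> carrier V \<Longrightarrow> w \<in> carrier W \<Longrightarrow> e (v, w) \<in> carrier F"
  unfolding tensor_free_def by (rule monoid_algebra_basis_closed[OF V.K.field_axioms M]) simp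

private lemma e_mult:
  "v \<in> carrier V \<Longrightarrow> w \<in> carrier W \<Longrightarrow> v' \<in> carrier V \<Longrightarrow> w' \<in> carrier W \<Longrightarrow>
    e (v, w) \<otimes>\<^bsub>F\<^esub> e (v', w') = e (v \<otimes>\<^bsub>V\<^esub> v', w \<otimes>\<^bsub>W\<^esub> w')"
  unfolding tensor_free_def
  using monoid_algebra_mult_basis[OF V.K.field_axioms M, of "(v, w)" "(v', w')"] by simp

private lemma rels_closed: "tensor_rels K V W \<subseteq> carrier F"
  by (auto simp: tensor_rels_def Let_def intro!: F.minus_closed F.a_closed F.smult_closed e_closed)

private lemma null_submodule: "submodule N K F"
  unfolding tensor_null_def by (rule module_span_submodule[OF F.module_axioms rels_closed])

private lemmas NE = F.submoduleE[OF null_submodule]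

private lemma null_rels:
  "v \<in> carrier V \<Longrightarrow> v' \<in> carrier V \<Longrightarrow> w \<in> carrier W \<Longrightarrow>
    e (v \<oplus>\<^bsub>V\<^esub> v', w) \<ominus>\<^bsub>F\<^esub> (e (v, w) \<oplus>\<^bsub>F\<^esub> e (v', w)) \<in> N"
  "v \<in> carrier V \<Longrightarrow> w \<in> carrier W \<Longrightarrow> w' \<in> carrier W \<Longrightarrow>
    e (v, w \<oplus>\<^bsub>W\<^esub> w') \<ominus>\<^bsub>F\<^esub> (e (v, w) \<oplus>\<^bsub>F\<^esub> e (v, w')) \<in> N"
  "c \<in> carrier K \<Longrightarrow> v \<in> carrier V \<Longrightarrow> w \<in> carrier W \<Longrightarrow>
    e (c \<odot>\<^bsub>V\<^esub> v, w) \<ominus>\<^bsub>F\<^esub> c \<odot>\<^bsub>F\<^esub> e (v, w) \<in> N"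
  "c \<in> carrier K \<Longrightarrow> v \<in> carrier V \<Longrightarrow> w \<in> carrier W \<Longrightarrow>
    e (v, c \<odot>\<^bsub>W\<^esub> w) \<ominus>\<^bsub>F\<^esub> c \<odot>\<^bsub>F\<^esub> e (v, w) \<in> N"
proof -
  have sub: "tensor_rels K V W \<subseteq> N" unfolding tensor_null_def by (rule module_span_subset)
  show "v \<in> carrier V \<Longrightarrow> v' \<in> carrier V \<Longrightarrow> w \<in> carrier W \<Longrightarrow>
    e (v \<oplus>\<^bsub>V\<^esub> v', w) \<ominus>\<^bsub>F\<^esub> (e (v, w) \<oplus>\<^bsub>F\<^esub> e (v', w)) \<in> N"
    by (rule subsetD[OF sub]) (unfold tensor_rels_def Let_def, blast)
  show "v \<in> carrier V \<Longrightarrow> w \<in> carrier W \<Longrightarrow> w' \<in> carrier W \<Longrightarrow>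
    e (v, w \<oplus>\<^bsub>W\<^esub> w') \<ominus>\<^bsub>F\<^esub> (e (v, w) \<oplus>\<^bsub>F\<^esub> e (v, w')) \<in> N"
    by (rule subsetD[OF sub]) (unfold tensor_rels_def Let_def, blast)
  show "c \<in> carrier K \<Longrightarrow> v \<in> carrier V \<Longrightarrow> w \<in> carrier W \<Longrightarrow>
    e (c \<odot>\<^bsub>V\<^esub> v, w) \<ominus>\<^bsub>F\<^esub> c \<odot>\<^bsub>F\<^esub> e (v, w) \<in> N"
    by (rule subsetD[OF sub]) (unfold tensor_rels_def Let_def, blast)
  show "c \<in> carrier K \<Longrightarrow> v \<in> carrier V \<Longrightarrow> w \<in> carrier W \<Longrightarrow>
    e (v, c \<odot>\<^bsub>W\<^esub> w) \<ominus>\<^bsub>F\<^esub> c \<odot>\<^bsub>F\<^esub> e (v, w) \<in> N"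
    by (rule subsetD[OF sub]) (unfold tensor_rels_def Let_def, blast)
qed

text \<open>The submodule \<open>N'\<close> is arbitrary because there are two uses: with
  \<open>N'\<close> zero, bilinear maps factor through the quotient; with \<open>N'\<close> the null
  space itself, multiplication is seen to preserve the relations.\<close>

private lemma null_least:
  assumes Z: "assoc_algebra K Z" and L: "L \<in> linear_maps K F Z" and N': "submodule N' K Z"
    and "\<And>v v' w. v \<in> carrier V \<Longrightarrow> v' \<in> carrier V \<Longrightarrow> w \<in> carrier W \<Longrightarrow>
      L (e (v \<oplus>\<^bsub>V\<^esub> v', w)) \<ominus>\<^bsub>Z\<^esub> (L (e (v, w)) \<oplus>\<^bsub>Z\<^esub> L (e (v', w))) \<in> N'"
    and "\<And>v w w'. v \<in> carrier V \<Longrightarrow> w \<in> carrier W \<Longrightarrow> w' \<in> carrier W \<Longrightarrow>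
      L (e (v, w \<oplus>\<^bsub>W\<^esub> w')) \<ominus>\<^bsub>Z\<^esub> (L (e (v, w)) \<oplus>\<^bsub>Z\<^esub> L (e (v, w'))) \<in> N'"
    and "\<And>c v w. c \<in> carrier K \<Longrightarrow> v \<in> carrier V \<Longrightarrow> w \<in> carrier W \<Longrightarrow>
      L (e (c \<odot>\<^bsub>V\<^esub> v, w)) \<ominus>\<^bsub>Z\<^esub> c \<odot>\<^bsub>Z\<^esub> L (e (v, w)) \<in> N'"
    and "\<And>c v w. c \<in> carrier K \<Longrightarrow> v \<in> carrier V \<Longrightarrow> w \<in> carrier W \<Longrightarrow>
      L (e (v, c \<odot>\<^bsub>W\<^esub> w)) \<ominus>\<^bsub>Z\<^esub> c \<odot>\<^bsub>Z\<^esub> L (e (v, w)) \<in> N'"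
    and x: "x \<in> N"
  shows "L x \<in> N'"
proof -
  interpret Z: assoc_algebra K Z by fact
  note minus = linear_maps_minus[OF F.module_axioms Z.module_axioms L]
  have "N \<subseteq> {x \<in> carrier F. L x \<in> N'}"
    unfolding tensor_null_def
  proof (rule module_span_least[OF submodule_vimage[OF F.module_axioms Z.module_axioms L N']])
    have "L r \<in> N'" if "r \<in> tensor_rels K V W" for r
      using that assms(4-7) unfolding tensor_rels_def Let_def
      by (auto simp: minus linear_maps_add[OF L] linear_maps_smult[OF L] e_closed)
    then show "tensor_rels K V W \<subseteq> {x \<in> carrier F. L x \<in> N'}" using rels_closed by auto
  qed
  then show ?thesis using x by auto
qed

text \<open>Since the products of \<open>V\<close> and \<open>W\<close> are bilinear, multiplying a
  bilinearity relation by a basis element on either side gives another such relation. Arbitrary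
  factors follow by induction.\<close>

private lemma null_ideal: "ideal N F"
proof -
  note R = mult_bilinear[OF F]
  note FM = F.module_axioms
  have sub: "p \<otimes>\<^bsub>F\<^esub> x \<in> N \<and> x \<otimes>\<^bsub>F\<^esub> p \<in> N" if x: "x \<in> N" and p: "p \<in> carrier F" for x p
  proof -
    have xF: "x \<in> carrier F" using x NE(1) by auto
    have e_null: "e (a, b) \<otimes>\<^bsub>F\<^esub> x \<in> N" "x \<otimes>\<^bsub>F\<^esub> e (a, b) \<in> N"
      if ab: "a \<in> carrier V" "b \<in> carrier W" for a b
    proof -
      show "e (a, b) \<otimes>\<^bsub>F\<^esub> x \<in> N"
        by (rule null_least[OF F bilinear_mapsD(1)[OF R e_closed[OF ab]] null_submodule _ _ _ _ x])
          (use ab in \<open>simp_all add: e_mult V.r_distr W.r_distr V.smult_mult_right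
            W.smult_mult_right null_rels\<close>)
      show "x \<otimes>\<^bsub>F\<^esub> e (a, b) \<in> N"
        by (rule null_least[OF F bilinear_mapsD(2)[OF R e_closed[OF ab]] null_submodule _ _ _ _ x])
          (use ab in \<open>simp_all add: e_mult V.l_distr W.l_distr V.smult_mult_left
            W.smult_mult_left null_rels\<close>)
    qed
    have z: "\<zero>\<^bsub>F\<^esub> \<in> N"
      by (rule submodule_zero[OF null_submodule])
    show ?thesis
      using p unfolding tensor_free_def
    proof (induction rule: monoid_algebra_induct[OF V.K.field_axioms M, consumes 1, case_names zero basis smult add])
      case zero
      then show ?case using z xF unfolding tensor_free_def[symmetric] by simp
    next
      case (basis y)
      then show ?case using e_null
        unfolding tensor_free_def[symmetric] by (cases y) auto
    next
      case (smult c p)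
      then show ?case using xF NE(4) unfolding tensor_free_def[symmetric]
        by (simp add: F.smult_mult_left F.smult_mult_right)
    next
      case (add p q)
      then show ?case using xF NE(5) unfolding tensor_free_def[symmetric]
        by (simp add: F.l_distr F.r_distr)
    qed
  qed
  show ?thesis
    by (rule idealI[OF F.ring_axioms submodule.axioms(1)[OF null_submodule]]) (use sub in auto)
qed

lemma tensor_assoc_algebra: "assoc_algebra K (tensor K V W)"
  unfolding tensor_def by (rule quot_algebra_algebra[OF F null_ideal])

interpretation T: assoc_algebra K "tensor K V W" by (rule tensor_assoc_algebra)

lemma pure_tensor_closed:
  "v \<in> carrier V \<Longrightarrow> w \<in> carrier W \<Longrightarrow> pure_tensor K V W v w \<in> carrier (tensor K V W)"
  unfolding tensor_def pure_tensor_def by (simp add: quot_carrier[OF F null_ideal] e_closed)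

lemma pure_tensor_bilinear: "pure_tensor K V W \<in> bilinear_maps K V W (tensor K V W)"
proof -
  note q = quot_eq_iff[OF F null_ideal] quot_add[OF F null_ideal] quot_smult[OF F null_ideal]
    quot_carrier[OF F null_ideal]
  show ?thesis
    unfolding tensor_def pure_tensor_def
    by (intro bilinear_mapsI linear_mapsI) (simp_all add: q e_closed null_rels)
qed

lemma pure_tensor_mult:
  "v \<in> carrier V \<Longrightarrow> w \<in> carrier W \<Longrightarrow> v' \<in> carrier V \<Longrightarrow> w' \<in> carrier W \<Longrightarrow>
    pure_tensor K V W v w \<otimes>\<^bsub>tensor K V W\<^esub> pure_tensor K V W v' w' =
    pure_tensor K V W (v \<otimes>\<^bsub>V\<^esub> v') (w \<otimes>\<^bsub>W\<^esub> w')"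
  unfolding tensor_def pure_tensor_def by (simp add: quot_mult[OF F null_ideal] e_closed e_mult)

lemma tensor_one: "\<one>\<^bsub>tensor K V W\<^esub> = pure_tensor K V W \<one>\<^bsub>V\<^esub> \<one>\<^bsub>W\<^esub>"
  unfolding tensor_def pure_tensor_def quot_one[OF F null_ideal]
  by (simp add: tensor_free_def monoid_algebra_one[OF V.K.field_axioms M])

text \<open>Zero and scalar multiples need no cases of their own: zero is a pure tensor, and
  \<open>c (v \<otimes> w) = (c v) \<otimes> w\<close>.\<close>

lemma tensor_induct [consumes 1, case_names pure add]:
  assumes x: "x \<in> carrier (tensor K V W)"
    and pure: "\<And>v w. v \<in> carrier V \<Longrightarrow> w \<in> carrier W \<Longrightarrow> P (pure_tensor K V W v w)"
    and add: "\<And>x y. x \<in> carrier (tensor K V W) \<Longrightarrow> y \<in> carrier (tensor K V W) \<Longrightarrow> P x \<Longrightarrow> P y \<Longrightarrow>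
      P (x \<oplus>\<^bsub>tensor K V W\<^esub> y)"
  shows "P x"
proof -
  note q = quot_add[OF F null_ideal] quot_smult[OF F null_ideal] quot_carrier[OF F null_ideal]
  note b = bilinear_mapsD[OF pure_tensor_bilinear]
  have pure_zero: "pure_tensor K V W \<zero>\<^bsub>V\<^esub> \<zero>\<^bsub>W\<^esub> = \<zero>\<^bsub>tensor K V W\<^esub>"
    by (rule linear_maps_zero[OF W.module_axioms T.module_axioms b(1)]) simp
  have proj: "(\<lambda>p. N +>\<^bsub>F\<^esub> p) \<in> linear_maps K F (tensor K V W)"
    unfolding tensor_def using quot_proj_alg_hom[OF F null_ideal] by (rule alg_homD)
  \<comment> \<open>Quantifying over a scalar factor carries the step for scalar multiples, as
    \<open>P\<close> itself is not assumed to be stable under them.\<close>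
  have "\<forall>c\<in>carrier K. P (c \<odot>\<^bsub>tensor K V W\<^esub> (N +>\<^bsub>F\<^esub> p))" if "p \<in> carrier F" for p
    using that unfolding tensor_free_def
  proof (induction rule: monoid_algebra_induct[OF V.K.field_axioms M, consumes 1, case_names zero basis smult add])
    case zero
    show ?case unfolding tensor_free_def[symmetric]
      using assms(2)[of "\<zero>\<^bsub>V\<^esub>" "\<zero>\<^bsub>W\<^esub>"] linear_maps_zero[OF F.module_axioms T.module_axioms proj]
        pure_zero
      by simp
  next
    case (basis y)
    then show ?case unfolding tensor_free_def[symmetric]
      using pure by (cases y)
        (auto simp: pure_tensor_def[symmetric] linear_maps_smult[OF b(2), symmetric])
  next
    case (smult c p)
    then show ?case unfolding tensor_free_def[symmetric]
      using linear_maps_smult[OF proj] linear_maps_closed[OF proj]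
      by (simp flip: T.smult_assoc1)
  next
    case (add p q)
    then show ?case unfolding tensor_free_def[symmetric]
      using linear_maps_add[OF proj] linear_maps_closed[OF proj]
      by (simp add: T.smult_r_distr assms(3))
  qed
  then have "P (\<one>\<^bsub>K\<^esub> \<odot>\<^bsub>tensor K V W\<^esub> (N +>\<^bsub>F\<^esub> p))" if "p \<in> carrier F" for p
    using that by simp
  then have "P (N +>\<^bsub>F\<^esub> p)" if "p \<in> carrier F" for p
    using that linear_maps_closed[OF proj] by simp
  then show ?thesis using x unfolding tensor_def by (auto simp: q)
qed

lemma tensor_linear_eq:
  assumes "f \<in> linear_maps K (tensor K V W) Z" "g \<in> linear_maps K (tensor K V W) Z"
    and "\<And>v w. v \<in> carrier V \<Longrightarrow> w \<in> carrier W \<Longrightarrow> f (pure_tensor K V W v w) = g (pure_tensor K V W v w)"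
    and "x \<in> carrier (tensor K V W)"
  shows "f x = g x"
  using assms(4)
  by (induction rule: tensor_induct) (use assms in \<open>auto simp: linear_maps_add\<close>)

section \<open>Universal property of the tensor product\<close>

context
  fixes Z :: "('k, 'z) module" and f :: "'v \<Rightarrow> 'w \<Rightarrow> 'z"
  assumes Z: "assoc_algebra K Z" and f: "f \<in> bilinear_maps K V W Z"
begin

interpretation Z: assoc_algebra K Z by (rule Z)

private abbreviation (input) "l \<equiv> lin_ext K Z (\<lambda>(v, w). f v w)"

private lemma fM: "(\<lambda>(v, w). f v w) \<in> carrier (V \<times>\<times> W) \<rightarrow> carrier Z"
  using bilinear_mapsD(3)[OF f] by auto

private lemma l_linear: "l \<in> linear_maps K F Z"
  unfolding tensor_free_def
  by (rule lin_ext_linear[OF V.K.field_axioms M Z.module_axioms fM])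

private lemma l_basis: "v \<in> carrier V \<Longrightarrow> w \<in> carrier W \<Longrightarrow> l (e (v, w)) = f v w"
  by (subst lin_ext_basis[OF V.K.field_axioms M Z.module_axioms fM]) auto

private lemma l_null: "x \<in> N \<Longrightarrow> l x = \<zero>\<^bsub>Z\<^esub>"
  using null_least[OF Z l_linear zero_submodule[OF Z.module_axioms], of x]
    linear_maps_add[OF bilinear_mapsD(1)[OF f]] linear_maps_smult[OF bilinear_mapsD(1)[OF f]]
    linear_maps_add[OF bilinear_mapsD(2)[OF f]] linear_maps_smult[OF bilinear_mapsD(2)[OF f]]
  by (simp add: l_basis bilinear_mapsD(3)[OF f] Z.minus_eq_zero_iff)

lemma tensor_lift_linear: "tensor_lift K Z f \<in> linear_maps K (tensor K V W) Z"
  unfolding tensor_def tensor_lift_def[abs_def]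
  by (rule quot_lift_linear[OF F null_ideal Z.module_axioms l_linear l_null])

lemma tensor_lift_pure:
  "v \<in> carrier V \<Longrightarrow> w \<in> carrier W \<Longrightarrow> tensor_lift K Z f (pure_tensor K V W v w) = f v w"
  unfolding pure_tensor_def tensor_lift_def
  by (subst quot_lift_eq[OF F null_ideal Z.module_axioms l_linear l_null])
    (auto simp: e_closed l_basis)

lemma tensor_lift_alg_hom:
  assumes one: "f \<one>\<^bsub>V\<^esub> \<one>\<^bsub>W\<^esub> = \<one>\<^bsub>Z\<^esub>"
    and mult: "\<And>v w v' w'. v \<in> carrier V \<Longrightarrow> w \<in> carrier W \<Longrightarrow> v' \<in> carrier V \<Longrightarrow> w' \<in> carrier W \<Longrightarrow>
      f (v \<otimes>\<^bsub>V\<^esub> v') (w \<otimes>\<^bsub>W\<^esub> w') = f v w \<otimes>\<^bsub>Z\<^esub> f v' w'"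
  shows "tensor_lift K Z f \<in> alg_hom K (tensor K V W) Z"
proof (rule alg_homI[OF tensor_lift_linear])
  let ?L = "tensor_lift K Z f" and ?T = "tensor K V W"
  note L = tensor_lift_linear
  show "?L \<one>\<^bsub>?T\<^esub> = \<one>\<^bsub>Z\<^esub>" by (simp add: tensor_one tensor_lift_pure one)
  have m1: "?L (pure_tensor K V W v w \<otimes>\<^bsub>?T\<^esub> y) = f v w \<otimes>\<^bsub>Z\<^esub> ?L y"
    if "v \<in> carrier V" "w \<in> carrier W" "y \<in> carrier ?T" for v w y
    using that(3)
    by (induction rule: tensor_induct)
      (use that in \<open>simp_all add: pure_tensor_mult tensor_lift_pure mult pure_tensor_closed
        T.r_distr Z.r_distr linear_maps_add[OF L] bilinear_mapsD(3)[OF f] linear_maps_closed[OF L]\<close>)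
  show "?L (x \<otimes>\<^bsub>?T\<^esub> y) = ?L x \<otimes>\<^bsub>Z\<^esub> ?L y" if "x \<in> carrier ?T" "y \<in> carrier ?T" for x y
    using that(1)
    by (induction rule: tensor_induct)
      (use that in \<open>simp_all add: m1 tensor_lift_pure pure_tensor_closed
        T.l_distr Z.l_distr linear_maps_add[OF L] linear_maps_closed[OF L]\<close>)
qed

end

lemma bilinear_maps_cong:
  assumes "f \<in> bilinear_maps K V W Z"
    "\<And>v w. v \<in> carrier V \<Longrightarrow> w \<in> carrier W \<Longrightarrow> g v w = f v w"
  shows "g \<in> bilinear_maps K V W Z"
proof (rule bilinear_mapsI)
  show "g v \<in> linear_maps K W Z" if "v \<in> carrier V" for v
    by (rule linear_maps_cong[OF W.module_axioms bilinear_mapsD(1)[OF assms(1) that]])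
      (use assms(2) that in auto)
  show "(\<lambda>v. g v w) \<in> linear_maps K V Z" if "w \<in> carrier W" for w
    by (rule linear_maps_cong[OF V.module_axioms bilinear_mapsD(2)[OF assms(1) that]])
      (use assms(2) that in auto)
qed

text \<open>In Sweedler notation, a linear map is moved under the sum. Together with
  \<open>tensor_lift_cong\<close>, \<open>tensor_lift_map\<close> and \<open>coassoc_lift\<close>,
  this rule carries the later calculations with Sweedler sums.\<close>

lemma tensor_lift_comp:
  assumes Z: "assoc_algebra K Z" and f: "f \<in> bilinear_maps K V W Z"
    and Y: "assoc_algebra K Y" and L: "L \<in> linear_maps K Z Y"
    and x: "x \<in> carrier (tensor K V W)"
  shows "L (tensor_lift K Z f x) = tensor_lift K Y (\<lambda>v w. L (f v w)) x"
  by (rule tensor_linear_eq[OF linear_maps_comp[OF tensor_lift_linear[OF Z f] L]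
        tensor_lift_linear[OF Y bilinear_maps_comp[OF f L]] _ x])
    (simp add: tensor_lift_pure Z f Y bilinear_maps_comp[OF f L])

lemma tensor_lift_cong:
  assumes Z: "assoc_algebra K Z" and f: "f \<in> bilinear_maps K V W Z"
    and eq: "\<And>v w. v \<in> carrier V \<Longrightarrow> w \<in> carrier W \<Longrightarrow> g v w = f v w"
    and x: "x \<in> carrier (tensor K V W)"
  shows "tensor_lift K Z g x = tensor_lift K Z f x"
  by (rule tensor_linear_eq[OF tensor_lift_linear[OF Z bilinear_maps_cong[OF f eq]]
        tensor_lift_linear[OF Z f] _ x])
    (simp_all add: tensor_lift_pure Z f eq bilinear_maps_cong[OF f eq])

text \<open>Nested lifts, as in \<open>tensor_assoc\<close>, require the inner lift to be linear in
  the outer variable. For pure \<open>x\<close> this is the hypothesis on \<open>f\<close>, and sums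
  of linear maps are linear.\<close>

lemma tensor_lift_parameter_linear:
  assumes Y: "assoc_algebra K Y" and X: "module K X"
    and f: "\<And>z. z \<in> carrier X \<Longrightarrow> (\<lambda>v w. f v w z) \<in> bilinear_maps K V W Y"
    and lin: "\<And>v w. v \<in> carrier V \<Longrightarrow> w \<in> carrier W \<Longrightarrow> f v w \<in> linear_maps K X Y"
    and x: "x \<in> carrier (tensor K V W)"
  shows "(\<lambda>z. tensor_lift K Y (\<lambda>v w. f v w z) x) \<in> linear_maps K X Y"
  using x
proof (induction rule: tensor_induct)
  case (pure v w)
  show ?case
    by (rule linear_maps_cong[OF X lin[OF pure]]) (simp add: tensor_lift_pure[OF Y f] pure)
next
  case (add x y)
  interpret Y: assoc_algebra K Y by fact
  interpret X: module K X by fact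
  note L = tensor_lift_linear[OF Y f]
  let ?l = "\<lambda>x z. tensor_lift K Y (\<lambda>v w. f v w z) x"
  have eq: "?l (x \<oplus>\<^bsub>tensor K V W\<^esub> y) z = ?l x z \<oplus>\<^bsub>Y\<^esub> ?l y z" if "z \<in> carrier X" for z
    using linear_maps_add[OF L[OF that]] add.hyps by blast
  note c = linear_maps_closed[OF L]
  have "?l x z \<in> carrier Y" "?l y z \<in> carrier Y" if "z \<in> carrier X" for z
    using c that add.hyps by blast+
  then show ?case
    by (intro linear_mapsI)
      (simp_all add: eq linear_maps_add[OF add.IH(1)] linear_maps_add[OF add.IH(2)]
        linear_maps_smult[OF add.IH(1)] linear_maps_smult[OF add.IH(2)] Y.smult_r_distr Y.a_ac)
qed

end

section \<open>Tensor products of linear maps\<close>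

lemma tensor_map_bilinear:
  assumes "assoc_algebra K V'" "assoc_algebra K W'"
    "f \<in> linear_maps K V V'" "g \<in> linear_maps K W W'"
  shows "(\<lambda>x y. pure_tensor K V' W' (f x) (g y)) \<in> bilinear_maps K V W (tensor K V' W')"
  by (rule bilinear_maps_precomp[OF pure_tensor_bilinear[OF assms(1,2)] assms(3,4)])

context
  fixes K :: "'k ring" and V :: "('k, 'v) module" and W :: "('k, 'w) module"
    and V' :: "('k, 'x) module" and W' :: "('k, 'y) module" and f :: "'v \<Rightarrow> 'x" and g :: "'w \<Rightarrow> 'y"
  assumes V: "assoc_algebra K V" and W: "assoc_algebra K W"
    and V': "assoc_algebra K V'" and W': "assoc_algebra K W'"
begin

lemma tensor_map_linear:
  assumes "f \<in> linear_maps K V V'" "g \<in> linear_maps K W W'"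
  shows "tensor_map K V' W' f g \<in> linear_maps K (tensor K V W) (tensor K V' W')"
  unfolding tensor_map_def
  by (rule tensor_lift_linear[OF V W tensor_assoc_algebra[OF V' W'] tensor_map_bilinear[OF V' W' assms]])

lemma tensor_map_pure:
  assumes "f \<in> linear_maps K V V'" "g \<in> linear_maps K W W'" "v \<in> carrier V" "w \<in> carrier W"
  shows "tensor_map K V' W' f g (pure_tensor K V W v w) = pure_tensor K V' W' (f v) (g w)"
  unfolding tensor_map_def
  by (rule tensor_lift_pure[OF V W tensor_assoc_algebra[OF V' W']
        tensor_map_bilinear[OF V' W' assms(1,2)] assms(3,4)])

lemma tensor_map_alg_hom:
  assumes "f \<in> alg_hom K V V'" "g \<in> alg_hom K W W'"
  shows "tensor_map K V' W' f g \<in> alg_hom K (tensor K V W) (tensor K V' W')"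
proof -
  note f = alg_homD[OF assms(1)] and g = alg_homD[OF assms(2)]
  show ?thesis
    unfolding tensor_map_def
    by (rule tensor_lift_alg_hom[OF V W tensor_assoc_algebra[OF V' W']
          tensor_map_bilinear[OF V' W' f(1) g(1)]])
      (simp_all add: f g tensor_one[OF V' W'] pure_tensor_mult[OF V' W']
        linear_maps_closed[OF f(1)] linear_maps_closed[OF g(1)])
qed

text \<open>The Sweedler rule that turns maps applied to the two legs into a substitution inside the
  bilinear map. It is evaluation on pure tensors, extended by linearity.\<close>

lemma tensor_lift_map:
  assumes f: "f \<in> linear_maps K V V'" and g: "g \<in> linear_maps K W W'"
    and Z: "assoc_algebra K Z" and h: "h \<in> bilinear_maps K V' W' Z"
    and x: "x \<in> carrier (tensor K V W)"
  shows "tensor_lift K Z h (tensor_map K V' W' f g x) = tensor_lift K Z (\<lambda>v w. h (f v) (g w)) x"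
proof -
  note b = bilinear_maps_precomp[OF h f g]
  show ?thesis
    by (rule tensor_linear_eq[OF V W
          linear_maps_comp[OF tensor_map_linear[OF f g] tensor_lift_linear[OF V' W' Z h]]
          tensor_lift_linear[OF V W Z b] _ x])
      (simp add: tensor_map_pure[OF f g] tensor_lift_pure[OF V' W' Z h] tensor_lift_pure[OF V W Z b]
        linear_maps_closed[OF f] linear_maps_closed[OF g])
qed

end

lemma linear_maps_id': "id \<in> linear_maps K V V"
  by (simp add: linear_maps_def)

lemma alg_hom_id: "id \<in> alg_hom K V V"
  by (intro alg_homI linear_maps_id') auto

section \<open>Associativity of tensor products\<close>

context
  fixes K :: "'k ring" and V :: "('k, 'v) module" and W :: "('k, 'w) module" and Z :: "('k, 'z) module"
  assumes V: "assoc_algebra K V" and W: "assoc_algebra K W" and Z: "assoc_algebra K Z"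
begin

private lemmas VW = tensor_assoc_algebra[OF V W]
private lemmas WZ = tensor_assoc_algebra[OF W Z]
private lemmas Y = tensor_assoc_algebra[OF VW Z]
private abbreviation (input) "b \<equiv> \<lambda>v w z. pure_tensor K (tensor K V W) Z (pure_tensor K V W v w) z"
private abbreviation (input) "Y \<equiv> tensor K (tensor K V W) Z"

lemma tensor_assoc_bilinear:
  assumes v: "v \<in> carrier V"
  shows "(\<lambda>w z. pure_tensor K (tensor K V W) Z (pure_tensor K V W v w) z) \<in>
    bilinear_maps K W Z (tensor K (tensor K V W) Z)"
  by (rule bilinear_maps_precomp[OF pure_tensor_bilinear[OF VW Z]
        bilinear_mapsD(1)[OF pure_tensor_bilinear[OF V W] v] linear_maps_id])

private lemma assoc_bilinear2: "(\<lambda>v. tensor_lift K Y (b v)) \<in> bilinear_maps K V (tensor K W Z) Y"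
proof (rule bilinear_mapsI)
  show "tensor_lift K Y (b v) \<in> linear_maps K (tensor K W Z) Y" if "v \<in> carrier V" for v
    by (rule tensor_lift_linear[OF W Z Y tensor_assoc_bilinear[OF that]])
  show "(\<lambda>v. tensor_lift K Y (b v) x) \<in> linear_maps K V Y" if "x \<in> carrier (tensor K W Z)" for x
  proof (rule tensor_lift_parameter_linear[OF W Z Y assoc_algebra.axioms(2)[OF V] _ _ that])
    show "(\<lambda>v'. b v' v w) \<in> linear_maps K V Y" if "v \<in> carrier W" "w \<in> carrier Z" for v w
      by (rule linear_maps_comp[OF bilinear_mapsD(2)[OF pure_tensor_bilinear[OF V W] that(1)]
            bilinear_mapsD(2)[OF pure_tensor_bilinear[OF VW Z] that(2)]])
  qed (rule tensor_assoc_bilinear)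
qed

text \<open>The second factor is not split into a pure tensor because it will be a value of a
  comultiplication or coaction, which need not be pure.\<close>

lemma tensor_assoc_pure:
  assumes "v \<in> carrier V" "x \<in> carrier (tensor K W Z)"
  shows "tensor_assoc K V W Z (pure_tensor K V (tensor K W Z) v x) =
    tensor_lift K (tensor K (tensor K V W) Z)
      (\<lambda>w z. pure_tensor K (tensor K V W) Z (pure_tensor K V W v w) z) x"
  unfolding tensor_assoc_def
  by (rule tensor_lift_pure[OF V WZ Y assoc_bilinear2 assms])

lemma tensor_assoc_alg_hom:
  "tensor_assoc K V W Z \<in>
    alg_hom K (tensor K V (tensor K W Z)) (tensor K (tensor K V W) Z)"
  unfolding tensor_assoc_def
proof (rule tensor_lift_alg_hom[OF V WZ Y assoc_bilinear2])
  interpret V: assoc_algebra K V by (rule V)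
  interpret W: assoc_algebra K W by (rule W)
  interpret Z: assoc_algebra K Z by (rule Z)
  interpret WZ: assoc_algebra K "tensor K W Z" by (rule WZ)
  interpret Y: assoc_algebra K Y by (rule Y)
  note pure = tensor_lift_pure[OF W Z Y tensor_assoc_bilinear]
  note lin = tensor_lift_linear[OF W Z Y tensor_assoc_bilinear]
  note closed = pure_tensor_closed[OF W Z] pure_tensor_closed[OF V W] pure_tensor_closed[OF VW Z]
  show "tensor_lift K Y (b \<one>\<^bsub>V\<^esub>) \<one>\<^bsub>tensor K W Z\<^esub> = \<one>\<^bsub>Y\<^esub>"
    by (simp add: tensor_one[OF W Z] tensor_one[OF V W] tensor_one[OF VW Z] pure)
  fix v v' x x'
  assume v: "v \<in> carrier V" "v' \<in> carrier V"
    and x: "x \<in> carrier (tensor K W Z)" and x': "x' \<in> carrier (tensor K W Z)"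
  have vv: "v \<otimes>\<^bsub>V\<^esub> v' \<in> carrier V" using v by simp
  \<comment> \<open>Multiplicativity is reduced to pure tensors in one factor at a time. On pure
    tensors all the products involved are componentwise.\<close>
  have m1: "tensor_lift K Y (b (v \<otimes>\<^bsub>V\<^esub> v')) (pure_tensor K W Z w z \<otimes>\<^bsub>tensor K W Z\<^esub> x') =
      tensor_lift K Y (b v) (pure_tensor K W Z w z) \<otimes>\<^bsub>Y\<^esub> tensor_lift K Y (b v') x'"
    if wz: "w \<in> carrier W" "z \<in> carrier Z" for w z
    using x'
  proof (induction rule: tensor_induct[OF W Z, consumes 1, case_names pure add])
    case (pure w' z')
    then show ?case using v vv wz
      by (simp add: pure_tensor_mult[OF W Z] pure_tensor_mult[OF V W] pure_tensor_mult[OF VW Z]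
          closed tensor_lift_pure[OF W Z Y tensor_assoc_bilinear])
  next
    case (add x y)
    then show ?case using v vv wz
      by (simp add: WZ.r_distr Y.r_distr linear_maps_add[OF lin] linear_maps_closed[OF lin] closed)
  qed
  show "tensor_lift K Y (b (v \<otimes>\<^bsub>V\<^esub> v')) (x \<otimes>\<^bsub>tensor K W Z\<^esub> x') =
      tensor_lift K Y (b v) x \<otimes>\<^bsub>Y\<^esub> tensor_lift K Y (b v') x'"
    using x
  proof (induction rule: tensor_induct[OF W Z, consumes 1, case_names pure add])
    case (pure w z)
    then show ?case by (rule m1)
  next
    case (add x y)
    then show ?case using v vv x'
      by (simp add: WZ.l_distr Y.l_distr linear_maps_add[OF lin] linear_maps_closed[OF lin] closed)
  qed
qed

lemmas tensor_assoc_linear = alg_homD(1)[OF tensor_assoc_alg_hom]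

end


section \<open>Tensor algebras\<close>

lemma word_monoid_monoid: "Group.monoid (word_monoid SV)"
  by (rule monoidI) (auto simp: word_monoid_def)

context
  fixes K :: "'k ring" and V :: "('k, 'v) module"
  assumes V: "assoc_algebra K V"
begin

interpretation V: assoc_algebra K V by (rule V)

private abbreviation (input) "WA \<equiv> word_algebra K V"
private abbreviation (input) "we \<equiv> basis_elem K"
private abbreviation (input) "TN \<equiv> tensor_algebra_null K V"
private abbreviation (input) "T \<equiv> tensor_algebra K V"
private abbreviation (input) "X \<equiv> tensor_algebra_gen K V"

private lemmas WM = word_monoid_monoid[of "carrier V"]
private lemmas KWM = V.K.field_axioms WM

private lemma WA: "assoc_algebra K WA"
  unfolding word_algebra_def by (rule monoid_algebra_algebra[OF KWM])

interpretation WA: assoc_algebra K WA by (rule WA)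

private lemma we_closed: "set w \<subseteq> carrier V \<Longrightarrow> we w \<in> carrier WA"
  unfolding word_algebra_def
  by (rule monoid_algebra_basis_closed[OF KWM]) (auto simp: word_monoid_def)

private lemma we_mult: "set v \<subseteq> carrier V \<Longrightarrow> set w \<subseteq> carrier V \<Longrightarrow> we v \<otimes>\<^bsub>WA\<^esub> we w = we (v @ w)"
  unfolding word_algebra_def
  by (subst monoid_algebra_mult_basis[OF KWM]) (auto simp: word_monoid_def in_lists_conv_set subset_iff)

private lemma we_one: "\<one>\<^bsub>WA\<^esub> = we []"
  unfolding word_algebra_def by (simp add: monoid_algebra_one[OF KWM]) (simp add: word_monoid_def)

private lemma word_null_ideal: "ideal TN WA"
  unfolding tensor_algebra_null_def Let_def
  by (rule WA.genideal_ideal) (auto intro!: WA.minus_closed WA.a_closed WA.smult_closed we_closed)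

private lemma word_null_rels:
  "v \<in> carrier V \<Longrightarrow> v' \<in> carrier V \<Longrightarrow> we [v \<oplus>\<^bsub>V\<^esub> v'] \<ominus>\<^bsub>WA\<^esub> (we [v] \<oplus>\<^bsub>WA\<^esub> we [v']) \<in> TN"
  "c \<in> carrier K \<Longrightarrow> v \<in> carrier V \<Longrightarrow> we [c \<odot>\<^bsub>V\<^esub> v] \<ominus>\<^bsub>WA\<^esub> c \<odot>\<^bsub>WA\<^esub> we [v] \<in> TN"
proof -
  let ?R = "{we [v \<oplus>\<^bsub>V\<^esub> v'] \<ominus>\<^bsub>WA\<^esub> (we [v] \<oplus>\<^bsub>WA\<^esub> we [v']) | v v'. v \<in> carrier V \<and> v' \<in> carrier V} \<union>
             {we [c \<odot>\<^bsub>V\<^esub> v] \<ominus>\<^bsub>WA\<^esub> c \<odot>\<^bsub>WA\<^esub> we [v] | c v. c \<in> carrier K \<and> v \<in> carrier V}"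
  have sub: "?R \<subseteq> TN" unfolding tensor_algebra_null_def Let_def
    by (rule WA.genideal_self) (auto intro!: WA.minus_closed WA.a_closed WA.smult_closed we_closed)
  show "v \<in> carrier V \<Longrightarrow> v' \<in> carrier V \<Longrightarrow> we [v \<oplus>\<^bsub>V\<^esub> v'] \<ominus>\<^bsub>WA\<^esub> (we [v] \<oplus>\<^bsub>WA\<^esub> we [v']) \<in> TN"
    by (rule subsetD[OF sub]) blast
  show "c \<in> carrier K \<Longrightarrow> v \<in> carrier V \<Longrightarrow> we [c \<odot>\<^bsub>V\<^esub> v] \<ominus>\<^bsub>WA\<^esub> c \<odot>\<^bsub>WA\<^esub> we [v] \<in> TN"
    by (rule subsetD[OF sub]) blast
qed

lemma tensor_algebra_algebra: "assoc_algebra K (T)"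
  unfolding tensor_algebra_def by (rule quot_algebra_algebra[OF WA word_null_ideal])

interpretation T: assoc_algebra K T by (rule tensor_algebra_algebra)

private lemmas wq = quot_eq_iff[OF WA word_null_ideal] quot_add[OF WA word_null_ideal]
  quot_smult[OF WA word_null_ideal] quot_carrier[OF WA word_null_ideal] quot_mult[OF WA word_null_ideal]

private lemma proj: "(\<lambda>p. TN +>\<^bsub>WA\<^esub> p) \<in> alg_hom K WA T"
  unfolding tensor_algebra_def by (rule quot_proj_alg_hom[OF WA word_null_ideal])

lemma tensor_algebra_gen_linear: "X \<in> linear_maps K V (T)"
  unfolding tensor_algebra_def tensor_algebra_gen_def
  by (intro linear_mapsI) (simp_all add: wq we_closed word_null_rels)

lemmas tensor_algebra_gen_closed = linear_maps_closed[OF tensor_algebra_gen_linear]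

text \<open>Words grow by one letter on the left, so products with a generator replace general
  products. Zero is covered as a multiple of the unit.\<close>

lemma tensor_algebra_induct [consumes 1, case_names one gen_mult smult add]:
  assumes x: "x \<in> carrier (T)"
    and one: "P \<one>\<^bsub>T\<^esub>"
    and gen_mult: "\<And>v x. v \<in> carrier V \<Longrightarrow> x \<in> carrier (T) \<Longrightarrow> P x \<Longrightarrow>
      P (X v \<otimes>\<^bsub>T\<^esub> x)"
    and smult: "\<And>c x. c \<in> carrier K \<Longrightarrow> x \<in> carrier (T) \<Longrightarrow> P x \<Longrightarrow>
      P (c \<odot>\<^bsub>T\<^esub> x)"
    and add: "\<And>x y. x \<in> carrier (T) \<Longrightarrow> y \<in> carrier (T) \<Longrightarrow>
      P x \<Longrightarrow> P y \<Longrightarrow> P (x \<oplus>\<^bsub>T\<^esub> y)"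
  shows "P x"
proof -
  note ph = alg_homD[OF proj]
  have word: "P (TN +>\<^bsub>WA\<^esub> we w)" if "set w \<subseteq> carrier V" for w
    using that
  proof (induction w)
    case Nil
    show ?case using one ph(2) by (simp add: we_one)
  next
    case (Cons v w)
    have "TN +>\<^bsub>WA\<^esub> we (v # w) = X v \<otimes>\<^bsub>T\<^esub> (TN +>\<^bsub>WA\<^esub> we w)"
      using Cons.prems ph(3)[of "we [v]" "we w"]
      by (simp add: tensor_algebra_gen_def we_closed we_mult)
    then show ?case
      using Cons linear_maps_closed[OF ph(1), of "we w"] by (simp add: gen_mult we_closed)
  qed
  have "P (TN +>\<^bsub>WA\<^esub> p)" if "p \<in> carrier WA" for p
    using that unfolding word_algebra_def
  proof (induction rule: monoid_algebra_induct[OF KWM, consumes 1, case_names zero basis smult add])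
    case zero
    show ?case unfolding word_algebra_def[symmetric]
      using linear_maps_zero[OF WA.module_axioms T.module_axioms ph(1)]
        assms(4)[of "\<zero>\<^bsub>K\<^esub>" "\<one>\<^bsub>T\<^esub>"] one by simp
  next
    case (basis w)
    then show ?case unfolding word_algebra_def[symmetric]
      by (intro word) (auto simp: word_monoid_def)
  next
    case (smult c p)
    then show ?case unfolding word_algebra_def[symmetric]
      using linear_maps_smult[OF ph(1)] linear_maps_closed[OF ph(1)] assms(4) by simp
  next
    case (add p r)
    then show ?case unfolding word_algebra_def[symmetric]
      using linear_maps_add[OF ph(1)] linear_maps_closed[OF ph(1)] assms(5) by simp
  qed
  then show ?thesis using x unfolding tensor_algebra_def by (auto simp: wq)
qed

lemma tensor_algebra_hom_eq:
  assumes f: "f \<in> alg_hom K (T) Z" and g: "g \<in> alg_hom K (T) Z"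
    and "\<And>v. v \<in> carrier V \<Longrightarrow> f (X v) = g (X v)"
    and "x \<in> carrier (T)"
  shows "f x = g x"
  using assms(4)
proof (induction rule: tensor_algebra_induct)
  note D = alg_homD[OF f] alg_homD[OF g]
  case one show ?case by (simp add: D)
next
  case (gen_mult v x)
  then show ?case using assms(3) by (simp add: alg_homD(3)[OF f] alg_homD(3)[OF g] tensor_algebra_gen_closed)
next
  case (smult c x)
  then show ?case by (simp add: linear_maps_smult[OF alg_homD(1)[OF f]] linear_maps_smult[OF alg_homD(1)[OF g]])
next
  case (add x y)
  then show ?case by (simp add: linear_maps_add[OF alg_homD(1)[OF f]] linear_maps_add[OF alg_homD(1)[OF g]])
qed

section \<open>Degrees zero and one of the tensor algebra\<close>

lemma tensor_power_0:
  "tensor_power K V 0 = (\<lambda>c. c \<odot>\<^bsub>T\<^esub> \<one>\<^bsub>T\<^esub>) ` carrier K"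
proof -
  note ph = alg_homD[OF proj]
  have eq: "c \<odot>\<^bsub>T\<^esub> \<one>\<^bsub>T\<^esub> = TN +>\<^bsub>WA\<^esub> (c \<odot>\<^bsub>WA\<^esub> we [])" if "c \<in> carrier K" for c
    using that linear_maps_smult[OF ph(1), of c "we []"] ph(2) by (simp add: we_closed we_one)
  have form: "p [] \<in> carrier K" "p = p [] \<odot>\<^bsub>WA\<^esub> we []"
    if "p \<in> carrier WA" "\<forall>w. p w \<noteq> \<zero>\<^bsub>K\<^esub> \<longrightarrow> length w = 0" for p
    using that monoid_algebra_carrierD(1)[OF KWM, folded word_algebra_def, OF that(1), of "[]"]
    by (auto simp: word_algebra_def monoid_algebra_def basis_elem_def fun_eq_iff)
  have deg: "\<forall>w. (c \<odot>\<^bsub>WA\<^esub> we []) w \<noteq> \<zero>\<^bsub>K\<^esub> \<longrightarrow> length w = 0" if "c \<in> carrier K" for c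
    using that by (auto simp: word_algebra_def monoid_algebra_def basis_elem_def)
  show ?thesis
  proof
    show "tensor_power K V 0 \<subseteq> (\<lambda>c. c \<odot>\<^bsub>T\<^esub> \<one>\<^bsub>T\<^esub>) ` carrier K"
    proof
      fix Y assume "Y \<in> tensor_power K V 0"
      then obtain p where p: "Y = TN +>\<^bsub>WA\<^esub> p" "p \<in> carrier WA"
        "\<forall>w. p w \<noteq> \<zero>\<^bsub>K\<^esub> \<longrightarrow> length w = 0"
        by (auto simp: tensor_power_def)
      note pf = form[OF p(2,3)]
      have "Y = p [] \<odot>\<^bsub>T\<^esub> \<one>\<^bsub>T\<^esub>"
        unfolding eq[OF pf(1)] p(1) by (rule arg_cong[OF pf(2)])
      then show "Y \<in> (\<lambda>c. c \<odot>\<^bsub>T\<^esub> \<one>\<^bsub>T\<^esub>) ` carrier K" using pf(1) by blast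
    qed
    show "(\<lambda>c. c \<odot>\<^bsub>T\<^esub> \<one>\<^bsub>T\<^esub>) ` carrier K \<subseteq> tensor_power K V 0"
    proof
      fix Y assume "Y \<in> (\<lambda>c. c \<odot>\<^bsub>T\<^esub> \<one>\<^bsub>T\<^esub>) ` carrier K"
      then obtain c where c: "Y = c \<odot>\<^bsub>T\<^esub> \<one>\<^bsub>T\<^esub>" "c \<in> carrier K" by blast
      have "c \<odot>\<^bsub>WA\<^esub> we [] \<in> carrier WA" using c(2) we_closed[of "[]"] by simp
      then show "Y \<in> tensor_power K V 0"
        unfolding tensor_power_def using c eq deg[OF c(2)] by blast
    qed
  qed
qed

text \<open>A condition on word lengths cannot be carried through an induction over the whole word
  algebra. The inclusion into the span of generators is therefore proved for the truncation
  \<open>?\<phi>\<close> of an arbitrary element to degree one, and elements supported on words of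
  length one equal their truncation.\<close>

lemma tensor_power_1: "tensor_power K V 1 = X ` carrier V"
proof
  note ph = alg_homD[OF proj]
  let ?\<phi> = "\<lambda>w. if length w = Suc 0 then we w else \<zero>\<^bsub>WA\<^esub>"
  have \<phi>: "?\<phi> \<in> carrier (word_monoid (carrier V)) \<rightarrow> carrier WA"
    by (auto simp: word_monoid_def intro!: we_closed)
  note L = lin_ext_linear[OF KWM WA.module_axioms \<phi>, folded word_algebra_def]
  have we: "we \<in> carrier (word_monoid (carrier V)) \<rightarrow> carrier WA"
    by (auto simp: word_monoid_def intro!: we_closed)
  note Le = lin_ext_linear[OF KWM WA.module_axioms we, folded word_algebra_def]
  have id: "lin_ext K WA we p = p" if "p \<in> carrier WA" for p
    by (rule monoid_algebra_linear_eq[OF KWM WA.module_axioms _ _ _ that[unfolded word_algebra_def]])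
      (use Le linear_maps_id[of K WA] lin_ext_basis[OF KWM WA.module_axioms we] in \<open>auto simp: word_algebra_def\<close>)
  have im: "TN +>\<^bsub>WA\<^esub> lin_ext K WA ?\<phi> p \<in> X ` carrier V" if "p \<in> carrier WA" for p
    using that unfolding word_algebra_def
  proof (induction rule: monoid_algebra_induct[OF KWM, consumes 1, case_names zero basis smult add])
    case zero
    have "TN +>\<^bsub>WA\<^esub> lin_ext K WA ?\<phi> \<zero>\<^bsub>WA\<^esub> = X \<zero>\<^bsub>V\<^esub>"
      using linear_maps_zero[OF WA.module_axioms WA.module_axioms L]
        linear_maps_zero[OF WA.module_axioms T.module_axioms ph(1)]
        linear_maps_zero[OF V.module_axioms T.module_axioms tensor_algebra_gen_linear] by simp
    then show ?case unfolding word_algebra_def[symmetric] by simp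
  next
    case (basis w)
    have "lin_ext K WA ?\<phi> (we w) = ?\<phi> w"
      by (rule lin_ext_basis[OF KWM WA.module_axioms \<phi> basis])
    moreover have "TN +>\<^bsub>WA\<^esub> ?\<phi> w \<in> X ` carrier V"
    proof (cases "length w = 1")
      case True
      then obtain v where "w = [v]" by (auto simp: length_Suc_conv)
      then show ?thesis using basis by (auto simp: tensor_algebra_gen_def word_monoid_def)
    next
      case False
      then show ?thesis using linear_maps_zero[OF WA.module_axioms T.module_axioms ph(1)]
        linear_maps_zero[OF V.module_axioms T.module_axioms tensor_algebra_gen_linear]
        by (intro image_eqI[of _ _ "\<zero>\<^bsub>V\<^esub>"]) auto
    qed
    ultimately show ?case unfolding word_algebra_def[symmetric] by simp
  next
    case (smult c p)
    then obtain v where "v \<in> carrier V" "TN +>\<^bsub>WA\<^esub> lin_ext K WA ?\<phi> p = X v"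
      unfolding word_algebra_def[symmetric] by auto
    then have "TN +>\<^bsub>WA\<^esub> lin_ext K WA ?\<phi> (c \<odot>\<^bsub>WA\<^esub> p) = X (c \<odot>\<^bsub>V\<^esub> v)"
      using smult(1,2) unfolding word_algebra_def[symmetric]
      by (simp add: linear_maps_smult[OF L] linear_maps_closed[OF L] linear_maps_smult[OF ph(1)]
          linear_maps_smult[OF tensor_algebra_gen_linear])
    then show ?case using \<open>v \<in> carrier V\<close> smult(1) unfolding word_algebra_def[symmetric] by simp
  next
    case (add p r)
    then obtain v u where "v \<in> carrier V" "TN +>\<^bsub>WA\<^esub> lin_ext K WA ?\<phi> p = X v"
      "u \<in> carrier V" "TN +>\<^bsub>WA\<^esub> lin_ext K WA ?\<phi> r = X u"
      unfolding word_algebra_def[symmetric] by auto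
    then have "TN +>\<^bsub>WA\<^esub> lin_ext K WA ?\<phi> (p \<oplus>\<^bsub>WA\<^esub> r) = X (v \<oplus>\<^bsub>V\<^esub> u)"
      using add(1,2) unfolding word_algebra_def[symmetric]
      by (simp add: linear_maps_add[OF L] linear_maps_closed[OF L] linear_maps_add[OF ph(1)]
          linear_maps_add[OF tensor_algebra_gen_linear])
    then show ?case using \<open>v \<in> carrier V\<close> \<open>u \<in> carrier V\<close> unfolding word_algebra_def[symmetric] by simp
  qed
  show "tensor_power K V 1 \<subseteq> X ` carrier V"
  proof
    fix Y assume "Y \<in> tensor_power K V 1"
    then obtain p where p: "Y = TN +>\<^bsub>WA\<^esub> p" "p \<in> carrier WA" "\<forall>w. p w \<noteq> \<zero>\<^bsub>K\<^esub> \<longrightarrow> length w = 1"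
      by (auto simp: tensor_power_def)
    note D = monoid_algebra_carrierD[OF KWM p(2)[unfolded word_algebra_def]]
    have ec: "we w \<in> carrier WA" if "p w \<noteq> \<zero>\<^bsub>K\<^esub>" for w
      using D(3)[OF that] we by auto
    have "lin_ext K WA ?\<phi> p = lin_ext K WA we p"
      unfolding lin_ext_def using D(1) p(3) ec by (intro WA.finsum_cong') auto
    then show "Y \<in> X ` carrier V" using im[OF p(2)] id[OF p(2)] p(1) by simp
  qed
  show "X ` carrier V \<subseteq> tensor_power K V 1"
    by (auto simp: tensor_power_def tensor_algebra_gen_def basis_elem_def intro!: exI[of _ "we [_]"]
        dest: we_closed[of "[_]", simplified] split: if_splits)
qed

section \<open>Universal property of the tensor algebra\<close>

context
  fixes Z :: "('k, 'z) module" and f :: "'v \<Rightarrow> 'z"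
  assumes Z: "assoc_algebra K Z" and f: "f \<in> linear_maps K V Z"
begin

interpretation Z: assoc_algebra K Z by (rule Z)

private abbreviation (input) "wg \<equiv> \<lambda>w. foldr (\<lambda>v y. f v \<otimes>\<^bsub>Z\<^esub> y) w \<one>\<^bsub>Z\<^esub>"

private lemma wg_closed: "set w \<subseteq> carrier V \<Longrightarrow> wg w \<in> carrier Z"
  by (induction w) (auto simp: linear_maps_closed[OF f])

private lemma g_append: "set v \<subseteq> carrier V \<Longrightarrow> set w \<subseteq> carrier V \<Longrightarrow> wg (v @ w) = wg v \<otimes>\<^bsub>Z\<^esub> wg w"
  by (induction v) (auto simp: wg_closed linear_maps_closed[OF f] Z.m_assoc)

private lemma wgM: "wg \<in> carrier (word_monoid (carrier V)) \<rightarrow> carrier Z"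
  by (auto simp: word_monoid_def intro!: wg_closed)

private lemma wl_hom: "lin_ext K Z wg \<in> alg_hom K WA Z"
  unfolding word_algebra_def
  by (rule lin_ext_alg_hom[OF KWM Z wgM])
    (auto simp: word_monoid_def intro!: g_append simp del: foldr_append)

private lemma wl_basis: "set w \<subseteq> carrier V \<Longrightarrow> lin_ext K Z wg (we w) = wg w"
  by (rule lin_ext_basis[OF KWM Z.module_axioms wgM]) (auto simp: word_monoid_def)

text \<open>The kernel of an algebra morphism is an ideal. It contains the linearity relations
  because \<open>f\<close> is linear, hence the whole ideal they generate.\<close>

private lemma wl_null: "x \<in> TN \<Longrightarrow> lin_ext K Z wg x = \<zero>\<^bsub>Z\<^esub>"
proof -
  let ?J = "{x \<in> carrier WA. lin_ext K Z wg x = \<zero>\<^bsub>Z\<^esub>}"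
  note L = alg_homD(1)[OF wl_hom]
  note minus = linear_maps_minus[OF WA.module_axioms Z.module_axioms L]
  have "TN \<subseteq> ?J" unfolding tensor_algebra_null_def Let_def
    by (rule WA.genideal_minimal[OF alg_hom_kernel_ideal[OF WA Z wl_hom]])
      (auto simp: minus we_closed linear_maps_add[OF L] linear_maps_smult[OF L] wl_basis
        linear_maps_add[OF f] linear_maps_smult[OF f] linear_maps_closed[OF f] Z.minus_eq_zero_iff)
  then show "x \<in> TN \<Longrightarrow> lin_ext K Z wg x = \<zero>\<^bsub>Z\<^esub>" by auto
qed

lemma tensor_algebra_lift_alg_hom: "tensor_algebra_lift K Z f \<in> alg_hom K (T) Z"
  unfolding tensor_algebra_def tensor_algebra_lift_def[abs_def]
  by (rule quot_lift_alg_hom[OF WA word_null_ideal Z.module_axioms wl_hom wl_null])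

lemma tensor_algebra_lift_gen:
  "v \<in> carrier V \<Longrightarrow> tensor_algebra_lift K Z f (X v) = f v"
  unfolding tensor_algebra_gen_def tensor_algebra_lift_def
  by (subst quot_lift_eq[OF WA word_null_ideal Z.module_axioms alg_homD(1)[OF wl_hom] wl_null])
    (auto simp: we_closed wl_basis linear_maps_closed[OF f])

end

section \<open>Symmetric algebras\<close>

private abbreviation (input) "SV \<equiv> sym_algebra K V"
private abbreviation (input) "IS \<equiv> sym_algebra_null K V"
private abbreviation (input) "ts \<equiv> sym_algebra_gen K V"

private lemma sym_ideal: "ideal IS T"
  unfolding sym_algebra_null_def Let_def
  by (rule T.genideal_ideal) (auto intro!: T.minus_closed T.m_closed tensor_algebra_gen_closed)

lemma sym_algebra_algebra: "assoc_algebra K (SV)"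
  unfolding sym_algebra_def by (rule quot_algebra_algebra[OF tensor_algebra_algebra sym_ideal])

interpretation SV: assoc_algebra K SV by (rule sym_algebra_algebra)

private lemma sym_proj: "(\<lambda>p. IS +>\<^bsub>T\<^esub> p) \<in> alg_hom K T SV"
  unfolding sym_algebra_def by (rule quot_proj_alg_hom[OF tensor_algebra_algebra sym_ideal])

private lemmas sp = alg_homD[OF sym_proj]

lemma sym_algebra_gen_linear: "ts \<in> linear_maps K V (SV)"
  unfolding sym_algebra_gen_def[abs_def]
  by (rule linear_maps_comp[OF tensor_algebra_gen_linear sp(1)])

lemmas sym_algebra_gen_closed = linear_maps_closed[OF sym_algebra_gen_linear]

lemma sym_algebra_gen_commute:
  assumes v: "v \<in> carrier V" and w: "w \<in> carrier V"
  shows "ts v \<otimes>\<^bsub>SV\<^esub> ts w =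
    ts w \<otimes>\<^bsub>SV\<^esub> ts v"
proof -
  let ?R = "{X v \<otimes>\<^bsub>T\<^esub> X w \<ominus>\<^bsub>T\<^esub> X w \<otimes>\<^bsub>T\<^esub> X v | v w. v \<in> carrier V \<and> w \<in> carrier V}"
  have "?R \<subseteq> IS" unfolding sym_algebra_null_def Let_def
    by (rule T.genideal_self) (auto intro!: T.minus_closed T.m_closed tensor_algebra_gen_closed)
  moreover have "X v \<otimes>\<^bsub>T\<^esub> X w \<ominus>\<^bsub>T\<^esub> X w \<otimes>\<^bsub>T\<^esub> X v \<in> ?R" using v w by blast
  ultimately have "X v \<otimes>\<^bsub>T\<^esub> X w \<ominus>\<^bsub>T\<^esub> X w \<otimes>\<^bsub>T\<^esub> X v \<in> IS" by blast
  then have "IS +>\<^bsub>T\<^esub> (X v \<otimes>\<^bsub>T\<^esub> X w) = IS +>\<^bsub>T\<^esub> (X w \<otimes>\<^bsub>T\<^esub> X v)"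
    using v w by (subst quot_eq_iff[OF tensor_algebra_algebra sym_ideal]) (auto intro!: tensor_algebra_gen_closed)
  then show ?thesis
    unfolding sym_algebra_gen_def using v w
    by (simp add: sp(3) tensor_algebra_gen_closed flip: sp(3))
qed

lemma sym_algebra_induct [consumes 1, case_names one gen_mult smult add]:
  assumes x: "x \<in> carrier (SV)"
    and one: "P \<one>\<^bsub>SV\<^esub>"
    and gen_mult: "\<And>v x. v \<in> carrier V \<Longrightarrow> x \<in> carrier (SV) \<Longrightarrow> P x \<Longrightarrow>
      P (ts v \<otimes>\<^bsub>SV\<^esub> x)"
    and smult: "\<And>c x. c \<in> carrier K \<Longrightarrow> x \<in> carrier (SV) \<Longrightarrow> P x \<Longrightarrow>
      P (c \<odot>\<^bsub>SV\<^esub> x)"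
    and add: "\<And>x y. x \<in> carrier (SV) \<Longrightarrow> y \<in> carrier (SV) \<Longrightarrow>
      P x \<Longrightarrow> P y \<Longrightarrow> P (x \<oplus>\<^bsub>SV\<^esub> y)"
  shows "P x"
proof -
  have "P (IS +>\<^bsub>T\<^esub> p)" if "p \<in> carrier T" for p
    using that
  proof (induction rule: tensor_algebra_induct)
    case one
    show ?case using sp(2) assms(2) by simp
  next
    case (gen_mult v x)
    then show ?case using assms(3)[of v "IS +>\<^bsub>T\<^esub> x"] linear_maps_closed[OF sp(1)]
      by (simp add: sp(3) tensor_algebra_gen_closed sym_algebra_gen_def)
  next
    case (smult c x)
    then show ?case using assms(4) linear_maps_closed[OF sp(1)] by (simp add: linear_maps_smult[OF sp(1)])
  next
    case (add x y)
    then show ?case using assms(5) linear_maps_closed[OF sp(1)] by (simp add: linear_maps_add[OF sp(1)])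
  qed
  then show ?thesis
    using x unfolding sym_algebra_def by (auto simp: quot_carrier[OF tensor_algebra_algebra sym_ideal])
qed

text \<open>The target may be noncommutative as long as the images of generators commute with one
  another. This matters because the target will be \<open>A\<close>, with the generators sent to
  central elements.\<close>

lemma sym_algebra_universal:
  assumes Z: "assoc_algebra K Z" and f: "f \<in> linear_maps K V Z"
    and comm: "\<And>v w. v \<in> carrier V \<Longrightarrow> w \<in> carrier V \<Longrightarrow> f v \<otimes>\<^bsub>Z\<^esub> f w = f w \<otimes>\<^bsub>Z\<^esub> f v"
  shows "\<exists>\<phi> \<in> alg_hom K (SV) Z. \<forall>v\<in>carrier V. \<phi> (ts v) = f v"
proof -
  interpret Z: assoc_algebra K Z by fact
  let ?l = "tensor_algebra_lift K Z f"
  note L = tensor_algebra_lift_alg_hom[OF Z f] and Lg = tensor_algebra_lift_gen[OF Z f]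
  note minus = linear_maps_minus[OF T.module_axioms Z.module_axioms alg_homD(1)[OF L]]
  have "IS \<subseteq> {x \<in> carrier T. ?l x = \<zero>\<^bsub>Z\<^esub>}"
    unfolding sym_algebra_null_def Let_def
    by (rule T.genideal_minimal[OF alg_hom_kernel_ideal[OF tensor_algebra_algebra Z L]])
      (auto simp: minus alg_homD(3)[OF L] Lg comm tensor_algebra_gen_closed linear_maps_closed[OF f]
        Z.minus_eq_zero_iff)
  then have ker: "\<And>x. x \<in> IS \<Longrightarrow> ?l x = \<zero>\<^bsub>Z\<^esub>" by auto
  show ?thesis
  proof (intro bexI[of _ "\<lambda>Y. the_elem (?l ` Y)"] ballI)
    show "(\<lambda>Y. the_elem (?l ` Y)) \<in> alg_hom K SV Z"
      unfolding sym_algebra_def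
      by (rule quot_lift_alg_hom[OF tensor_algebra_algebra sym_ideal Z.module_axioms L ker])
    show "the_elem (?l ` ts v) = f v" if "v \<in> carrier V" for v
      unfolding sym_algebra_gen_def using that
      by (subst quot_lift_eq[OF tensor_algebra_algebra sym_ideal Z.module_axioms alg_homD(1)[OF L] ker])
        (auto simp: tensor_algebra_gen_closed Lg)
  qed
qed

end

section \<open>Polynomials with coefficients in a vector space\<close>

text \<open>Coefficients are listed from the constant term upwards, and \<open>L\<close> plays
  multiplication by the variable. It stays abstract so as to serve both for scaling by a point of
  the field and for multiplication by a generator in the tensor product of a symmetric algebra with
  \<open>A\<close>.\<close>

primrec horner :: "('k, 'z) module \<Rightarrow> ('z \<Rightarrow> 'z) \<Rightarrow> 'z list \<Rightarrow> 'z" where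
  "horner Z L [] = \<zero>\<^bsub>Z\<^esub>"
| "horner Z L (x # xs) = x \<oplus>\<^bsub>Z\<^esub> L (horner Z L xs)"

text \<open>For \<open>L\<close> scaling by \<open>d\<close>, the result on \<open>xs\<close> lists
  the coefficients of the quotient of \<open>a # xs\<close> by the linear factor with root
  \<open>d\<close>, whatever the constant term \<open>a\<close>. Its entries are the values at
  \<open>d\<close> of the nonempty suffixes of \<open>xs\<close>.\<close>

primrec synthetic_division :: "('k, 'z) module \<Rightarrow> ('z \<Rightarrow> 'z) \<Rightarrow> 'z list \<Rightarrow> 'z list" where
  "synthetic_division Z L [] = []"
| "synthetic_division Z L (x # xs) = horner Z L (x # xs) # synthetic_division Z L xs"

lemma length_synthetic_division: "length (synthetic_division Z L xs) = length xs"
  by (induction xs) auto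

context
  fixes K :: "'k ring" and Z :: "('k, 'z) module" (structure)
  assumes K: "field K" and Z: "module K Z"
begin

interpretation K: field K by (rule K)
interpretation Z: module K Z by (rule Z)

private abbreviation (input) "ev c \<equiv> horner Z (\<lambda>y. c \<odot> y)"

lemma horner_closed:
  assumes "\<And>y. y \<in> carrier Z \<Longrightarrow> L y \<in> carrier Z" "set xs \<subseteq> carrier Z"
  shows "horner Z L xs \<in> carrier Z"
  using assms(2) by (induction xs) (auto intro: assms(1))

private lemma ev_closed: "c \<in> carrier K \<Longrightarrow> set xs \<subseteq> carrier Z \<Longrightarrow> ev c xs \<in> carrier Z"
  by (rule horner_closed) auto

private lemma quotient_closed:
  "d \<in> carrier K \<Longrightarrow> set xs \<subseteq> carrier Z \<Longrightarrow> set (synthetic_division Z (\<lambda>y. d \<odot> y) xs) \<subseteq> carrier Z"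
  by (induction xs) (auto simp: ev_closed)

text \<open>Division by a linear factor, with the value at \<open>d\<close> as remainder, read at
  the point \<open>c\<close>. It is stated for values because the coefficients are vectors.\<close>

private lemma division:
  assumes "c \<in> carrier K" "d \<in> carrier K" "a \<in> carrier Z" "set xs \<subseteq> carrier Z"
  shows "ev c (a # xs) = ev d (a # xs) \<oplus>
     (c \<ominus>\<^bsub>K\<^esub> d) \<odot> ev c (synthetic_division Z (\<lambda>y. d \<odot> y) xs)"
  using assms(3,4)
proof (induction xs arbitrary: a)
  case Nil
  then show ?case using assms(1,2) by simp
next
  case (Cons b bs)
  let ?u = "ev d (b # bs)" and ?w = "ev c (synthetic_division Z (\<lambda>y. d \<odot> y) bs)"
  have uw: "?u \<in> carrier Z" "?w \<in> carrier Z"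
    using Cons.prems assms ev_closed quotient_closed by (auto simp: ev_closed quotient_closed)
  have comm: "c \<odot> ((c \<ominus>\<^bsub>K\<^esub> d) \<odot> ?w) = (c \<ominus>\<^bsub>K\<^esub> d) \<odot> (c \<odot> ?w)"
    using uw assms by (simp add: K.m_comm flip: Z.smult_assoc1)
  have split: "(c \<ominus>\<^bsub>K\<^esub> d) \<odot> ?u = c \<odot> ?u \<oplus> \<ominus> (d \<odot> ?u)"
    using uw assms by (simp only: a_minus_def Z.smult_l_distr Z.smult_l_minus K.a_inv_closed)
  have IH: "ev c (b # bs) = ?u \<oplus> (c \<ominus>\<^bsub>K\<^esub> d) \<odot> ?w"
    using Cons by simp
  \<comment> \<open>Here \<open>cu\<close> and \<open>du\<close> stand for \<open>c\<close> and
    \<open>d\<close> times the value \<open>?u\<close>. Inserting \<open>du\<close> and its negative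
    exposes the value at \<open>d\<close> and the factor \<open>c - d\<close>.\<close>
  have rearrange: "a \<oplus> (cu \<oplus> v) = (a \<oplus> du) \<oplus> ((cu \<oplus> \<ominus> du) \<oplus> v)"
    if "cu \<in> carrier Z" "du \<in> carrier Z" "v \<in> carrier Z" for cu du v
  proof -
    have "(a \<oplus> du) \<oplus> ((cu \<oplus> \<ominus> du) \<oplus> v) = (a \<oplus> (cu \<oplus> v)) \<oplus> (du \<oplus> \<ominus> du)"
      using that Cons.prems by (simp add: Z.a_ac)
    then show ?thesis using that Cons.prems by (simp add: Z.M.r_neg)
  qed
  have "ev c (a # b # bs) = a \<oplus> (c \<odot> ?u \<oplus> (c \<ominus>\<^bsub>K\<^esub> d) \<odot> (c \<odot> ?w))"
    using uw assms by (subst horner.simps(2), subst IH) (simp add: Z.smult_r_distr comm)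
  also have "\<dots> = (a \<oplus> d \<odot> ?u) \<oplus>
      ((c \<odot> ?u \<oplus> \<ominus> (d \<odot> ?u)) \<oplus> (c \<ominus>\<^bsub>K\<^esub> d) \<odot> (c \<odot> ?w))"
    using uw assms by (intro rearrange) auto
  also have "\<dots> = ev d (a # b # bs) \<oplus> (c \<ominus>\<^bsub>K\<^esub> d) \<odot> (?u \<oplus> c \<odot> ?w)"
    unfolding split[symmetric] using uw assms
    by (simp only: Z.smult_r_distr horner.simps K.minus_closed Z.smult_closed)
  finally show ?case by simp
qed

text \<open>The entries of the quotient are values of suffixes at \<open>d\<close>. Once all later
  coefficients vanish, the value of a suffix is its first entry, so the coefficients vanish from the
  last one backwards.\<close>

private lemma quotient_zero:
  assumes "d \<in> carrier K" "set xs \<subseteq> carrier Z"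
    "set (synthetic_division Z (\<lambda>y. d \<odot> y) xs) \<subseteq> {\<zero>}"
  shows "set xs \<subseteq> {\<zero>}"
  using assms(2,3)
proof (induction xs)
  case (Cons b bs)
  then have "set bs \<subseteq> {\<zero>}" by simp
  then have "ev d bs = \<zero>" using assms(1) by (induction bs) auto
  then show ?case using Cons assms(1) by auto
qed simp

text \<open>A root \<open>d\<close> is divided out. Away from \<open>d\<close> the quotient still
  vanishes, since \<open>c - d\<close> can be cancelled over a field, and deleting one point leaves
  \<open>C\<close> infinite. The set \<open>C\<close> is a parameter so that the induction on the
  number of coefficients may shrink it.\<close>

lemma polynomial_zero:
  assumes "infinite C" "C \<subseteq> carrier K" "set xs \<subseteq> carrier Z"
    "\<And>c. c \<in> C \<Longrightarrow> horner Z (\<lambda>y. c \<odot> y) xs = \<zero>"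
  shows "set xs \<subseteq> {\<zero>}"
  using assms
proof (induction "length xs" arbitrary: xs C)
  case (Suc n)
  then obtain a as where xs: "xs = a # as" by (cases xs) auto
  obtain d where d: "d \<in> C" using Suc.prems(1) by fastforce
  then have dK: "d \<in> carrier K" using Suc.prems(2) by auto
  let ?q = "synthetic_division Z (\<lambda>y. d \<odot> y) as"
  have carr: "a \<in> carrier Z" "set as \<subseteq> carrier Z" using Suc.prems(3) xs by auto
  have q: "set ?q \<subseteq> carrier Z" by (rule quotient_closed[OF dK carr(2)])
  have "ev c ?q = \<zero>" if "c \<in> C - {d}" for c
  proof (rule ccontr)
    assume nz: "ev c ?q \<noteq> \<zero>"
    have cK: "c \<in> carrier K" using that Suc.prems(2) by auto
    have evc: "ev c ?q \<in> carrier Z" by (rule ev_closed[OF cK q])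
    have "(c \<ominus>\<^bsub>K\<^esub> d) \<odot> ev c ?q = \<zero>"
      using division[OF cK dK carr] Suc.prems(4)[of c] Suc.prems(4)[OF d] that xs evc cK dK by simp
    also have "\<dots> = \<zero>\<^bsub>K\<^esub> \<odot> ev c ?q" using evc by simp
    finally have "c \<ominus>\<^bsub>K\<^esub> d = \<zero>\<^bsub>K\<^esub>"
      using cK dK evc nz by (intro smult_right_cancel[OF K Z, of _ _ "ev c ?q"]) auto
    then show False using that cK dK by (simp add: K.minus_eq_zero_iff)
  qed
  then have "set ?q \<subseteq> {\<zero>}"
    using Suc.hyps(2) Suc.prems(1,2) q xs
    by (intro Suc.hyps(1)[of ?q "C - {d}"]) (auto simp: length_synthetic_division)
  then have as0: "set as \<subseteq> {\<zero>}" by (rule quotient_zero[OF dK carr(2)])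
  then have "ev d as = \<zero>" using dK by (induction as) auto
  then show ?case using Suc.prems(4)[OF d] xs as0 carr(1) dK by auto
qed simp

end

text \<open>Used with \<open>f\<close> multiplication by another generator, which then acts on the
  coefficients, and with \<open>f\<close> a specialisation, which turns the generator into a
  scalar.\<close>

lemma horner_map:
  assumes "module K Y" "module K Z" "f \<in> linear_maps K Y Z" "set xs \<subseteq> carrier Y"
    and "\<And>y. y \<in> carrier Y \<Longrightarrow> L y \<in> carrier Y"
    and "\<And>y. y \<in> carrier Y \<Longrightarrow> f (L y) = L' (f y)"
  shows "f (horner Y L xs) = horner Z L' (map f xs)"
  using assms(4)
proof (induction xs)
  case Nil
  show ?case using linear_maps_zero[OF assms(1-3)] by simp
next
  case (Cons x xs)
  interpret Y: module K Y by fact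
  have "horner Y L xs \<in> carrier Y"
    using Cons.prems assms(5) by (induction xs) auto
  then show ?case using Cons assms(5,6) by (simp add: linear_maps_add[OF assms(3)])
qed

section \<open>Specialisations of the symmetric algebra\<close>

context
  fixes K :: "'k ring" and V :: "('k, 'v) module" and A :: "('k, 'a) module" (structure)
  assumes V: "assoc_algebra K V" and A: "assoc_algebra K A"
begin

interpretation V: assoc_algebra K V by (rule V)
interpretation A: assoc_algebra K A by (rule A)

private abbreviation (input) "S \<equiv> sym_algebra K V"
private abbreviation (input) "t \<equiv> sym_algebra_gen K V"
private abbreviation (input) "SA \<equiv> tensor K (sym_algebra K V) A"
private abbreviation (input) "pure \<equiv> pure_tensor K (sym_algebra K V) A"

private lemmas algebra_S = sym_algebra_algebra[OF V]
private lemmas algebra_SA = tensor_assoc_algebra[OF algebra_S A]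
private lemmas t_closed = sym_algebra_gen_closed[OF V]
private lemmas pure_closed = pure_tensor_closed[OF algebra_S A]
private lemmas pure_bilinear = pure_tensor_bilinear[OF algebra_S A]
private lemmas pure_left = bilinear_mapsD(2)[OF pure_bilinear]
private lemmas pure_right = bilinear_mapsD(1)[OF pure_bilinear]

interpretation S: assoc_algebra K S by (rule algebra_S)
interpretation SA: assoc_algebra K SA by (rule algebra_SA)

text \<open>The symmetric algebra is sent into the centre of \<open>A\<close> by some
  \<open>\<phi>\<close>, and \<open>s \<otimes> a\<close> goes to \<open>\<phi> s\<close> times
  \<open>a\<close>. Multiplicativity amounts to exchanging \<open>\<phi> s'\<close> with
  \<open>a\<close>, which centrality permits.\<close>

lemma central_specialisation:
  assumes f: "f \<in> linear_maps K V A"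
    and central: "\<And>v a. v \<in> carrier V \<Longrightarrow> a \<in> carrier A \<Longrightarrow> f v \<otimes> a = a \<otimes> f v"
  shows "\<exists>\<Phi> \<in> alg_hom K (SA) A.
    (\<forall>v\<in>carrier V. \<forall>a\<in>carrier A.
       \<Phi> (pure (t v) a) = f v \<otimes> a) \<and>
    (\<forall>a\<in>carrier A. \<Phi> (pure \<one>\<^bsub>S\<^esub> a) = a)"
proof -
  note fc = linear_maps_closed[OF f]
  obtain \<phi> where \<phi>: "\<phi> \<in> alg_hom K S A" and \<phi>t: "\<And>v. v \<in> carrier V \<Longrightarrow> \<phi> (t v) = f v"
    using sym_algebra_universal[OF V A f] central fc by meson
  note p = alg_homD[OF \<phi>]
  note pc = linear_maps_closed[OF p(1)]
  have \<phi>central: "\<phi> s \<otimes> a = a \<otimes> \<phi> s" if "s \<in> carrier S" "a \<in> carrier A" for s a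
    using that(1)
  proof (induction rule: sym_algebra_induct[OF V, consumes 1, case_names one gen_mult smult add])
    case one
    show ?case using that(2) by (simp add: p(2))
  next
    case (gen_mult v x)
    have "\<phi> (t v \<otimes>\<^bsub>S\<^esub> x) \<otimes> a = f v \<otimes> (a \<otimes> \<phi> x)"
      using gen_mult that(2) by (simp add: p(3) t_closed \<phi>t fc pc A.m_assoc)
    also have "\<dots> = (f v \<otimes> a) \<otimes> \<phi> x"
      using gen_mult that(2) by (simp add: fc pc A.m_assoc)
    also have "\<dots> = a \<otimes> \<phi> (t v \<otimes>\<^bsub>S\<^esub> x)"
      using gen_mult that(2) central by (simp add: p(3) t_closed \<phi>t fc pc A.m_assoc)
    finally show ?case .
  next
    case (smult c x)
    then show ?case using that(2)
      by (simp add: linear_maps_smult[OF p(1)] pc A.smult_mult_left A.smult_mult_right)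
  next
    case (add x y)
    then show ?case using that(2)
      by (simp add: linear_maps_add[OF p(1)] pc A.l_distr A.r_distr)
  qed
  have bil: "(\<lambda>s a. \<phi> s \<otimes> a) \<in> bilinear_maps K S A A"
    by (rule bilinear_maps_precomp[OF mult_bilinear[OF A] p(1) linear_maps_id])
  show ?thesis
  proof (intro bexI[of _ "tensor_lift K A (\<lambda>s a. \<phi> s \<otimes> a)"] conjI ballI)
    show "tensor_lift K A (\<lambda>s a. \<phi> s \<otimes> a) \<in> alg_hom K SA A"
    proof (rule tensor_lift_alg_hom[OF algebra_S A A bil])
      show "\<phi> \<one>\<^bsub>S\<^esub> \<otimes> \<one> = \<one>" by (simp add: p(2))
    next
      fix s a s' a' assume h: "s \<in> carrier S" "a \<in> carrier A" "s' \<in> carrier S" "a' \<in> carrier A"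
      have "(\<phi> s \<otimes> \<phi> s') \<otimes> (a \<otimes> a') = \<phi> s \<otimes> ((\<phi> s' \<otimes> a) \<otimes> a')"
        using h by (simp add: pc A.m_assoc)
      also have "\<dots> = \<phi> s \<otimes> ((a \<otimes> \<phi> s') \<otimes> a')"
        using h by (simp add: \<phi>central)
      also have "\<dots> = (\<phi> s \<otimes> a) \<otimes> (\<phi> s' \<otimes> a')"
        using h by (simp add: pc A.m_assoc)
      finally show "\<phi> (s \<otimes>\<^bsub>S\<^esub> s') \<otimes> (a \<otimes> a') = (\<phi> s \<otimes> a) \<otimes> (\<phi> s' \<otimes> a')"
        using h by (simp add: p(3))
    qed
  qed (simp_all add: tensor_lift_pure[OF algebra_S A A bil] t_closed \<phi>t p(2))
qed

text \<open>Since \<open>central_specialisation\<close> only asserts existence, one map is fixed for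
  each functional. The separation statement can then quantify over functionals alone, and only the
  three listed properties are used.\<close>

definition scalar_specialisation :: "('v \<Rightarrow> 'k) \<Rightarrow> (('v list \<Rightarrow> 'k) set set \<times> 'a \<Rightarrow> 'k) set \<Rightarrow> 'a" where
  "scalar_specialisation f = (SOME \<Phi>. \<Phi> \<in> alg_hom K (SA) A \<and>
    (\<forall>v\<in>carrier V. \<forall>a\<in>carrier A.
       \<Phi> (pure (t v) a) = f v \<odot> a) \<and>
    (\<forall>a\<in>carrier A. \<Phi> (pure \<one>\<^bsub>S\<^esub> a) = a))"

private abbreviation (input) "E \<equiv> scalar_specialisation"
private abbreviation (input) "KV \<equiv> linear_maps K V (base_algebra K)"

lemma scalar_specialisation:
  assumes f: "f \<in> linear_maps K V (base_algebra K)"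
  shows "scalar_specialisation f \<in> alg_hom K (SA) A"
    and "v \<in> carrier V \<Longrightarrow> a \<in> carrier A \<Longrightarrow>
      scalar_specialisation f (pure (t v) a) = f v \<odot> a"
    and "a \<in> carrier A \<Longrightarrow>
      scalar_specialisation f (pure \<one>\<^bsub>S\<^esub> a) = a"
proof -
  have fc: "f v \<in> carrier K" if "v \<in> carrier V" for v
    using linear_maps_closed[OF f that] by (simp add: base_algebra_def)
  have lin: "(\<lambda>v. f v \<odot> \<one>) \<in> linear_maps K V A"
    by (rule linear_maps_comp[OF f bilinear_mapsD(2)[OF smult_bilinear[OF A]]]) simp
  have "(f v \<odot> \<one>) \<otimes> a = f v \<odot> a" "a \<otimes> (f v \<odot> \<one>) = f v \<odot> a"
    if "v \<in> carrier V" "a \<in> carrier A" for v a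
    using fc that by (simp_all add: A.smult_mult_left A.smult_mult_right)
  then have "\<exists>\<Phi>. \<Phi> \<in> alg_hom K SA A \<and>
    (\<forall>v\<in>carrier V. \<forall>a\<in>carrier A. \<Phi> (pure (t v) a) = f v \<odot> a) \<and>
    (\<forall>a\<in>carrier A. \<Phi> (pure \<one>\<^bsub>S\<^esub> a) = a)"
    using central_specialisation[OF lin] by (simp add: Bex_def)
  from someI_ex[OF this, folded scalar_specialisation_def]
  show "E f \<in> alg_hom K SA A"
    and "v \<in> carrier V \<Longrightarrow> a \<in> carrier A \<Longrightarrow> E f (pure (t v) a) = f v \<odot> a"
    and "a \<in> carrier A \<Longrightarrow> E f (pure \<one>\<^bsub>S\<^esub> a) = a"
    by blast+
qed

text \<open>These are the polynomials in the generators \<open>t w\<close>, for \<open>w\<close> in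
  \<open>W\<close>, with coefficients in \<open>A\<close>. Finite sets \<open>W\<close> allow an
  induction on the number of generators, and no linear independence is asked of them.\<close>

inductive_set sym_subspace :: "'v set \<Rightarrow> (('v list \<Rightarrow> 'k) set set \<times> 'a \<Rightarrow> 'k) set set"
  for W :: "'v set" where
  const: "a \<in> carrier A \<Longrightarrow>
    pure \<one>\<^bsub>S\<^esub> a \<in> sym_subspace W"
| gen_mult: "w \<in> W \<Longrightarrow> x \<in> sym_subspace W \<Longrightarrow>
    pure (t w) \<one> \<otimes>\<^bsub>SA\<^esub> x
      \<in> sym_subspace W"
| add: "x \<in> sym_subspace W \<Longrightarrow> y \<in> sym_subspace W \<Longrightarrow>
    x \<oplus>\<^bsub>SA\<^esub> y \<in> sym_subspace W"

private abbreviation (input) "G \<equiv> sym_subspace"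
private abbreviation (input) "\<tau> v \<equiv> pure (t v) \<one>"

private lemma tau_closed: "v \<in> carrier V \<Longrightarrow> \<tau> v \<in> carrier SA"
  by (simp add: pure_closed t_closed)

private lemma tau_linear: "(\<lambda>v. \<tau> v) \<in> linear_maps K V SA"
  by (rule linear_maps_comp[OF sym_algebra_gen_linear[OF V] pure_left]) simp

private lemma tau_commute:
  "v \<in> carrier V \<Longrightarrow> w \<in> carrier V \<Longrightarrow> x \<in> carrier SA \<Longrightarrow>
    \<tau> v \<otimes>\<^bsub>SA\<^esub> (\<tau> w \<otimes>\<^bsub>SA\<^esub> x) = \<tau> w \<otimes>\<^bsub>SA\<^esub> (\<tau> v \<otimes>\<^bsub>SA\<^esub> x)"
  by (simp add: tau_closed pure_tensor_mult[OF algebra_S A] t_closed sym_algebra_gen_commute[OF V]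
      flip: SA.m_assoc)

private lemma G_closed: "W \<subseteq> carrier V \<Longrightarrow> x \<in> G W \<Longrightarrow> x \<in> carrier SA"
proof -
  assume W: "W \<subseteq> carrier V" and "x \<in> G W"
  from this(2) show "x \<in> carrier SA"
    by (induction rule: sym_subspace.induct) (use W in \<open>auto simp: pure_closed tau_closed\<close>)
qed

private lemma G_mono: "x \<in> G W \<Longrightarrow> W \<subseteq> W' \<Longrightarrow> x \<in> G W'"
  by (induction rule: sym_subspace.induct) (auto intro: sym_subspace.intros)

private lemma G_smult: "x \<in> G W \<Longrightarrow> W \<subseteq> carrier V \<Longrightarrow> c \<in> carrier K \<Longrightarrow> c \<odot>\<^bsub>SA\<^esub> x \<in> G W"
proof (induction rule: sym_subspace.induct)
  case (const a)
  then show ?case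
    using sym_subspace.const[of "c \<odot> a"] by (simp add: linear_maps_smult[OF pure_right])
next
  case (gen_mult w x)
  then show ?case
    using sym_subspace.gen_mult[of w W "c \<odot>\<^bsub>SA\<^esub> x"] G_closed[of W x] tau_closed[of w]
    by (auto simp: SA.smult_mult_right)
next
  case (add x y)
  then show ?case
    using sym_subspace.add[of "c \<odot>\<^bsub>SA\<^esub> x" W "c \<odot>\<^bsub>SA\<^esub> y"] G_closed[of W] by (simp add: SA.smult_r_distr)
qed

private lemma G_submodule: "W \<subseteq> carrier V \<Longrightarrow> submodule (G W) K SA"
proof (rule SA.submoduleI)
  assume W: "W \<subseteq> carrier V"
  show "G W \<subseteq> carrier SA" using G_closed[OF W] by auto
  have "pure \<one>\<^bsub>S\<^esub> \<zero> = \<zero>\<^bsub>SA\<^esub>"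
    by (rule linear_maps_zero[OF A.module_axioms SA.module_axioms pure_right]) simp
  then show "\<zero>\<^bsub>SA\<^esub> \<in> G W" using sym_subspace.const[of "\<zero>" W] by simp
  show "\<ominus>\<^bsub>SA\<^esub> a \<in> G W" if "a \<in> G W" for a
    using G_smult[OF that W, of "\<ominus>\<^bsub>K\<^esub> \<one>\<^bsub>K\<^esub>"] G_closed[OF W that] by (simp add: SA.smult_l_minus)
qed (auto intro: sym_subspace.add G_smult)

text \<open>This subspace takes the place of a span in a test of linear independence: a generator
  inside it adds nothing to \<open>G W\<close>, and one outside it can be separated from
  \<open>W\<close> by a functional. It is an intersection of preimages of \<open>G W\<close> under
  the linear maps sending \<open>v\<close> to \<open>\<tau> v\<close> times
  \<open>x\<close>.\<close>

private lemma G_normalizer_submodule: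
  assumes W: "W \<subseteq> carrier V"
  shows "submodule {v \<in> carrier V. \<forall>x\<in>G W. \<tau> v \<otimes>\<^bsub>SA\<^esub> x \<in> G W} K V"
proof -
  note Gx = G_closed[OF W]
  let ?C = "insert (carrier V) ((\<lambda>x. {v \<in> carrier V. \<tau> v \<otimes>\<^bsub>SA\<^esub> x \<in> G W}) ` G W)"
  have "submodule (\<Inter>?C) K V"
  proof (rule submodule_Inter[OF V.module_axioms])
    fix N assume "N \<in> ?C"
    then show "submodule N K V"
    proof
      assume "N = carrier V" then show ?thesis using V.carrier_is_submodule by simp
    next
      assume "N \<in> (\<lambda>x. {v \<in> carrier V. \<tau> v \<otimes>\<^bsub>SA\<^esub> x \<in> G W}) ` G W"
      then obtain x where x: "x \<in> G W" "N = {v \<in> carrier V. \<tau> v \<otimes>\<^bsub>SA\<^esub> x \<in> G W}" by auto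
      have "(\<lambda>v. \<tau> v \<otimes>\<^bsub>SA\<^esub> x) \<in> linear_maps K V SA"
        by (rule linear_maps_comp[OF tau_linear bilinear_mapsD(2)[OF mult_bilinear[OF algebra_SA] Gx[OF x(1)]]])
      then show ?thesis unfolding x(2)
        by (rule submodule_vimage[OF V.module_axioms SA.module_axioms _ G_submodule[OF W]])
    qed
  qed simp
  moreover have "\<Inter>?C = {v \<in> carrier V. \<forall>x\<in>G W. \<tau> v \<otimes>\<^bsub>SA\<^esub> x \<in> G W}" by auto
  ultimately show ?thesis by simp
qed

text \<open>The lists are added coefficientwise and the longer one is continued unchanged. Only
  existence is claimed, since dependent generators may allow several expansions.\<close>

private lemma G_horner_add:
  assumes W: "W \<subseteq> carrier V" and w: "w \<in> carrier V"
    and "set xs \<subseteq> G W" "set ys \<subseteq> G W"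
  shows "\<exists>zs. set zs \<subseteq> G W \<and> horner SA (\<lambda>y. \<tau> w \<otimes>\<^bsub>SA\<^esub> y) zs =
    horner SA (\<lambda>y. \<tau> w \<otimes>\<^bsub>SA\<^esub> y) xs \<oplus>\<^bsub>SA\<^esub> horner SA (\<lambda>y. \<tau> w \<otimes>\<^bsub>SA\<^esub> y) ys"
  using assms(3,4)
proof (induction xs arbitrary: ys)
  let ?h = "horner SA (\<lambda>y. \<tau> w \<otimes>\<^bsub>SA\<^esub> y)"
  have hc: "?h zs \<in> carrier SA" if "set zs \<subseteq> G W" for zs
    using that G_closed[OF W] tau_closed[OF w]
    by (intro horner_closed[OF V.K.field_axioms SA.module_axioms]) auto
  {
    case Nil
    then show ?case using hc[of ys] by (intro exI[of _ ys]) simp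
  next
    case (Cons x xs)
    note xc = G_closed[OF W, of x] hc[of xs]
    show ?case
    proof (cases ys)
      case Nil
      then show ?thesis using Cons.prems hc[of "x # xs"] by (intro exI[of _ "x # xs"]) simp
    next
      case (Cons y ys')
      then obtain zs where zs: "set zs \<subseteq> G W" "?h zs = ?h xs \<oplus>\<^bsub>SA\<^esub> ?h ys'"
        using Cons.IH[of ys'] Cons.prems \<open>ys = y # ys'\<close> by auto
      have c: "x \<in> carrier SA" "y \<in> carrier SA" "?h xs \<in> carrier SA" "?h ys' \<in> carrier SA"
        using Cons.prems \<open>ys = y # ys'\<close> G_closed[OF W] hc by auto
      have "?h ((x \<oplus>\<^bsub>SA\<^esub> y) # zs) = ?h (x # xs) \<oplus>\<^bsub>SA\<^esub> ?h ys"
        using c zs(2) tau_closed[OF w] \<open>ys = y # ys'\<close> by (simp add: SA.r_distr SA.a_ac)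
      then show ?thesis using zs(1) Cons.prems \<open>ys = y # ys'\<close>
        by (intro exI[of _ "(x \<oplus>\<^bsub>SA\<^esub> y) # zs"]) (auto intro: sym_subspace.add)
    qed
  }
qed

text \<open>An element is expanded in powers of \<open>\<tau> w\<close>. The other generators
  commute with \<open>\<tau> w\<close> and act on the coefficients, while \<open>\<tau> w\<close>
  itself shifts them by one place and leaves a zero constant term.\<close>

private lemma G_insert_horner:
  assumes W: "W \<subseteq> carrier V" and w: "w \<in> carrier V" and x: "x \<in> G (insert w W)"
  shows "\<exists>xs. set xs \<subseteq> G W \<and> x = horner SA (\<lambda>y. \<tau> w \<otimes>\<^bsub>SA\<^esub> y) xs"
  using x
proof (induction rule: sym_subspace.induct)
  case (const a)
  then show ?case using tau_closed[OF w] pure_closed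
    by (intro exI[of _ "[pure \<one>\<^bsub>S\<^esub> a]"]) (auto intro: sym_subspace.const)
next
  case (gen_mult v x)
  let ?h = "horner SA (\<lambda>y. \<tau> w \<otimes>\<^bsub>SA\<^esub> y)"
  obtain xs where xs: "set xs \<subseteq> G W" "x = ?h xs" using gen_mult by auto
  have hc: "?h xs \<in> carrier SA"
    using xs(1) G_closed[OF W] tau_closed[OF w]
    by (intro horner_closed[OF V.K.field_axioms SA.module_axioms]) auto
  show ?case
  proof (cases "v = w")
    case True
    have "\<zero>\<^bsub>SA\<^esub> \<in> G W"
      by (rule submodule_zero[OF G_submodule[OF W]])
    then show ?thesis using True xs hc tau_closed[OF w] by (intro exI[of _ "\<zero>\<^bsub>SA\<^esub> # xs"]) auto
  next
    case False
    then have v: "v \<in> W" "v \<in> carrier V" using gen_mult W by auto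
    have "\<tau> v \<otimes>\<^bsub>SA\<^esub> ?h xs = ?h (map (\<lambda>y. \<tau> v \<otimes>\<^bsub>SA\<^esub> y) xs)"
      using xs(1) G_closed[OF W] tau_closed w v
      by (intro horner_map[OF SA.module_axioms SA.module_axioms bilinear_mapsD(1)[OF mult_bilinear[OF algebra_SA]]])
        (auto simp: tau_commute)
    then show ?thesis using xs v sym_subspace.gen_mult[OF v(1)]
      by (intro exI[of _ "map (\<lambda>y. \<tau> v \<otimes>\<^bsub>SA\<^esub> y) xs"]) auto
  qed
next
  case (add x y)
  then show ?case using G_horner_add[OF W w] by metis
qed

text \<open>A product of generators involves finitely many of them, and sums are handled by finite
  unions because \<open>G W\<close> grows with \<open>W\<close>.\<close>

private lemma G_exhaust: "x \<in> carrier SA \<Longrightarrow> \<exists>W. finite W \<and> W \<subseteq> carrier V \<and> x \<in> G W"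
proof (induction rule: tensor_induct[OF algebra_S A, consumes 1, case_names pure add])
  case (pure s a)
  then show ?case
  proof (induction arbitrary: a rule: sym_algebra_induct[OF V, consumes 1, case_names one gen_mult smult add])
    case one
    then show ?case by (intro exI[of _ "{}"]) (auto intro: sym_subspace.const)
  next
    case (gen_mult v s)
    then obtain W where W: "finite W" "W \<subseteq> carrier V" "pure s a \<in> G W" by blast
    have "pure (t v \<otimes>\<^bsub>S\<^esub> s) a = \<tau> v \<otimes>\<^bsub>SA\<^esub> pure s a"
      using gen_mult by (simp add: pure_tensor_mult[OF algebra_S A] t_closed)
    then show ?case using W gen_mult(1) G_mono[OF W(3), of "insert v W"]
      by (intro exI[of _ "insert v W"]) (auto intro: sym_subspace.gen_mult)
  next
    case (smult c s)
    then obtain W where W: "finite W" "W \<subseteq> carrier V" "pure s a \<in> G W" by blast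
    then show ?case using smult G_smult[OF W(3,2)]
      by (intro exI[of _ W]) (auto simp: linear_maps_smult[OF pure_left])
  next
    case (add s s')
    then obtain W W' where W: "finite W" "W \<subseteq> carrier V" "pure s a \<in> G W"
       "finite W'" "W' \<subseteq> carrier V" "pure s' a \<in> G W'" by meson
    then show ?case using add G_mono[OF W(3), of "W \<union> W'"] G_mono[OF W(6), of "W \<union> W'"]
      by (intro exI[of _ "W \<union> W'"]) (auto simp: linear_maps_add[OF pure_left] intro: sym_subspace.add)
  qed
next
  case (add x y)
  then obtain W W' where W: "finite W" "W \<subseteq> carrier V" "x \<in> G W"
     "finite W'" "W' \<subseteq> carrier V" "y \<in> G W'" by meson
  then show ?case using G_mono[OF W(3), of "W \<union> W'"] G_mono[OF W(6), of "W \<union> W'"]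
    by (intro exI[of _ "W \<union> W'"]) (auto intro: sym_subspace.add)
qed

private lemma E_tau:
  assumes f: "f \<in> KV" and v: "v \<in> carrier V" and x: "x \<in> carrier SA"
  shows "E f (\<tau> v \<otimes>\<^bsub>SA\<^esub> x) = f v \<odot> E f x"
proof -
  note Ef = alg_homD[OF scalar_specialisation(1)[OF f]]
  have "f v \<in> carrier K" using linear_maps_closed[OF f v] by (simp add: base_algebra_def)
  then show ?thesis
    using v x linear_maps_closed[OF Ef(1) x]
    by (simp add: Ef(3) tau_closed scalar_specialisation(2)[OF f] A.smult_mult_left)
qed

text \<open>This permits changing a functional at a new generator without disturbing the
  specialisation of coefficients that involve only \<open>W\<close>.\<close>

private lemma E_cong:
  assumes W: "W \<subseteq> carrier V" and f: "f \<in> KV" and g: "g \<in> KV" and eq: "\<And>w. w \<in> W \<Longrightarrow> f w = g w"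
    and x: "x \<in> G W"
  shows "E f x = E g x"
  using x
proof (induction rule: sym_subspace.induct)
  case (const a)
  then show ?case by (simp add: scalar_specialisation(3)[OF f] scalar_specialisation(3)[OF g])
next
  case (gen_mult w x)
  then have "w \<in> carrier V" "x \<in> carrier SA" using W G_closed[OF W] by auto
  then show ?case using gen_mult eq by (simp add: E_tau[OF f] E_tau[OF g])
next
  case (add x y)
  then have "x \<in> carrier SA" "y \<in> carrier SA" using G_closed[OF W] by auto
  then show ?case using add
    by (simp add: linear_maps_add[OF alg_homD(1)[OF scalar_specialisation(1)[OF f]]]
        linear_maps_add[OF alg_homD(1)[OF scalar_specialisation(1)[OF g]]])
qed

text \<open>
  By induction on a finite set of generators occurring in \<open>x\<close>: a new generator \<open>w\<close> that does not
  already act on the previous subspace is separated from it by a functional, and moving \<open>f\<close>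
  along this functional turns the value of \<open>x\<close> into a polynomial in \<open>f w\<close>.
\<close>

private lemma G_zero:
  assumes inf: "infinite (carrier K)"
  shows "finite W \<Longrightarrow> W \<subseteq> carrier V \<Longrightarrow> x \<in> G W \<Longrightarrow> (\<And>f. f \<in> KV \<Longrightarrow> E f x = \<zero>) \<Longrightarrow> x = \<zero>\<^bsub>SA\<^esub>"
proof (induction W arbitrary: x rule: finite_induct)
  case empty
  have "\<exists>a\<in>carrier A. x = pure \<one>\<^bsub>S\<^esub> a" using empty.prems(2)
  proof (induction rule: sym_subspace.induct)
    case (add x y)
    then obtain a b where ab: "a \<in> carrier A" "x = pure \<one>\<^bsub>S\<^esub> a" "b \<in> carrier A" "y = pure \<one>\<^bsub>S\<^esub> b" by auto
    then show ?case
      by (intro bexI[of _ "a \<oplus> b"]) (simp_all add: linear_maps_add[OF pure_right])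
  qed auto
  then obtain a where a: "a \<in> carrier A" "x = pure \<one>\<^bsub>S\<^esub> a" by auto
  \<comment> \<open>Without generators the element is a constant \<open>1 \<otimes> a\<close>, from
    which every specialisation recovers \<open>a\<close>. The zero functional is the one at
    hand.\<close>
  have z: "(\<lambda>_. \<zero>\<^bsub>K\<^esub>) \<in> KV" by (intro linear_mapsI) (auto simp: base_algebra_def)
  have "a = \<zero>" using scalar_specialisation(3)[OF z a(1)] empty.prems(3)[OF z] a(2) by simp
  then show ?case
    using a(2) linear_maps_zero[OF A.module_axioms SA.module_axioms pure_right] by simp
next
  case (insert w W)
  then have W: "W \<subseteq> carrier V" and w: "w \<in> carrier V" by auto
  let ?N = "{v \<in> carrier V. \<forall>x\<in>G W. \<tau> v \<otimes>\<^bsub>SA\<^esub> x \<in> G W}"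
  show ?case
  proof (cases "w \<in> ?N")
    \<comment> \<open>The new generator is redundant: \<open>G W\<close> already absorbs
      multiplication by \<open>\<tau> w\<close>, so it contains \<open>x\<close>.\<close>
    case True
    have "y \<in> G W" if "y \<in> G (insert w W)" for y
      using that by (induction rule: sym_subspace.induct) (use True in \<open>auto intro: sym_subspace.intros\<close>)
    then show ?thesis using insert W by blast
  next
    case False
    obtain f0 where f0: "f0 \<in> KV" "\<And>v. v \<in> ?N \<Longrightarrow> f0 v = \<zero>\<^bsub>K\<^esub>" "f0 w = \<one>\<^bsub>K\<^esub>"
      using separating_functional[OF V.K.field_axioms V.module_axioms G_normalizer_submodule[OF W] w False]
      by auto
    have WN: "W \<subseteq> ?N" using W by (auto intro: sym_subspace.gen_mult)
    obtain xs where xs: "set xs \<subseteq> G W" "x = horner SA (\<lambda>y. \<tau> w \<otimes>\<^bsub>SA\<^esub> y) xs"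
      using G_insert_horner[OF W w insert.prems(2)] by auto
    have xsc: "set xs \<subseteq> carrier SA" using xs(1) G_closed[OF W] by auto
    \<comment> \<open>For fixed \<open>f\<close> the specialised coefficients form a polynomial over
      \<open>A\<close>. Its value at a scalar \<open>c\<close> is the specialisation of
      \<open>x\<close> at a functional \<open>g\<close> that takes the value \<open>c\<close> at
      \<open>w\<close> and agrees with \<open>f\<close> on \<open>W\<close>.\<close>
    have "set (map (E f) xs) \<subseteq> {\<zero>}" if f: "f \<in> KV" for f
    proof (rule polynomial_zero[OF V.K.field_axioms A.module_axioms inf order.refl])
      show "set (map (E f) xs) \<subseteq> carrier A"
        using xsc linear_maps_closed[OF alg_homD(1)[OF scalar_specialisation(1)[OF f]]] by auto
      fix c assume c: "c \<in> carrier K"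
      have fK: "f v \<in> carrier K" "f0 v \<in> carrier K" if "v \<in> carrier V" for v
        using linear_maps_closed[OF f that] linear_maps_closed[OF f0(1) that] by (simp_all add: base_algebra_def)
      \<comment> \<open>As \<open>f0 w\<close> is one, adding this multiple of \<open>f0\<close>
        moves the value at \<open>w\<close> from \<open>f w\<close> to \<open>c\<close>.\<close>
      define d where "d = c \<ominus>\<^bsub>K\<^esub> f w"
      have d: "d \<in> carrier K" using c fK w by (simp add: d_def)
      define g where "g v = f v \<oplus>\<^bsub>K\<^esub> d \<otimes>\<^bsub>K\<^esub> f0 v" for v
      have g: "g \<in> KV"
        using linear_maps_add[OF f] linear_maps_add[OF f0(1)] linear_maps_smult[OF f]
          linear_maps_smult[OF f0(1)] d fK
        by (intro linear_mapsI) (simp_all add: g_def base_algebra_def V.K.r_distr V.K.a_ac V.K.m_lcomm)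
      have gw: "g w = c"
        using c fK w f0(3) by (simp add: g_def d_def a_minus_def V.K.a_ac V.K.r_neg1 V.K.r_neg2 V.K.r_neg)
      have gW: "g v = f v" if "v \<in> W" for v
        using that WN f0(2) W fK d by (auto simp: g_def)
      have "horner A (\<lambda>y. c \<odot> y) (map (E g) xs) = E g x"
        unfolding xs(2) using w xsc tau_closed[OF w] gw
        by (intro horner_map[symmetric, OF SA.module_axioms A.module_axioms
              alg_homD(1)[OF scalar_specialisation(1)[OF g]]]) (auto simp: E_tau[OF g])
      moreover have "map (E g) xs = map (E f) xs"
        using xs(1) E_cong[OF W g f gW] by auto
      ultimately show "horner A (\<lambda>y. c \<odot> y) (map (E f) xs) = \<zero>"
        using insert.prems(3)[OF g] by simp
    qed
    then have zero: "E f y = \<zero>" if "f \<in> KV" "y \<in> set xs" for f y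
      using that by fastforce
    have "y = \<zero>\<^bsub>SA\<^esub>" if "y \<in> set xs" for y
      by (rule insert.IH[OF W _ zero[OF _ that]]) (use that xs(1) in auto)
    then have "\<forall>y\<in>set xs. y = \<zero>\<^bsub>SA\<^esub>" by blast
    then show ?thesis unfolding xs(2) using tau_closed[OF w]
      by (induction xs) simp_all
  qed
qed

lemma scalar_specialisations_separate:
  assumes "infinite (carrier K)" "x \<in> carrier (SA)"
    and "\<And>f. f \<in> linear_maps K V (base_algebra K) \<Longrightarrow> scalar_specialisation f x = \<zero>"
  shows "x = \<zero>\<^bsub>SA\<^esub>"
  using G_exhaust[OF assms(2)] G_zero[OF assms(1) _ _ _ assms(3)] by blast

end

section \<open>Comodule algebras\<close>

text \<open>Closure under scalars also yields negatives, as multiples by minus one, and zero, as a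
  multiple of the unit.\<close>

lemma subalgebra_algebra:
  assumes A: "assoc_algebra K A" and sub: "S \<subseteq> carrier A" and one: "\<one>\<^bsub>A\<^esub> \<in> S"
    and add: "\<And>x y. x \<in> S \<Longrightarrow> y \<in> S \<Longrightarrow> x \<oplus>\<^bsub>A\<^esub> y \<in> S"
    and mult: "\<And>x y. x \<in> S \<Longrightarrow> y \<in> S \<Longrightarrow> x \<otimes>\<^bsub>A\<^esub> y \<in> S"
    and smult: "\<And>c x. c \<in> carrier K \<Longrightarrow> x \<in> S \<Longrightarrow> c \<odot>\<^bsub>A\<^esub> x \<in> S"
  shows "assoc_algebra K (A\<lparr>carrier := S\<rparr>)"
proof -
  interpret A: assoc_algebra K A by fact
  have inA: "x \<in> carrier A" if "x \<in> S" for x using that sub by auto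
  have zero: "\<zero>\<^bsub>A\<^esub> \<in> S" using smult[of "\<zero>\<^bsub>K\<^esub>" "\<one>\<^bsub>A\<^esub>"] one by simp
  have inv: "\<exists>y\<in>S. x \<oplus>\<^bsub>A\<^esub> y = \<zero>\<^bsub>A\<^esub>" if "x \<in> S" for x
  proof (rule bexI)
    show "((\<ominus>\<^bsub>K\<^esub> \<one>\<^bsub>K\<^esub>) \<odot>\<^bsub>A\<^esub> x) \<in> S" using that by (intro smult) auto
    show "x \<oplus>\<^bsub>A\<^esub> ((\<ominus>\<^bsub>K\<^esub> \<one>\<^bsub>K\<^esub>) \<odot>\<^bsub>A\<^esub> x) = \<zero>\<^bsub>A\<^esub>"
      using inA[OF that] by (simp add: A.smult_l_minus A.r_neg)
  qed
  have ag: "abelian_group (A\<lparr>carrier := S\<rparr>)"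
    by (rule abelian_groupI) (auto simp: zero add inA inv A.a_ac)
  have "ring (A\<lparr>carrier := S\<rparr>)"
    by (intro ringI ag monoidI) (auto simp: one mult inA A.l_distr A.r_distr A.m_assoc)
  then show ?thesis
    by (intro assoc_algebra.intro moduleI A.K.field_axioms A.K.is_cring ag assoc_algebra_axioms.intro)
      (auto simp: smult inA A.smult_l_distr A.smult_r_distr A.smult_assoc1
        A.smult_mult_left A.smult_mult_right)
qed

lemma tensor_map_comp:
  assumes V: "assoc_algebra K V" and V': "assoc_algebra K V'" and V'': "assoc_algebra K V''"
    and W: "assoc_algebra K W" and f: "f \<in> linear_maps K V V'" and g: "g \<in> linear_maps K V' V''"
    and x: "x \<in> carrier (tensor K V W)"
  shows "tensor_map K V'' W g id (tensor_map K V' W f id x) = tensor_map K V'' W (\<lambda>v. g (f v)) id x"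
  using tensor_lift_map[OF V W V' W f linear_maps_id' tensor_assoc_algebra[OF V'' W]
      tensor_map_bilinear[OF V'' W g linear_maps_id'] x]
  unfolding tensor_map_def[of K V'' W] by simp

lemma tensor_map_cong:
  assumes V: "assoc_algebra K V" and V': "assoc_algebra K V'" and W: "assoc_algebra K W"
    and f: "f \<in> linear_maps K V V'" and eq: "\<And>v. v \<in> carrier V \<Longrightarrow> g v = f v"
    and x: "x \<in> carrier (tensor K V W)"
  shows "tensor_map K V' W g id x = tensor_map K V' W f id x"
  unfolding tensor_map_def
  by (rule tensor_lift_cong[OF V W tensor_assoc_algebra[OF V' W]
        tensor_map_bilinear[OF V' W f linear_maps_id'] _ x]) (simp add: eq)

lemma tensor_map_id:
  assumes V: "assoc_algebra K V" and W: "assoc_algebra K W"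
    and x: "x \<in> carrier (tensor K V W)"
  shows "tensor_map K V W (\<lambda>v. v) id x = x"
  by (rule tensor_linear_eq[OF V W tensor_map_linear[OF V W V W linear_maps_id linear_maps_id']
        linear_maps_id _ x])
    (simp add: tensor_map_pure[OF V W V W linear_maps_id linear_maps_id'])

section \<open>The coaction carried by the second tensor factor\<close>

context
  fixes K :: "'k ring" and H :: "('k, 'h) module" and V :: "('k, 'v) module"
    and M :: "('k, 'm) module" and \<delta>M :: "'m \<Rightarrow> ('m \<times> 'h \<Rightarrow> 'k) set"
  assumes H: "assoc_algebra K H" and V: "assoc_algebra K V" and M: "assoc_algebra K M"
    and \<delta>M: "\<delta>M \<in> alg_hom K M (tensor K M H)"
begin

private lemmas MH = tensor_assoc_algebra[OF M H]

lemma free_coact_alg_hom: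
  "free_coact K H V M \<delta>M \<in> alg_hom K (tensor K V M) (tensor K (tensor K V M) H)"
  unfolding free_coact_def[abs_def]
  by (rule alg_hom_comp[OF tensor_map_alg_hom[OF V M V MH alg_hom_id \<delta>M] tensor_assoc_alg_hom[OF V M H]])

lemma free_coact_pure:
  assumes v: "v \<in> carrier V" and m: "m \<in> carrier M"
  shows "free_coact K H V M \<delta>M (pure_tensor K V M v m) =
    tensor_lift K (tensor K (tensor K V M) H)
      (\<lambda>w z. pure_tensor K (tensor K V M) H (pure_tensor K V M v w) z) (\<delta>M m)"
proof -
  note \<delta> = alg_homD(1)[OF \<delta>M]
  show ?thesis
    unfolding free_coact_def
    by (simp add: tensor_map_pure[OF V M V MH linear_maps_id' \<delta> v m]
        tensor_assoc_pure[OF V M H v linear_maps_closed[OF \<delta> m]])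
qed

end

context bialgebra
begin

context
begin

lemma algebra_H: "assoc_algebra K H"
  by (rule assoc_algebra_axioms)

private lemmas HH = tensor_assoc_algebra[OF algebra_H algebra_H]

lemma comult_linear: "\<Delta> \<in> linear_maps K H (tensor K H H)"
  by (rule alg_homD(1)[OF comult_hom])

lemma comult_closed: "h \<in> carrier H \<Longrightarrow> \<Delta> h \<in> carrier (tensor K H H)"
  by (rule linear_maps_closed[OF comult_linear])

text \<open>In Sweedler notation: \<open>\<Sum> F h\<^sub>(\<^sub>1\<^sub>)\<^sub>(\<^sub>1\<^sub>) h\<^sub>(\<^sub>1\<^sub>)\<^sub>(\<^sub>2\<^sub>) h\<^sub>(\<^sub>2\<^sub>) = \<Sum> F h\<^sub>(\<^sub>1\<^sub>) h\<^sub>(\<^sub>2\<^sub>)\<^sub>(\<^sub>1\<^sub>) h\<^sub>(\<^sub>2\<^sub>)\<^sub>(\<^sub>2\<^sub>)\<close>.\<close>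

lemma coassoc_lift:
  assumes Y: "assoc_algebra K Y"
    and F1: "\<And>a. a \<in> carrier H \<Longrightarrow> F a \<in> bilinear_maps K H H Y"
    and F2: "\<And>z. z \<in> carrier H \<Longrightarrow> (\<lambda>a b. F a b z) \<in> bilinear_maps K H H Y"
    and h: "h \<in> carrier H"
  shows "tensor_lift K Y (\<lambda>x z. tensor_lift K Y (\<lambda>a b. F a b z) (\<Delta> x)) (\<Delta> h) =
    tensor_lift K Y (\<lambda>a y. tensor_lift K Y (F a) (\<Delta> y)) (\<Delta> h)"
proof -
  note H = algebra_H
  note Hm = assoc_algebra.axioms(2)[OF H]
  \<comment> \<open>\<open>Q\<close> and \<open>R\<close> are the two iterated sums, as bilinear
    maps on \<open>(H \<otimes> H) \<times> H\<close> and on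
    \<open>H \<times> (H \<otimes> H)\<close>. Reassociation carries the lift of one to that of the
    other, so that \<open>coassoc\<close> equates them.\<close>
  define Q where "Q p z = tensor_lift K Y (\<lambda>a b. F a b z) p" for p z
  have Q: "Q \<in> bilinear_maps K (tensor K H H) H Y"
  proof (rule bilinear_mapsI)
    show "Q p \<in> linear_maps K H Y" if "p \<in> carrier (tensor K H H)" for p
      unfolding Q_def
      by (rule tensor_lift_parameter_linear[OF H H Y Hm F2 _ that])
        (auto intro: bilinear_mapsD(1)[OF F1])
    show "(\<lambda>p. Q p z) \<in> linear_maps K (tensor K H H) Y" if "z \<in> carrier H" for z
      unfolding Q_def by (rule tensor_lift_linear[OF H H Y F2[OF that]])
  qed
  define R where "R a q = tensor_lift K Y (F a) q" for a q
  have R: "R \<in> bilinear_maps K H (tensor K H H) Y"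
  proof (rule bilinear_mapsI)
    show "R a \<in> linear_maps K (tensor K H H) Y" if "a \<in> carrier H" for a
      unfolding R_def by (rule tensor_lift_linear[OF H H Y F1[OF that]])
    show "(\<lambda>a. R a q) \<in> linear_maps K H Y" if q: "q \<in> carrier (tensor K H H)" for q
      unfolding R_def
      by (rule tensor_lift_parameter_linear[OF H H Y Hm, where f = "\<lambda>b z a. F a b z" and x = q])
        (use F1 q bilinear_mapsD(2)[OF F2] in auto)
  qed
  let ?L = "tensor_lift K Y Q"
  note L = tensor_lift_linear[OF HH H Y Q]
  have assoc: "?L (tensor_assoc K H H H y) = tensor_lift K Y R y"
    if "y \<in> carrier (tensor K H (tensor K H H))" for y
  proof (rule tensor_linear_eq[OF H HH linear_maps_comp[OF tensor_assoc_linear[OF H H H] L]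
        tensor_lift_linear[OF H HH Y R] _ that])
    fix a q assume a: "a \<in> carrier H" and q: "q \<in> carrier (tensor K H H)"
    note ab = tensor_assoc_bilinear[OF H H H a]
    have "?L (tensor_assoc K H H H (pure_tensor K H (tensor K H H) a q)) =
        tensor_lift K Y (\<lambda>b z. ?L (pure_tensor K (tensor K H H) H (pure_tensor K H H a b) z)) q"
      unfolding tensor_assoc_pure[OF H H H a q]
      by (rule tensor_lift_comp[OF H H tensor_assoc_algebra[OF HH H] ab Y L q])
    also have "\<dots> = tensor_lift K Y (F a) q"
      by (rule tensor_lift_cong[OF H H Y F1[OF a] _ q])
        (simp add: tensor_lift_pure[OF HH H Y Q] pure_tensor_closed[OF H H] a Q_def
          tensor_lift_pure[OF H H Y F2])
    also have "\<dots> = tensor_lift K Y R (pure_tensor K H (tensor K H H) a q)"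
      by (simp add: tensor_lift_pure[OF H HH Y R a q] R_def)
    finally show "?L (tensor_assoc K H H H (pure_tensor K H (tensor K H H) a q)) = \<dots>" .
  qed
  note D = comult_closed[OF h]
  have "?L (tensor_map K (tensor K H H) H \<Delta> id (\<Delta> h)) = tensor_lift K Y (\<lambda>x z. Q (\<Delta> x) (id z)) (\<Delta> h)"
    by (rule tensor_lift_map[OF H H HH H comult_linear linear_maps_id' Y Q D])
  moreover have "tensor_lift K Y R (tensor_map K H (tensor K H H) id \<Delta> (\<Delta> h)) =
      tensor_lift K Y (\<lambda>a y. R (id a) (\<Delta> y)) (\<Delta> h)"
    by (rule tensor_lift_map[OF H H H HH linear_maps_id' comult_linear Y R D])
  moreover have "tensor_map K H (tensor K H H) id \<Delta> (\<Delta> h) \<in> carrier (tensor K H (tensor K H H))"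
    by (rule linear_maps_closed[OF tensor_map_linear[OF H H H HH linear_maps_id' comult_linear] D])
  ultimately show ?thesis using coassoc[OF h] assoc by (simp add: Q_def R_def)
qed

section \<open>The coaction on the tensor algebra\<close>

private abbreviation (input) "TH \<equiv> tensor_algebra K H"
private abbreviation (input) "XH \<equiv> tensor_algebra_gen K H"
private abbreviation (input) "\<delta>T \<equiv> tensor_algebra_coact K H \<Delta>"

private lemmas algebra_T = tensor_algebra_algebra[OF algebra_H]
private lemmas gen_X = tensor_algebra_gen_linear[OF algebra_H]
private lemmas TTH = tensor_assoc_algebra[OF algebra_T algebra_H]

private lemma coact_gen_linear:
  "(\<lambda>h. tensor_map K TH H XH id (\<Delta> h)) \<in> linear_maps K H (tensor K TH H)"
  by (rule linear_maps_comp[OF comult_linear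
        tensor_map_linear[OF algebra_H algebra_H algebra_T algebra_H gen_X linear_maps_id']])

private lemma coact_eq: "\<delta>T = tensor_algebra_lift K (tensor K TH H) (\<lambda>h. tensor_map K TH H XH id (\<Delta> h))"
  unfolding tensor_algebra_coact_def Let_def tensor_map_def by simp

lemma tensor_algebra_coact_alg_hom:
  "tensor_algebra_coact K H \<Delta> \<in> alg_hom K (tensor_algebra K H) (tensor K (tensor_algebra K H) H)"
  unfolding coact_eq by (rule tensor_algebra_lift_alg_hom[OF algebra_H TTH coact_gen_linear])

lemma tensor_algebra_coact_gen:
  "h \<in> carrier H \<Longrightarrow> tensor_algebra_coact K H \<Delta> (tensor_algebra_gen K H h) =
    tensor_map K (tensor_algebra K H) H (tensor_algebra_gen K H) id (\<Delta> h)"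
  unfolding coact_eq by (rule tensor_algebra_lift_gen[OF algebra_H TTH coact_gen_linear])

text \<open>Colinearity compares two algebra morphisms out of the tensor algebra, because all
  coactions involved are multiplicative. Agreement on generators is therefore enough.\<close>

lemma tensor_algebra_comodule_alg_homI:
  assumes Z: "assoc_algebra K Z" and \<delta>Z: "\<delta>Z \<in> alg_hom K Z (tensor K Z H)"
    and \<mu>: "\<mu> \<in> alg_hom K (tensor_algebra K H) Z"
    and gen: "\<And>h. h \<in> carrier H \<Longrightarrow> \<delta>Z (\<mu> (tensor_algebra_gen K H h)) =
      tensor_map K Z H (\<lambda>x. \<mu> (tensor_algebra_gen K H x)) id (\<Delta> h)"
  shows "\<mu> \<in> comodule_alg_hom K H (tensor_algebra K H) (tensor_algebra_coact K H \<Delta>) Z \<delta>Z"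
proof -
  note m = alg_homD(1)[OF \<mu>]
  have "\<delta>Z (\<mu> P) = tensor_map K Z H \<mu> id (\<delta>T P)" if "P \<in> carrier TH" for P
    by (rule tensor_algebra_hom_eq[OF algebra_H alg_hom_comp[OF \<mu> \<delta>Z]
          alg_hom_comp[OF tensor_algebra_coact_alg_hom
            tensor_map_alg_hom[OF algebra_T algebra_H Z algebra_H \<mu> alg_hom_id]] _ that])
      (simp add: gen tensor_algebra_coact_gen
        tensor_map_comp[OF algebra_H algebra_T Z algebra_H gen_X m comult_closed])
  then show ?thesis using \<mu> m by (simp add: comodule_alg_hom_def comodule_hom_def)
qed

lemma tensor_algebra_comodule_alg_homD:
  assumes Z: "assoc_algebra K Z"
    and \<mu>: "\<mu> \<in> comodule_alg_hom K H (tensor_algebra K H) (tensor_algebra_coact K H \<Delta>) Z \<delta>Z"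
    and h: "h \<in> carrier H"
  shows "\<delta>Z (\<mu> (tensor_algebra_gen K H h)) =
      tensor_map K Z H (\<lambda>x. \<mu> (tensor_algebra_gen K H x)) id (\<Delta> h)"
proof -
  have m: "\<mu> \<in> linear_maps K TH Z" and eq: "\<And>P. P \<in> carrier TH \<Longrightarrow> \<delta>Z (\<mu> P) = tensor_map K Z H \<mu> id (\<delta>T P)"
    using \<mu> by (auto simp: comodule_alg_hom_def comodule_hom_def)
  show ?thesis
    using h linear_maps_closed[OF gen_X h]
    by (simp add: eq tensor_algebra_coact_gen
        tensor_map_comp[OF algebra_H algebra_T Z algebra_H gen_X m comult_closed])
qed

text \<open>The coaction splits off part of \<open>h_(2)\<close>, because \<open>j\<close> is
  colinear; by coassociativity this equals splitting \<open>h\<close> first and then twisting its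
  first leg. The map \<open>m\<close> is kept general to serve both \<open>t_x \<otimes> a\<close>
  in \<open>S(t_H) \<otimes> A\<close> and the scalar multiple \<open>f x\<close> times
  \<open>a\<close> in \<open>A\<close>.\<close>

lemma twisted_comodule_hom:
  assumes A: "assoc_algebra K A" and Z: "assoc_algebra K Z"
    and \<delta>Z: "\<delta>Z \<in> linear_maps K Z (tensor K Z H)"
    and j: "j \<in> linear_maps K H A"
    and j_comod: "\<And>h. h \<in> carrier H \<Longrightarrow> \<delta> (j h) = tensor_map K A H j id (\<Delta> h)"
    and m: "m \<in> bilinear_maps K H A Z"
    and m_comod: "\<And>x a. x \<in> carrier H \<Longrightarrow> a \<in> carrier A \<Longrightarrow> \<delta>Z (m x a) =
      tensor_lift K (tensor K Z H) (\<lambda>w z. pure_tensor K Z H (m x w) z) (\<delta> a)"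
    and h: "h \<in> carrier H"
  shows "\<delta>Z (tensor_lift K Z (\<lambda>x y. m x (j y)) (\<Delta> h)) =
    tensor_map K Z H (\<lambda>h. tensor_lift K Z (\<lambda>x y. m x (j y)) (\<Delta> h)) id (\<Delta> h)"
proof -
  note H = algebra_H and D = comult_closed
  note ZH = tensor_assoc_algebra[OF Z H]
  note pb = pure_tensor_bilinear[OF Z H]
  have mj: "(\<lambda>x y. m x (j y)) \<in> bilinear_maps K H H Z"
    by (rule bilinear_maps_precomp[OF m linear_maps_id j])
  let ?F = "\<lambda>a b z. pure_tensor K Z H (m a (j b)) z"
  have F0: "(\<lambda>w z. pure_tensor K Z H (m x w) z) \<in> bilinear_maps K A H (tensor K Z H)"
    if "x \<in> carrier H" for x
    by (rule bilinear_maps_precomp[OF pb bilinear_mapsD(1)[OF m that] linear_maps_id])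
  have F1: "?F a \<in> bilinear_maps K H H (tensor K Z H)" if "a \<in> carrier H" for a
    by (rule bilinear_maps_precomp[OF pb bilinear_mapsD(1)[OF mj that] linear_maps_id])
  have F2: "(\<lambda>a b. ?F a b z) \<in> bilinear_maps K H H (tensor K Z H)" if "z \<in> carrier H" for z
    by (rule bilinear_maps_comp[OF mj bilinear_mapsD(2)[OF pb that]])
  let ?g = "\<lambda>h. tensor_lift K Z (\<lambda>x y. m x (j y)) (\<Delta> h)"
  have g: "?g \<in> linear_maps K H Z"
    by (rule linear_maps_comp[OF comult_linear tensor_lift_linear[OF H H Z mj]])
  have eq: "tensor_lift K (tensor K Z H) (?F x) (\<Delta> y) = \<delta>Z (m x (j y))"
    if "x \<in> carrier H" "y \<in> carrier H" for x y
    using that m_comod[OF that(1) linear_maps_closed[OF j that(2)]]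
      tensor_lift_map[OF H H A H j linear_maps_id' ZH F0[OF that(1)] D[OF that(2)]]
    by (simp add: j_comod)
  have "\<delta>Z (?g h) = tensor_lift K (tensor K Z H) (\<lambda>x y. \<delta>Z (m x (j y))) (\<Delta> h)"
    by (rule tensor_lift_comp[OF H H Z mj ZH \<delta>Z D[OF h]])
  also have "\<dots> = tensor_lift K (tensor K Z H) (\<lambda>x y. tensor_lift K (tensor K Z H) (?F x) (\<Delta> y)) (\<Delta> h)"
    by (rule tensor_lift_cong[OF H H ZH bilinear_maps_cong[OF H H bilinear_maps_comp[OF mj \<delta>Z] eq]
          eq[symmetric] D[OF h]])
  also have "\<dots> = tensor_lift K (tensor K Z H)
      (\<lambda>x z. tensor_lift K (tensor K Z H) (\<lambda>a b. ?F a b z) (\<Delta> x)) (\<Delta> h)"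
    by (rule coassoc_lift[OF ZH F1 F2 h, symmetric])
  also have "\<dots> = tensor_map K Z H ?g id (\<Delta> h)"
    unfolding tensor_map_def
  proof (rule tensor_lift_cong[OF H H ZH tensor_map_bilinear[OF Z H g linear_maps_id'] _ D[OF h]])
    fix x z assume "x \<in> carrier H" "z \<in> carrier H"
    then show "tensor_lift K (tensor K Z H) (\<lambda>a b. ?F a b z) (\<Delta> x) = pure_tensor K Z H (?g x) (id z)"
      using tensor_lift_comp[OF H H Z mj ZH bilinear_mapsD(2)[OF pb] D, of z x] by simp
  qed
  finally show ?thesis .
qed

end

end

section \<open>The generic comodule algebra morphism\<close>

context
  fixes K :: "'k ring" and H :: "('k, 'h) module" and A :: "('k, 'a) module" (structure)
    and \<Delta> :: "'h \<Rightarrow> ('h \<times> 'h \<Rightarrow> 'k) set" and \<epsilon> :: "'h \<Rightarrow> 'k"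
    and \<delta> :: "'a \<Rightarrow> ('a \<times> 'h \<Rightarrow> 'k) set" and u :: "('a \<times> 'h \<Rightarrow> 'k) set \<Rightarrow> 'a"
  assumes infinite: "infinite (carrier K)"
    and comod_alg: "comodule_algebra K H \<Delta> \<epsilon> A \<delta>"
    and central: "\<And>b a. b \<in> carrier (coinvariants K H A \<delta>) \<Longrightarrow> a \<in> carrier A \<Longrightarrow>
      b \<otimes> a = a \<otimes> b"
    and u_comod: "u \<in> comodule_hom K H (tensor K (coinvariants K H A \<delta>) H)
      (free_coact K H (coinvariants K H A \<delta>) H \<Delta>) A \<delta>"
    and u_bij: "bij_betw u (carrier (tensor K (coinvariants K H A \<delta>) H)) (carrier A)"
    and u_lin: "\<And>b x. b \<in> carrier (coinvariants K H A \<delta>) \<Longrightarrow>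
      x \<in> carrier (tensor K (coinvariants K H A \<delta>) H) \<Longrightarrow>
      u (tensor_map K (coinvariants K H A \<delta>) H (\<lambda>b'. b \<otimes>\<^bsub>coinvariants K H A \<delta>\<^esub> b') id x) =
      b \<otimes> u x"
begin

interpretation bialg: bialgebra K H \<Delta> \<epsilon>
  using comod_alg by (rule comodule_algebra.axioms)

interpretation A: assoc_algebra K A
  using comod_alg by (rule comodule_algebra.axioms)

private abbreviation (input) "B \<equiv> coinvariants K H A \<delta>"
private abbreviation (input) "BH \<equiv> tensor K B H"
private abbreviation (input) "SH \<equiv> sym_algebra K H"
private abbreviation (input) "tH \<equiv> sym_algebra_gen K H"
private abbreviation (input) "SHA \<equiv> tensor K SH A"
private abbreviation (input) "TX \<equiv> tensor_algebra K H"
private abbreviation (input) "XX \<equiv> tensor_algebra_gen K H"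
private abbreviation (input) "IA \<equiv> identities K H \<Delta> A \<delta>"
private abbreviation (input) "U \<equiv> univ_algebra K H \<Delta> A \<delta>"
private abbreviation (input) "\<pi> \<equiv> univ_proj K H \<Delta> A \<delta>"
private abbreviation (input) "\<delta>TX \<equiv> tensor_algebra_coact K H \<Delta>"
private abbreviation (input) "\<delta>U \<equiv> univ_coact K H \<Delta> A \<delta>"
private abbreviation (input) "\<delta>SA \<equiv> free_coact K H SH A \<delta>"
private abbreviation (input) "\<delta>BH \<equiv> free_coact K H B H \<Delta>"
private abbreviation (input) "\<mu>A \<equiv> generic_map K H \<Delta> A \<delta> u"
private abbreviation (input) "EA \<equiv> scalar_specialisation K H A"

private lemmas H = bialg.algebra_H
private lemmas D = bialg.comult_closed
private lemma Km: "field K" by (rule assoc_algebra.axioms(1)[OF A.assoc_algebra_axioms])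
private lemma A: "assoc_algebra K A" by (rule A.assoc_algebra_axioms)
private lemmas AH = tensor_assoc_algebra[OF A H]
private lemmas S = sym_algebra_algebra[OF H]
private lemmas SA = tensor_assoc_algebra[OF S A]
private lemmas T = tensor_algebra_algebra[OF H]
private lemmas X = tensor_algebra_gen_linear[OF H]
private lemmas t = sym_algebra_gen_linear[OF H]
private lemmas Hm = assoc_algebra.axioms(2)[OF H]
private lemmas Am = assoc_algebra.axioms(2)[OF A]
private lemmas SAm = assoc_algebra.axioms(2)[OF SA]
private lemmas Tm = assoc_algebra.axioms(2)[OF T]
private lemmas \<delta>_hom = comodule_algebra.coact_hom[OF comod_alg]
private lemmas \<delta>_linear = alg_homD(1)[OF \<delta>_hom]

private lemma B_simps:
  "\<one>\<^bsub>B\<^esub> = \<one>" "mult B = mult A" "add B = add A" "smult B = smult A"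
  "b \<in> carrier B \<longleftrightarrow> b \<in> carrier A \<and> \<delta> b = pure_tensor K A H b \<one>\<^bsub>H\<^esub>"
  by (simp_all add: coinvariants_def)

private lemma B: "assoc_algebra K B"
  unfolding coinvariants_def
proof (rule subalgebra_algebra[OF A])
  interpret H: assoc_algebra K H by (rule H)
  interpret AH: assoc_algebra K "tensor K A H" by (rule AH)
  note d = alg_homD[OF \<delta>_hom]
  show "\<one> \<in> {a \<in> carrier A. \<delta> a = pure_tensor K A H a \<one>\<^bsub>H\<^esub>}"
    by (simp add: d(2) tensor_one[OF A H])
qed (auto simp: alg_homD(3)[OF \<delta>_hom] linear_maps_add[OF \<delta>_linear] linear_maps_smult[OF \<delta>_linear]
      pure_tensor_mult[OF A H] bialg.one_closed
      linear_maps_add[OF bilinear_mapsD(2)[OF pure_tensor_bilinear[OF A H]]]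
      linear_maps_smult[OF bilinear_mapsD(2)[OF pure_tensor_bilinear[OF A H]]])

private lemmas BH = tensor_assoc_algebra[OF B H]
private lemmas BHm = assoc_algebra.axioms(2)[OF BH]

interpretation B: assoc_algebra K B by (rule B)

private lemma one_B: "\<one>\<^bsub>B\<^esub> \<in> carrier B" by (rule B.one_closed)

private lemma B_inclusion: "(\<lambda>b. b) \<in> linear_maps K B A"
  by (rule linear_mapsI) (auto simp: B_simps)

private lemmas pureB = pure_tensor_bilinear[OF B H]
private lemmas pureS = pure_tensor_bilinear[OF S A]

private lemma u_linear: "u \<in> linear_maps K BH A"
  and u_colinear: "x \<in> carrier BH \<Longrightarrow> \<delta> (u x) = tensor_map K A H u id (\<delta>BH x)"
  using u_comod by (auto simp: comodule_hom_def)

private abbreviation (input) "j \<equiv> \<lambda>y. u (pure_tensor K B H \<one>\<^bsub>B\<^esub> y)"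

private lemma j_linear: "j \<in> linear_maps K H A"
  by (rule linear_maps_comp[OF bilinear_mapsD(1)[OF pureB one_B] u_linear])

text \<open>The tensor \<open>b \<otimes> y\<close> is \<open>b\<close> acting on
  \<open>1 \<otimes> y\<close>, so linearity over \<open>B\<close> determines \<open>u\<close> by
  its restriction \<open>j\<close>.\<close>

private lemma u_pure:
  assumes b: "b \<in> carrier B" and y: "y \<in> carrier H"
  shows "u (pure_tensor K B H b y) = b \<otimes> j y"
proof -
  have "tensor_map K B H (\<lambda>b'. b \<otimes>\<^bsub>B\<^esub> b') id (pure_tensor K B H \<one>\<^bsub>B\<^esub> y) = pure_tensor K B H b y"
    using b y one_B
    by (simp add: tensor_map_pure[OF B H B H bilinear_mapsD(1)[OF mult_bilinear[OF B] b] linear_maps_id'])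
  then show ?thesis using u_lin[OF b pure_tensor_closed[OF B H one_B y]] by simp
qed

private lemmas \<delta>BH_hom = free_coact_alg_hom[OF H B H bialg.comult_hom]
private lemmas \<delta>BH_linear = alg_homD(1)[OF \<delta>BH_hom]
private lemmas \<delta>SA_hom = free_coact_alg_hom[OF H S A \<delta>_hom]
private lemmas \<delta>SA_linear = alg_homD(1)[OF \<delta>SA_hom]
private lemmas BHH = tensor_assoc_algebra[OF BH H]

text \<open>A composite of colinear maps: \<open>\<delta>BH\<close> acts by \<open>\<Delta>\<close>
  on the second factor, so inserting \<open>1\<close> in the first factor is colinear, and so is
  \<open>u\<close>.\<close>

private lemma j_colinear:
  assumes h: "h \<in> carrier H"
  shows "\<delta> (j h) = tensor_map K A H j id (\<Delta> h)"
proof -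
  note uid = tensor_map_linear[OF BH H A H u_linear linear_maps_id']
  note p1 = bilinear_mapsD(1)[OF pureB one_B]
  have "\<delta>BH (pure_tensor K B H \<one>\<^bsub>B\<^esub> h) = tensor_map K BH H (pure_tensor K B H \<one>\<^bsub>B\<^esub>) id (\<Delta> h)"
    unfolding free_coact_pure[OF H B H bialg.comult_hom one_B h] tensor_map_def by simp
  then show ?thesis
    using u_colinear[OF pure_tensor_closed[OF B H one_B h]]
      tensor_map_comp[OF H BH A H p1 u_linear D[OF h]] by simp
qed

private abbreviation (input) "generic_gen \<equiv>
  \<lambda>h. tensor_lift K SHA (\<lambda>x y. pure_tensor K SH A (tH x) (j y)) (\<Delta> h)"

private lemma tj_bilinear: "(\<lambda>x y. pure_tensor K SH A (tH x) (j y)) \<in> bilinear_maps K H H SHA"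
  by (rule bilinear_maps_precomp[OF pureS t j_linear])

private lemma generic_gen_linear: "generic_gen \<in> linear_maps K H SHA"
  by (rule linear_maps_comp[OF bialg.comult_linear tensor_lift_linear[OF H H SA tj_bilinear]])

private lemma generic_map_eq: "\<mu>A = tensor_algebra_lift K SHA generic_gen"
  by (simp add: generic_map_def Let_def)

private lemma generic_alg_hom: "\<mu>A \<in> alg_hom K TX SHA"
  unfolding generic_map_eq by (rule tensor_algebra_lift_alg_hom[OF H SA generic_gen_linear])

private lemma generic_map_gen: "h \<in> carrier H \<Longrightarrow> \<mu>A (XX h) = generic_gen h"
  unfolding generic_map_eq by (rule tensor_algebra_lift_gen[OF H SA generic_gen_linear])

private lemmas generic_linear = alg_homD(1)[OF generic_alg_hom]

text \<open>The coaction on \<open>S(t_H) \<otimes> A\<close> leaves the first factor alone, so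
  \<open>t_x \<otimes> a\<close> is colinear in \<open>a\<close> and
  \<open>twisted_comodule_hom\<close> applies.\<close>

private lemma generic_comodule: "\<mu>A \<in> comodule_alg_hom K H TX \<delta>TX SHA \<delta>SA"
proof (rule bialg.tensor_algebra_comodule_alg_homI[OF SA \<delta>SA_hom generic_alg_hom])
  fix h assume h: "h \<in> carrier H"
  have m: "(\<lambda>x a. pure_tensor K SH A (tH x) a) \<in> bilinear_maps K H A SHA"
    by (rule bilinear_maps_precomp[OF pureS t linear_maps_id])
  have "\<delta>SA (generic_gen h) = tensor_map K SHA H generic_gen id (\<Delta> h)"
    by (rule bialg.twisted_comodule_hom[OF A SA \<delta>SA_linear j_linear j_colinear m _ h])
      (simp_all add: free_coact_pure[OF H S A \<delta>_hom linear_maps_closed[OF t]])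
  also have "\<dots> = tensor_map K SHA H (\<lambda>x. \<mu>A (XX x)) id (\<Delta> h)"
    by (rule tensor_map_cong[symmetric, OF H SA H generic_gen_linear generic_map_gen D[OF h]])
  finally show "\<delta>SA (\<mu>A (XX h)) = \<dots>" using h by (simp add: generic_map_gen)
qed

text \<open>Kept general in \<open>\<Phi>\<close> and \<open>m\<close> so as to cover both families
  of specialisations, by functionals on \<open>H\<close> and by maps from \<open>H\<close> to
  \<open>B\<close>.\<close>

private lemma generic_specialisation:
  assumes "\<Phi> \<in> linear_maps K SHA A" "m \<in> bilinear_maps K H A A"
    and "\<And>v a. v \<in> carrier H \<Longrightarrow> a \<in> carrier A \<Longrightarrow> \<Phi> (pure_tensor K SH A (tH v) a) = m v a"
    and h: "h \<in> carrier H"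
  shows "\<Phi> (\<mu>A (XX h)) = tensor_lift K A (\<lambda>x y. m x (j y)) (\<Delta> h)"
proof -
  have "\<Phi> (\<mu>A (XX h)) = tensor_lift K A (\<lambda>x y. \<Phi> (pure_tensor K SH A (tH x) (j y))) (\<Delta> h)"
    using tensor_lift_comp[OF H H SA tj_bilinear A assms(1) D[OF h]] h by (simp add: generic_map_gen)
  also have "\<dots> = tensor_lift K A (\<lambda>x y. m x (j y)) (\<Delta> h)"
    by (rule tensor_lift_cong[OF H H A bilinear_maps_precomp[OF assms(2) linear_maps_id j_linear] _ D[OF h]])
      (simp add: assms(3) linear_maps_closed[OF j_linear])
  finally show ?thesis .
qed

private lemma smult_functional_bilinear:
  assumes f: "f \<in> linear_maps K H (base_algebra K)"
  shows "(\<lambda>x a. f x \<odot> a) \<in> bilinear_maps K H A A"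
  by (rule bilinear_maps_precomp[OF smult_bilinear[OF A] f linear_maps_id])

text \<open>Scaling by \<open>f x\<close> commutes with the coaction because \<open>\<delta>\<close>
  is linear. Hence \<open>f x\<close> times \<open>a\<close> is colinear in \<open>a\<close>, as
  \<open>twisted_comodule_hom\<close> requires.\<close>

private lemma specialisation_comodule:
  assumes f: "f \<in> linear_maps K H (base_algebra K)"
  shows "(\<lambda>P. EA f (\<mu>A P)) \<in> comodule_alg_hom K H TX \<delta>TX A \<delta>"
proof (rule bialg.tensor_algebra_comodule_alg_homI[OF A \<delta>_hom])
  note Ef = scalar_specialisation[OF H A f]
  show hom: "(\<lambda>P. EA f (\<mu>A P)) \<in> alg_hom K TX A"
    by (rule alg_hom_comp[OF generic_alg_hom Ef(1)])
  fix h assume h: "h \<in> carrier H"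
  let ?m = "\<lambda>x a. f x \<odot> a"
  let ?g = "\<lambda>h. tensor_lift K A (\<lambda>x y. ?m x (j y)) (\<Delta> h)"
  note m = smult_functional_bilinear[OF f]
  have gen: "EA f (\<mu>A (XX h)) = ?g h" if "h \<in> carrier H" for h
    by (rule generic_specialisation[OF alg_homD(1)[OF Ef(1)] m Ef(2) that])
  have g: "?g \<in> linear_maps K H A"
    by (rule linear_maps_comp[OF bialg.comult_linear
          tensor_lift_linear[OF H H A bilinear_maps_precomp[OF m linear_maps_id j_linear]]])
  have "\<delta> (?m x a) = tensor_lift K (tensor K A H) (\<lambda>w z. pure_tensor K A H (?m x w) z) (\<delta> a)"
    if x: "x \<in> carrier H" and a: "a \<in> carrier A" for x a
  proof -
    interpret AH: assoc_algebra K "tensor K A H" by (rule AH)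
    have fx: "f x \<in> carrier K" using linear_maps_closed[OF f x] by (simp add: base_algebra_def)
    note pb = pure_tensor_bilinear[OF A H]
    have sm: "(\<lambda>p. f x \<odot>\<^bsub>tensor K A H\<^esub> p) \<in> linear_maps K (tensor K A H) (tensor K A H)"
      using fx by (intro bilinear_mapsD(1)[OF smult_bilinear[OF AH]]) (simp add: base_algebra_def)
    have bil: "(\<lambda>w z. pure_tensor K A H (?m x w) z) \<in> bilinear_maps K A H (tensor K A H)"
      by (rule bilinear_maps_precomp[OF pb bilinear_mapsD(1)[OF m x] linear_maps_id])
    have "f x \<odot>\<^bsub>tensor K A H\<^esub> p = tensor_lift K (tensor K A H) (\<lambda>w z. pure_tensor K A H (?m x w) z) p"
      if "p \<in> carrier (tensor K A H)" for p
      by (rule tensor_linear_eq[OF A H sm tensor_lift_linear[OF A H AH bil] _ that])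
        (simp add: tensor_lift_pure[OF A H AH bil] linear_maps_smult[OF bilinear_mapsD(2)[OF pb]] fx)
    then show ?thesis
      using fx a linear_maps_closed[OF \<delta>_linear a] by (simp add: linear_maps_smult[OF \<delta>_linear])
  qed
  then have "\<delta> (?g h) = tensor_map K A H ?g id (\<Delta> h)"
    by (intro bialg.twisted_comodule_hom[OF A A \<delta>_linear j_linear j_colinear m _ h])
  also have "\<dots> = tensor_map K A H (\<lambda>x. EA f (\<mu>A (XX x))) id (\<Delta> h)"
    by (rule tensor_map_cong[symmetric, OF H A H g gen D[OF h]])
  finally show "\<delta> (EA f (\<mu>A (XX h))) = \<dots>" using gen[OF h] by simp
qed

text \<open>\<open>B \<otimes> H\<close> is a cofree comodule: a colinear map into it is determined
  by its composite with \<open>p\<close>, which is \<open>id \<otimes> \<epsilon>\<close>.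
  Transporting \<open>g\<close> to \<open>B \<otimes> H\<close> and back along \<open>u\<close>
  gives the formula.\<close>

private lemma comodule_hom_form:
  assumes g: "g \<in> linear_maps K H A"
    and g_colinear: "\<And>h. h \<in> carrier H \<Longrightarrow> \<delta> (g h) = tensor_map K A H g id (\<Delta> h)"
  obtains f where "f \<in> linear_maps K H B"
    "\<And>h. h \<in> carrier H \<Longrightarrow> g h = tensor_lift K A (\<lambda>x y. f x \<otimes> j y) (\<Delta> h)"
proof -
  \<comment> \<open>A left inverse of the bijection \<open>u\<close> is its inverse; obtained in
    this way it comes with linearity.\<close>
  obtain v where v: "v \<in> linear_maps K A BH" and vu: "\<And>x. x \<in> carrier BH \<Longrightarrow> v (u x) = x"
    using linear_left_inverse[OF Km BHm Am u_linear bij_betw_imp_inj_on[OF u_bij]] by blast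
  have uv: "u (v a) = a" if a: "a \<in> carrier A" for a
  proof -
    obtain x where "x \<in> carrier BH" "a = u x"
      using a bij_betw_imp_surj_on[OF u_bij] by blast
    then show ?thesis using vu by simp
  qed
  note vc = linear_maps_closed[OF v]
  have v_colinear: "\<delta>BH (v a) = tensor_map K BH H v id (\<delta> a)" if a: "a \<in> carrier A" for a
  proof -
    have d: "\<delta>BH (v a) \<in> carrier (tensor K BH H)" using linear_maps_closed[OF \<delta>BH_linear vc[OF a]] .
    have "tensor_map K BH H v id (\<delta> a) = tensor_map K BH H (\<lambda>x. v (u x)) id (\<delta>BH (v a))"
      using u_colinear[OF vc[OF a]] uv[OF a] tensor_map_comp[OF BH A BH H u_linear v d] by simp
    also have "\<dots> = tensor_map K BH H (\<lambda>x. x) id (\<delta>BH (v a))"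
      by (rule tensor_map_cong[OF BH BH H linear_maps_id vu d])
    finally show ?thesis using tensor_map_id[OF BH H d] by simp
  qed
  let ?G = "\<lambda>h. v (g h)"
  have G: "?G \<in> linear_maps K H BH" by (rule linear_maps_comp[OF g v])
  have G_colinear: "\<delta>BH (?G h) = tensor_map K BH H ?G id (\<Delta> h)" if h: "h \<in> carrier H" for h
    using v_colinear[OF linear_maps_closed[OF g h]] g_colinear[OF h]
      tensor_map_comp[OF H A BH H g v D[OF h]] by simp
  note \<epsilon> = alg_homD(1)[OF bialg.counit_hom]
  have \<epsilon>_bil: "(\<lambda>b y. \<epsilon> y \<odot>\<^bsub>B\<^esub> b) \<in> bilinear_maps K B H B"
    by (rule bilinear_maps_swap[OF bilinear_maps_precomp[OF smult_bilinear[OF B] \<epsilon> linear_maps_id]])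
  define p where "p = tensor_lift K B (\<lambda>b y. \<epsilon> y \<odot>\<^bsub>B\<^esub> b)"
  have p: "p \<in> linear_maps K BH B" unfolding p_def by (rule tensor_lift_linear[OF B H B \<epsilon>_bil])
  have p_pure: "p (pure_tensor K B H b y) = \<epsilon> y \<odot>\<^bsub>B\<^esub> b" if "b \<in> carrier B" "y \<in> carrier H" for b y
    unfolding p_def by (rule tensor_lift_pure[OF B H B \<epsilon>_bil that])
  have pp: "(\<lambda>x y. pure_tensor K B H (p x) y) \<in> bilinear_maps K BH H BH"
    by (rule bilinear_maps_precomp[OF pureB p linear_maps_id])
  let ?\<Psi> = "tensor_lift K BH (\<lambda>x y. pure_tensor K B H (p x) y)"
  note \<Psi> = tensor_lift_linear[OF BH H BH pp]
  \<comment> \<open>The counit law makes \<open>p \<otimes> id\<close> after the coaction the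
    identity: \<open>b \<otimes> y\<close> goes to the sum of the tensors
    \<open>b \<otimes> y_(2)\<close> scaled by \<open>\<epsilon> y_(1)\<close>.\<close>
  have retract: "?\<Psi> (\<delta>BH x) = x" if "x \<in> carrier BH" for x
  proof (rule tensor_linear_eq[OF B H linear_maps_comp[OF \<delta>BH_linear \<Psi>] linear_maps_id _ that])
    fix b y assume b: "b \<in> carrier B" and y: "y \<in> carrier H"
    note Lb = bilinear_mapsD(1)[OF pureB b]
    have bil: "(\<lambda>w z. \<epsilon> w \<odot>\<^bsub>H\<^esub> z) \<in> bilinear_maps K H H H"
      by (rule bilinear_maps_precomp[OF smult_bilinear[OF H] \<epsilon> linear_maps_id])
    have "?\<Psi> (\<delta>BH (pure_tensor K B H b y)) =
        tensor_lift K BH (\<lambda>w z. ?\<Psi> (pure_tensor K BH H (pure_tensor K B H b w) z)) (\<Delta> y)"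
      unfolding free_coact_pure[OF H B H bialg.comult_hom b y]
      by (rule tensor_lift_comp[OF H H BHH tensor_assoc_bilinear[OF B H H b] BH \<Psi> D[OF y]])
    also have "\<dots> = tensor_lift K BH (\<lambda>w z. pure_tensor K B H b (\<epsilon> w \<odot>\<^bsub>H\<^esub> z)) (\<Delta> y)"
    proof (rule tensor_lift_cong[OF H H BH bilinear_maps_comp[OF bil Lb] _ D[OF y]])
      fix w z assume w: "w \<in> carrier H" and z: "z \<in> carrier H"
      have ew: "\<epsilon> w \<in> carrier K" using linear_maps_closed[OF \<epsilon> w] by (simp add: base_algebra_def)
      show "?\<Psi> (pure_tensor K BH H (pure_tensor K B H b w) z) = pure_tensor K B H b (\<epsilon> w \<odot>\<^bsub>H\<^esub> z)"
        using b w z ew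
        by (simp add: tensor_lift_pure[OF BH H BH pp] pure_tensor_closed[OF B H] p_pure
            linear_maps_smult[OF bilinear_mapsD(2)[OF pureB]] linear_maps_smult[OF Lb])
    qed
    also have "\<dots> = pure_tensor K B H b (tensor_lift K H (\<lambda>w z. \<epsilon> w \<odot>\<^bsub>H\<^esub> z) (\<Delta> y))"
      by (rule tensor_lift_comp[OF H H H bil BH Lb D[OF y], symmetric])
    also have "\<dots> = pure_tensor K B H b y" by (simp add: bialg.counit_left[OF y])
    finally show "?\<Psi> (\<delta>BH (pure_tensor K B H b y)) = pure_tensor K B H b y" .
  qed
  let ?f = "\<lambda>h. p (?G h)"
  have f: "?f \<in> linear_maps K H B" by (rule linear_maps_comp[OF G p])
  have fp: "(\<lambda>x z. pure_tensor K B H (?f x) z) \<in> bilinear_maps K H H BH"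
    by (rule bilinear_maps_precomp[OF pureB f linear_maps_id])
  have "g h = tensor_lift K A (\<lambda>x y. ?f x \<otimes> j y) (\<Delta> h)" if h: "h \<in> carrier H" for h
  proof -
    have "?G h = ?\<Psi> (tensor_map K BH H ?G id (\<Delta> h))"
      using retract[OF linear_maps_closed[OF G h]] G_colinear[OF h] by simp
    also have "\<dots> = tensor_lift K BH (\<lambda>x z. pure_tensor K B H (?f x) z) (\<Delta> h)"
      using tensor_lift_map[OF H H BH H G linear_maps_id' BH pp D[OF h]] by simp
    finally have "u (?G h) = tensor_lift K A (\<lambda>x z. u (pure_tensor K B H (?f x) z)) (\<Delta> h)"
      using tensor_lift_comp[OF H H BH fp A u_linear D[OF h]] by simp
    also have "\<dots> = tensor_lift K A (\<lambda>x y. ?f x \<otimes> j y) (\<Delta> h)"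
      by (rule tensor_lift_cong[OF H H A bilinear_maps_precomp[OF mult_bilinear[OF A]
              linear_maps_comp[OF f B_inclusion] j_linear] _ D[OF h]])
        (rule u_pure[OF linear_maps_closed[OF f]])
    finally show ?thesis using uv[OF linear_maps_closed[OF g h]] by simp
  qed
  then show ?thesis using that f by blast
qed

private lemma identities_eq_kernel: "IA = {P \<in> carrier TX. \<mu>A P = \<zero>\<^bsub>SHA\<^esub>}"
proof (intro equalityI subsetI)
  fix P assume P: "P \<in> IA"
  then have PT: "P \<in> carrier TX" by (simp add: identities_def)
  have "\<mu>A P = \<zero>\<^bsub>SHA\<^esub>"
  proof (rule scalar_specialisations_separate[OF H A infinite linear_maps_closed[OF generic_linear PT]])
    show "EA f (\<mu>A P) = \<zero>" if "f \<in> linear_maps K H (base_algebra K)" for f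
      using P specialisation_comodule[OF that] by (auto simp: identities_def)
  qed
  then show "P \<in> {P \<in> carrier TX. \<mu>A P = \<zero>\<^bsub>SHA\<^esub>}" using PT by simp
next
  fix P assume "P \<in> {P \<in> carrier TX. \<mu>A P = \<zero>\<^bsub>SHA\<^esub>}"
  then have P: "P \<in> carrier TX" "\<mu>A P = \<zero>\<^bsub>SHA\<^esub>" by auto
  have "\<mu> P = \<zero>" if \<mu>: "\<mu> \<in> comodule_alg_hom K H TX \<delta>TX A \<delta>" for \<mu>
  proof -
    have \<mu>_hom: "\<mu> \<in> alg_hom K TX A" using \<mu> by (simp add: comodule_alg_hom_def)
    note \<mu>_linear = alg_homD(1)[OF \<mu>_hom]
    obtain f where f: "f \<in> linear_maps K H B"
      and fg: "\<And>h. h \<in> carrier H \<Longrightarrow> \<mu> (XX h) = tensor_lift K A (\<lambda>x y. f x \<otimes> j y) (\<Delta> h)"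
      by (rule comodule_hom_form[OF linear_maps_comp[OF X \<mu>_linear]
            bialg.tensor_algebra_comodule_alg_homD[OF A \<mu>]]) auto
    note fA = linear_maps_comp[OF f B_inclusion]
    obtain \<Phi> where \<Phi>: "\<Phi> \<in> alg_hom K SHA A"
      and \<Phi>t: "\<And>v a. v \<in> carrier H \<Longrightarrow> a \<in> carrier A \<Longrightarrow> \<Phi> (pure_tensor K SH A (tH v) a) = f v \<otimes> a"
      using central_specialisation[OF H A fA central[OF linear_maps_closed[OF f]]] by blast
    \<comment> \<open>Both sides are algebra morphisms in \<open>P\<close>, and on a generator
      \<open>X_h\<close> the right side reproduces the sum \<open>fg\<close>.\<close>
    have "\<mu> P = \<Phi> (\<mu>A P)"
      by (rule tensor_algebra_hom_eq[OF H \<mu>_hom alg_hom_comp[OF generic_alg_hom \<Phi>] _ P(1)])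
        (simp add: fg generic_specialisation[OF alg_homD(1)[OF \<Phi>]
            bilinear_maps_precomp[OF mult_bilinear[OF A] fA linear_maps_id] \<Phi>t])
    then show ?thesis using P(2) linear_maps_zero[OF SAm Am alg_homD(1)[OF \<Phi>]] by simp
  qed
  then show "P \<in> IA" using P(1) by (simp add: identities_def)
qed

section \<open>The universal comodule algebra and its embedding\<close>

private lemma I_ideal: "ideal IA TX"
  unfolding identities_eq_kernel by (rule alg_hom_kernel_ideal[OF T SA generic_alg_hom])

private lemma U: "assoc_algebra K U"
  unfolding univ_algebra_def by (rule quot_algebra_algebra[OF T I_ideal])

private lemma \<pi>_hom: "\<pi> \<in> alg_hom K TX U"
  unfolding univ_algebra_def univ_proj_def[abs_def] by (rule quot_proj_alg_hom[OF T I_ideal])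

private lemmas \<pi>_linear = alg_homD(1)[OF \<pi>_hom]

private lemma U_carrier: "carrier U = \<pi> ` carrier TX"
  unfolding univ_algebra_def univ_proj_def[abs_def] by (rule quot_carrier[OF T I_ideal])

private lemma I_null: "P \<in> IA \<Longrightarrow> \<mu>A P = \<zero>\<^bsub>SHA\<^esub>"
  by (simp add: identities_eq_kernel)

private abbreviation (input) "\<nu> \<equiv> \<lambda>Y. the_elem (\<mu>A ` Y)"

private lemma \<nu>_hom: "\<nu> \<in> alg_hom K U SHA"
  unfolding univ_algebra_def
  by (rule quot_lift_alg_hom[OF T I_ideal SAm generic_alg_hom I_null])

private lemmas \<nu>_linear = alg_homD(1)[OF \<nu>_hom]

private lemma \<nu>_\<pi>: "P \<in> carrier TX \<Longrightarrow> \<nu> (\<pi> P) = \<mu>A P"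
  unfolding univ_proj_def by (rule quot_lift_eq[OF T I_ideal SAm generic_linear I_null])

private lemma \<pi>_eq_iff:
  assumes "P \<in> carrier TX" "Q \<in> carrier TX"
  shows "\<pi> P = \<pi> Q \<longleftrightarrow> \<mu>A P = \<mu>A Q"
proof -
  interpret T: assoc_algebra K TX by (rule T)
  interpret SA: assoc_algebra K SHA by (rule SA)
  have "\<pi> P = \<pi> Q \<longleftrightarrow> P \<ominus>\<^bsub>TX\<^esub> Q \<in> IA"
    unfolding univ_proj_def by (rule quot_eq_iff[OF T I_ideal assms])
  also have "\<dots> \<longleftrightarrow> \<mu>A P \<ominus>\<^bsub>SHA\<^esub> \<mu>A Q = \<zero>\<^bsub>SHA\<^esub>"
    using assms by (simp add: identities_eq_kernel linear_maps_minus[OF Tm SAm generic_linear])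
  finally show ?thesis
    using assms linear_maps_closed[OF generic_linear] by (simp add: SA.minus_eq_zero_iff)
qed

private lemma \<nu>_inj: "inj_on \<nu> (carrier U)"
proof (rule inj_onI)
  fix Y Z assume "Y \<in> carrier U" "Z \<in> carrier U" and eq: "\<nu> Y = \<nu> Z"
  then obtain P Q where "P \<in> carrier TX" "Q \<in> carrier TX" "Y = \<pi> P" "Z = \<pi> Q"
    unfolding U_carrier by blast
  then show "Y = Z" using eq by (simp add: \<nu>_\<pi> \<pi>_eq_iff)
qed

private lemmas UH = tensor_assoc_algebra[OF U H]
private lemmas Um = assoc_algebra.axioms(2)[OF U]
private lemmas \<delta>TX_linear = alg_homD(1)[OF bialg.tensor_algebra_coact_alg_hom]

private lemma generic_colinear:
  "P \<in> carrier TX \<Longrightarrow> \<delta>SA (\<mu>A P) = tensor_map K SHA H \<mu>A id (\<delta>TX P)"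
  using generic_comodule by (auto simp: comodule_alg_hom_def comodule_hom_def)

text \<open>The coset formula requires \<open>\<pi> \<otimes> id\<close> after the coaction to kill
  the identities. With \<open>r\<close> a linear left inverse of \<open>\<nu>\<close>, the
  projection \<open>\<pi>\<close> is \<open>r\<close> after \<open>\<mu>A\<close>; as
  \<open>\<mu>A\<close> is colinear and vanishes on identities, so does the composite. Linearity of
  \<open>r\<close> is all that tensoring with \<open>H\<close> demands.\<close>

private lemma univ_coact_proj:
  assumes P: "P \<in> carrier TX"
  shows "\<delta>U (\<pi> P) = tensor_map K U H \<pi> id (\<delta>TX P)"
  unfolding univ_coact_def univ_proj_def[of K H \<Delta> A \<delta> P]
proof (rule quot_lift_eq[OF T I_ideal assoc_algebra.axioms(2)[OF UH] _ _ P])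
  show "(\<lambda>P. tensor_map K U H \<pi> id (\<delta>TX P)) \<in> linear_maps K TX (tensor K U H)"
    by (rule linear_maps_comp[OF \<delta>TX_linear tensor_map_linear[OF T H U H \<pi>_linear linear_maps_id']])
next
  fix Q assume Q: "Q \<in> IA"
  then have QT: "Q \<in> carrier TX" by (simp add: identities_def)
  note d = linear_maps_closed[OF \<delta>TX_linear QT]
  obtain r where r: "r \<in> linear_maps K SHA U" "\<And>x. x \<in> carrier U \<Longrightarrow> r (\<nu> x) = x"
    using linear_left_inverse[OF Km Um SAm \<nu>_linear \<nu>_inj] by blast
  have r_\<mu>: "r (\<mu>A P) = \<pi> P" if "P \<in> carrier TX" for P
    using r(2)[of "\<pi> P"] that linear_maps_closed[OF \<pi>_linear that] by (simp add: \<nu>_\<pi>)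
  have "tensor_map K U H \<pi> id (\<delta>TX Q) = tensor_map K U H (\<lambda>P. r (\<mu>A P)) id (\<delta>TX Q)"
    by (rule tensor_map_cong[symmetric, OF T U H \<pi>_linear r_\<mu> d])
  also have "\<dots> = tensor_map K U H r id (\<delta>SA (\<mu>A Q))"
    unfolding generic_colinear[OF QT]
    by (rule tensor_map_comp[OF T SA U H generic_linear r(1) d, symmetric])
  also have "\<dots> = \<zero>\<^bsub>tensor K U H\<^esub>"
    using I_null[OF Q] linear_maps_zero[OF SAm assoc_algebra.axioms(2)[OF UH]
        linear_maps_comp[OF \<delta>SA_linear tensor_map_linear[OF SA H U H r(1) linear_maps_id']]] by simp
  finally show "tensor_map K U H \<pi> id (\<delta>TX Q) = \<zero>\<^bsub>tensor K U H\<^esub>" .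
qed

private lemma \<nu>_comodule: "\<nu> \<in> comodule_alg_hom K H U \<delta>U SHA \<delta>SA"
proof -
  have "\<delta>SA (\<nu> (\<pi> P)) = tensor_map K SHA H \<nu> id (\<delta>U (\<pi> P))" if P: "P \<in> carrier TX" for P
  proof -
    note d = linear_maps_closed[OF \<delta>TX_linear P]
    have "tensor_map K SHA H \<nu> id (\<delta>U (\<pi> P)) = tensor_map K SHA H (\<lambda>P. \<nu> (\<pi> P)) id (\<delta>TX P)"
      unfolding univ_coact_proj[OF P]
      by (rule tensor_map_comp[OF T U SA H \<pi>_linear \<nu>_linear d])
    also have "\<dots> = tensor_map K SHA H \<mu>A id (\<delta>TX P)"
      by (rule tensor_map_cong[OF T SA H generic_linear \<nu>_\<pi> d])
    finally show ?thesis using P by (simp add: \<nu>_\<pi> generic_colinear)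
  qed
  then show ?thesis
    using \<nu>_hom \<nu>_linear by (auto simp: comodule_alg_hom_def comodule_hom_def U_carrier)
qed

lemma generic_map_factorisation:
  "\<exists>\<nu> \<in> comodule_alg_hom K H (univ_algebra K H \<Delta> A \<delta>) (univ_coact K H \<Delta> A \<delta>)
      (tensor K (sym_algebra K H) A) (free_coact K H (sym_algebra K H) A \<delta>).
    (\<forall>P \<in> carrier (tensor_algebra K H). \<nu> (univ_proj K H \<Delta> A \<delta> P) = generic_map K H \<Delta> A \<delta> u P) \<and>
    inj_on \<nu> (carrier (univ_algebra K H \<Delta> A \<delta>))"
  using \<nu>_comodule \<nu>_\<pi> \<nu>_inj by (intro bexI[of _ \<nu>]) auto

section \<open>Degrees zero and one of the universal algebra\<close>

context
  assumes nontrivial: "\<one> \<noteq> \<zero>"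
begin

interpretation T: assoc_algebra K TX by (rule T)
interpretation U: assoc_algebra K U by (rule U)
interpretation SA: assoc_algebra K SHA by (rule SA)

private abbreviation (input) "\<iota>0 \<equiv> \<lambda>c. \<pi> (c \<odot>\<^bsub>TX\<^esub> \<one>\<^bsub>TX\<^esub>)"
private abbreviation (input) "\<iota>1 \<equiv> \<lambda>h. \<pi> (XX h)"

private lemma \<epsilon>_linear: "\<epsilon> \<in> linear_maps K H (base_algebra K)"
  by (rule alg_homD(1)[OF bialg.counit_hom])

private lemma \<iota>0_image: "univ_deg K H \<Delta> A \<delta> 0 = \<iota>0 ` carrier K"
  by (simp add: univ_deg_def tensor_power_0[OF H] image_image)

private lemma \<iota>1_image: "univ_deg K H \<Delta> A \<delta> 1 = \<iota>1 ` carrier H"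
  by (simp only: univ_deg_def tensor_power_1[OF H] image_image)

private lemma \<iota>0_eq: "c \<in> carrier K \<Longrightarrow> \<iota>0 c = c \<odot>\<^bsub>U\<^esub> \<one>\<^bsub>U\<^esub>"
  by (simp add: linear_maps_smult[OF \<pi>_linear] alg_homD(2)[OF \<pi>_hom])

lemma univ_deg_0_hom:
  "(\<lambda>c. univ_proj K H \<Delta> A \<delta> (c \<odot>\<^bsub>tensor_algebra K H\<^esub> \<one>\<^bsub>tensor_algebra K H\<^esub>)) \<in>
    alg_hom K (base_algebra K)
      (univ_algebra K H \<Delta> A \<delta>\<lparr>carrier := univ_deg K H \<Delta> A \<delta> 0\<rparr>)"
proof (intro alg_homI linear_mapsI)
  fix c assume c: "c \<in> carrier (base_algebra K)"
  then show "\<iota>0 c \<in> carrier (U\<lparr>carrier := univ_deg K H \<Delta> A \<delta> 0\<rparr>)"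
    by (simp add: \<iota>0_image base_algebra_def)
qed (simp_all add: base_algebra_def \<iota>0_eq alg_homD(2)[OF \<pi>_hom] U.smult_l_distr U.smult_assoc1
    U.smult_mult_left)

text \<open>Specialising at \<open>\<epsilon>\<close> turns the image of \<open>c\<close> into
  \<open>c\<close> times the unit of \<open>A\<close>, and a nonzero unit lets \<open>c\<close> be
  recovered.\<close>

lemma univ_deg_0_bij:
  "bij_betw (\<lambda>c. univ_proj K H \<Delta> A \<delta> (c \<odot>\<^bsub>tensor_algebra K H\<^esub> \<one>\<^bsub>tensor_algebra K H\<^esub>))
    (carrier K) (univ_deg K H \<Delta> A \<delta> 0)"
proof -
  note Ef = scalar_specialisation[OF H A \<epsilon>_linear]
  have EA: "EA \<epsilon> (\<mu>A (c \<odot>\<^bsub>TX\<^esub> \<one>\<^bsub>TX\<^esub>)) = c \<odot> \<one>" if "c \<in> carrier K" for c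
    using that
    by (simp add: linear_maps_smult[OF generic_linear] alg_homD(2)[OF generic_alg_hom]
        linear_maps_smult[OF alg_homD(1)[OF Ef(1)]] alg_homD(2)[OF Ef(1)])
  have "c = d" if "c \<in> carrier K" "d \<in> carrier K" "\<iota>0 c = \<iota>0 d" for c d
  proof -
    have "\<mu>A (c \<odot>\<^bsub>TX\<^esub> \<one>\<^bsub>TX\<^esub>) = \<mu>A (d \<odot>\<^bsub>TX\<^esub> \<one>\<^bsub>TX\<^esub>)"
      using that \<pi>_eq_iff by simp
    then have "c \<odot> \<one> = d \<odot> \<one>" using EA that by metis
    then show ?thesis using that nontrivial by (intro smult_right_cancel[OF Km Am]) auto
  qed
  then show ?thesis unfolding bij_betw_def \<iota>0_image by (auto intro!: inj_onI)
qed

text \<open>Colinearity is included so that the identification of degree one with \<open>X_H\<close>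
  is one of comodules and not only of vector spaces.\<close>

lemma univ_deg_1_hom:
  "(\<lambda>h. univ_proj K H \<Delta> A \<delta> (tensor_algebra_gen K H h)) \<in>
    comodule_hom K H H \<Delta> (univ_algebra K H \<Delta> A \<delta>) (univ_coact K H \<Delta> A \<delta>)"
proof -
  have "\<delta>U (\<iota>1 h) = tensor_map K U H \<iota>1 id (\<Delta> h)" if h: "h \<in> carrier H" for h
    using univ_coact_proj[OF linear_maps_closed[OF X h]] h
      tensor_map_comp[OF H T U H X \<pi>_linear D[OF h]] by (simp add: bialg.tensor_algebra_coact_gen)
  then show ?thesis using linear_maps_comp[OF X \<pi>_linear] by (simp add: comodule_hom_def)
qed

text \<open>Injectivity is inherited from \<open>j\<close>, which is \<open>u\<close> after
  inserting the unit of \<open>B\<close>; the latter step is injective because that unit is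
  nonzero.\<close>

lemma univ_deg_1_bij:
  "bij_betw (\<lambda>h. univ_proj K H \<Delta> A \<delta> (tensor_algebra_gen K H h))
    (carrier H) (univ_deg K H \<Delta> A \<delta> 1)"
proof -
  note Ef = scalar_specialisation[OF H A \<epsilon>_linear]
  have bil: "(\<lambda>x y. \<epsilon> x \<odot>\<^bsub>H\<^esub> y) \<in> bilinear_maps K H H H"
    by (rule bilinear_maps_precomp[OF smult_bilinear[OF H] \<epsilon>_linear linear_maps_id])
  have EA: "EA \<epsilon> (\<mu>A (XX h)) = j h" if h: "h \<in> carrier H" for h
  proof -
    have "EA \<epsilon> (\<mu>A (XX h)) = tensor_lift K A (\<lambda>x y. \<epsilon> x \<odot> j y) (\<Delta> h)"
      by (rule generic_specialisation[OF alg_homD(1)[OF Ef(1)] smult_functional_bilinear[OF \<epsilon>_linear] Ef(2) h])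
    \<comment> \<open>With the scalar moved inside \<open>j\<close>, the argument sums up
      \<open>h_(2)\<close> scaled by \<open>\<epsilon> h_(1)\<close>, which is \<open>h\<close> by
      the counit law.\<close>
    also have "\<dots> = tensor_lift K A (\<lambda>x y. j (\<epsilon> x \<odot>\<^bsub>H\<^esub> y)) (\<Delta> h)"
      using linear_maps_closed[OF \<epsilon>_linear]
      by (intro tensor_lift_cong[OF H H A bilinear_maps_comp[OF bil j_linear] _ D[OF h]])
        (simp add: linear_maps_smult[OF j_linear] base_algebra_def)
    also have "\<dots> = j h"
      using tensor_lift_comp[OF H H H bil A j_linear D[OF h]] bialg.counit_left[OF h] by simp
    finally show ?thesis .
  qed
  have "\<one>\<^bsub>B\<^esub> \<notin> {\<zero>\<^bsub>B\<^esub>}" using nontrivial by (simp add: coinvariants_def)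
  \<comment> \<open>Applying such a functional to the first factor of \<open>1 \<otimes> h\<close>
    gives \<open>h\<close> back. It exists because \<open>B\<close> shares its unit and zero with
    the nonzero algebra \<open>A\<close>.\<close>
  then obtain l where l: "l \<in> linear_maps K B (base_algebra K)" "l \<one>\<^bsub>B\<^esub> = \<one>\<^bsub>K\<^esub>"
    using separating_functional[OF Km B.module_axioms zero_submodule[OF B.module_axioms] one_B] by auto
  have lb: "(\<lambda>b y. l b \<odot>\<^bsub>H\<^esub> y) \<in> bilinear_maps K B H H"
    by (rule bilinear_maps_precomp[OF smult_bilinear[OF H] l(1) linear_maps_id])
  have pure_inj: "h = h'" if hh: "h \<in> carrier H" "h' \<in> carrier H"
    "pure_tensor K B H \<one>\<^bsub>B\<^esub> h = pure_tensor K B H \<one>\<^bsub>B\<^esub> h'" for h h'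
  proof -
    interpret H: assoc_algebra K H by (rule H)
    have "tensor_lift K H (\<lambda>b y. l b \<odot>\<^bsub>H\<^esub> y) (pure_tensor K B H \<one>\<^bsub>B\<^esub> y) = y" if "y \<in> carrier H" for y
      using that module.smult_one[OF Hm] by (simp add: tensor_lift_pure[OF B H H lb one_B that] l(2))
    then show ?thesis using hh by metis
  qed
  have "h = h'" if "h \<in> carrier H" "h' \<in> carrier H" "\<iota>1 h = \<iota>1 h'" for h h'
  proof -
    have "\<mu>A (XX h) = \<mu>A (XX h')"
      using that \<pi>_eq_iff linear_maps_closed[OF X] by blast
    then have "j h = j h'" using EA that by metis
    then have "pure_tensor K B H \<one>\<^bsub>B\<^esub> h = pure_tensor K B H \<one>\<^bsub>B\<^esub> h'"
      by (rule inj_onD[OF bij_betw_imp_inj_on[OF u_bij] _ pure_tensor_closed[OF B H one_B that(1)]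
            pure_tensor_closed[OF B H one_B that(2)]])
    then show ?thesis using pure_inj that by blast
  qed
  then show ?thesis unfolding bij_betw_def \<iota>1_image by (auto intro!: inj_onI)
qed

end

end

text \<open>The isomorphisms of part (b) are given by explicit maps, for nonzero \<open>A\<close>
  only: the zero algebra satisfies (i) and (ii), but every element of the tensor algebra is then an
  identity, and the universal algebra is zero in degree zero instead of the field.\<close>

theorem corollary4p4:
  fixes K :: "'k ring" and H :: "('k, 'h) module" and A :: "('k, 'a) module"
    and \<Delta> :: "'h \<Rightarrow> ('h \<times> 'h \<Rightarrow> 'k) set" and \<epsilon> :: "'h \<Rightarrow> 'k" and S :: "'h \<Rightarrow> 'h"
    and \<delta> :: "'a \<Rightarrow> ('a \<times> 'h \<Rightarrow> 'k) set" and u :: "('a \<times> 'h \<Rightarrow> 'k) set \<Rightarrow> 'a"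
  defines "B \<equiv> coinvariants K H A \<delta>"
    and "U \<equiv> univ_algebra K H \<Delta> A \<delta>"
    and "\<delta>U \<equiv> univ_coact K H \<Delta> A \<delta>"
    and "\<pi> \<equiv> univ_proj K H \<Delta> A \<delta>"
    and "SA \<equiv> tensor K (sym_algebra K H) A"
    and "\<delta>SA \<equiv> free_coact K H (sym_algebra K H) A \<delta>"
  assumes field: "field K" and infinite: "infinite (carrier K)"
    and hopf: "hopf_algebra K H \<Delta> \<epsilon> S"
    and comod_alg: "comodule_algebra K H \<Delta> \<epsilon> A \<delta>"
    and central: "\<And>b a. b \<in> carrier B \<Longrightarrow> a \<in> carrier A \<Longrightarrow> b \<otimes>\<^bsub>A\<^esub> a = a \<otimes>\<^bsub>A\<^esub> b"
    and u_comod: "u \<in> comodule_hom K H (tensor K B H) (free_coact K H B H \<Delta>) A \<delta>"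
    and u_bij: "bij_betw u (carrier (tensor K B H)) (carrier A)"
    and u_lin: "\<And>b x. b \<in> carrier B \<Longrightarrow> x \<in> carrier (tensor K B H) \<Longrightarrow>
       u (tensor_map K B H (\<lambda>b'. b \<otimes>\<^bsub>B\<^esub> b') id x) = b \<otimes>\<^bsub>A\<^esub> u x"
  shows "(\<exists>\<nu> \<in> comodule_alg_hom K H U \<delta>U SA \<delta>SA.
            (\<forall>P \<in> carrier (tensor_algebra K H). \<nu> (\<pi> P) = generic_map K H \<Delta> A \<delta> u P) \<and>
            inj_on \<nu> (carrier U))
       \<and> (\<one>\<^bsub>A\<^esub> \<noteq> \<zero>\<^bsub>A\<^esub> \<longrightarrow>
            (let \<iota>0 = (\<lambda>c. \<pi> (c \<odot>\<^bsub>tensor_algebra K H\<^esub> \<one>\<^bsub>tensor_algebra K H\<^esub>));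
                 \<iota>1 = (\<lambda>h. \<pi> (tensor_algebra_gen K H h))
             in \<iota>0 \<in> alg_hom K (base_algebra K) (U\<lparr>carrier := univ_deg K H \<Delta> A \<delta> 0\<rparr>)
                \<and> bij_betw \<iota>0 (carrier K) (univ_deg K H \<Delta> A \<delta> 0)
                \<and> \<iota>1 \<in> comodule_hom K H H \<Delta> U \<delta>U
                \<and> bij_betw \<iota>1 (carrier H) (univ_deg K H \<Delta> A \<delta> 1)))"
proof -
  note hyps = infinite comod_alg central[unfolded B_def] u_comod[unfolded B_def]
    u_bij[unfolded B_def] u_lin[unfolded B_def]
  show ?thesis
    unfolding U_def \<delta>U_def \<pi>_def SA_def \<delta>SA_def Let_def
    by (intro conjI impI generic_map_factorisation[OF hyps] univ_deg_0_hom[OF hyps]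
        univ_deg_0_bij[OF hyps] univ_deg_1_hom[OF hyps] univ_deg_1_bij[OF hyps])
qed

end
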